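(* Let $p>1/3$ and $u_-<u_+$. Assume $f\in C^4(\mathbb{R})$ with $f''(u)>0$ $(u\in\mathbb{R})$, and $\sigma\in C^2(\mathbb{R})$ with $$\sigma(0)=0,\qquad \sigma'(v)>0\ (v\in\mathbb{R}),\qquad |\sigma(v)|\sim|v|^p,\quad |\sigma'(v)|\sim|v|^{p-1}\quad(|v|\to\infty).$$ Assume further $u_0-u_0^{\rm R}\in L^2$, $\partial_x u_0\in H^1$, and $u_0-u_0^{\rm R}\in L^1$. Then the unique global in time solution $u$ of the Cauchy problem $$\partial_t u+\partial_x\big(f(u)-\sigma(\partial_x u)\big)=0\ \ (t>0,\ x\in\mathbb{R}),\qquad u(0,x)=u_0(x)\to u_\pm\ \ (x\to\pm\infty)$$ satisfies, for every $q\in(1,\infty)$ and every $\epsilon>0$, $$\Big\|u(t)-u^r\Big(\frac{\cdot}{t};u_-,u_+\Big)\Big\|_{L^1}\le C_{u_0,\epsilon}(1+t)^{\epsilon}\quad(t\ge0),$$ $$\Big\|u(t)-u^r\Big(\frac{\cdot}{t};u_-,u_+\Big)\Big\|_{L^q}\le C_{u_0}(1+t)^{-\frac12\left(1-\frac1q\right)}\max\{1,\ln(1+t)\}\quad(t\ge0),$$ $$\Big\|u(t)-u^r\Big(\frac{\cdot}{t};u_-,u_+\Big)\Big\|_{L^\infty}\le C_{u_0,\epsilon}(1+t)^{-\frac12+\epsilon}\quad(t\ge0).$$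
   Context: $L^q=L^q(\mathbb{R})$, $H^k=H^k(\mathbb{R})$ are the usual Lebesgue and $L^2$-based Sobolev spaces in $x$. $g(v)\sim h(v)$ as $|v|\to\infty$ means that $C^{-1}h(v)\le g(v)\le C\,h(v)$ for some $C\ge1$ and all sufficiently large $|v|$. The Riemann data are $u_0^{\rm R}(x)=u_-$ for $x<0$ and $u_0^{\rm R}(x)=u_+$ for $x>0$. The rarefaction wave connecting $u_-$ to $u_+$ is $$u^r\Big(\frac xt;u_-,u_+\Big)=\begin{cases}u_-& (x\le f'(u_-)t),\\ (f')^{-1}(x/t)&(f'(u_-)t\le x\le f'(u_+)t),\\ u_+&(x\ge f'(u_+)t),\end{cases}$$ which at $t=0$ is read as $u_0^{\rm R}$. The unique global in time solution is the one in the class $u-u_0^{\rm R}\in C^0\cap L^\infty([0,\infty);L^2)$, $\partial_x u\in C^0\cap L^\infty([0,\infty);H^1)\cap L^2_{\rm loc}(0,\infty;H^2)$, $\partial_t u\in C^0\cap L^\infty([0,\infty);L^2)\cap L^2_{\rm loc}(0,\infty;H^1)$. $C_{\alpha,\beta,\dots}$ denotes a generic positive constant independent of $t$, the subscripts emphasizing dependence; such constants may also depend on the fixed data ($f,\sigma,p,u_\pm$) and on the exponent $q$. *)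

theory Defs
  imports "HOL-Analysis.Analysis" "HOL-Probability.Essential_Supremum"
begin

section \<open>Classical notions on the real line\<close>

definition C_diff :: "nat \<Rightarrow> (real \<Rightarrow> real) \<Rightarrow> bool" where
  "C_diff n g \<longleftrightarrow> (\<forall>j<n. (deriv ^^ j) g differentiable_on UNIV) \<and>
                 continuous_on UNIV ((deriv ^^ n) g)"

definition sim_infinity :: "(real \<Rightarrow> real) \<Rightarrow> (real \<Rightarrow> real) \<Rightarrow> bool" where
  "sim_infinity g h \<longleftrightarrow>
     (\<exists>C\<ge>1. \<exists>R. \<forall>v. \<bar>v\<bar> \<ge> R \<longrightarrow> inverse C * h v \<le> g v \<and> g v \<le> C * h v)"

section \<open>Lebesgue and Sobolev spaces\<close>

text \<open>
  Elements of these spaces are represented by functions; all notions below are invariant under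
  modification on null sets.  The norms are real valued and therefore carry information only
  together with membership in the corresponding space.
\<close>

definition Lq :: "real \<Rightarrow> (real \<Rightarrow> real) set" where
  "Lq q = {g. g \<in> borel_measurable lebesgue \<and> integrable lebesgue (\<lambda>x. \<bar>g x\<bar> powr q)}"

definition Lq_norm :: "real \<Rightarrow> (real \<Rightarrow> real) \<Rightarrow> real" where
  "Lq_norm q g = (LINT x|lebesgue. \<bar>g x\<bar> powr q) powr (1 / q)"

text \<open>The value is \<open>\<infinity>\<close> for functions that are not measurable or not essentially bounded.\<close>

definition Linf_norm :: "(real \<Rightarrow> real) \<Rightarrow> ereal" where
  "Linf_norm g = esssup lebesgue (\<lambda>x. ereal \<bar>g x\<bar>)"

definition test_fun :: "(real \<Rightarrow> real) \<Rightarrow> bool" where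
  "test_fun \<phi> \<longleftrightarrow> (\<forall>n. C_diff n \<phi>) \<and> bounded {x. \<phi> x \<noteq> 0}"

definition locally_integrable :: "(real \<Rightarrow> real) \<Rightarrow> bool" where
  "locally_integrable g \<longleftrightarrow> (\<forall>a b. set_integrable lebesgue {a..b} g)"

definition has_weak_deriv :: "(real \<Rightarrow> real) \<Rightarrow> (real \<Rightarrow> real) \<Rightarrow> bool" where
  "has_weak_deriv g g' \<longleftrightarrow> locally_integrable g \<and> locally_integrable g' \<and>
     (\<forall>\<phi>. test_fun \<phi> \<longrightarrow>
        (LINT x|lebesgue. g x * deriv \<phi> x) = - (LINT x|lebesgue. g' x * \<phi> x))"

text \<open>A representative of the weak derivative, which is unique up to null sets.\<close>

definition weak_deriv :: "(real \<Rightarrow> real) \<Rightarrow> real \<Rightarrow> real" where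
  "weak_deriv g = (SOME g'. has_weak_deriv g g')"

primrec Hk :: "nat \<Rightarrow> (real \<Rightarrow> real) set" where
  "Hk 0 = Lq 2"
| "Hk (Suc k) = {g \<in> Lq 2. \<exists>g'\<in>Hk k. has_weak_deriv g g'}"

definition Hk_norm :: "nat \<Rightarrow> (real \<Rightarrow> real) \<Rightarrow> real" where
  "Hk_norm k g = sqrt (\<Sum>j\<le>k. (Lq_norm 2 ((weak_deriv ^^ j) g))\<^sup>2)"

section \<open>Functions of time with values in Sobolev spaces\<close>

text \<open>A function of time and space is curried with time first: \<open>v t x\<close>.\<close>

definition CB_Hk :: "nat \<Rightarrow> (real \<Rightarrow> real \<Rightarrow> real) \<Rightarrow> bool" where
  \<comment> \<open>\<open>v\<close> belongs to \<open>C^0([0,\<infinity>); H^k)\<close> and to \<open>L^\<infinity>([0,\<infinity>); H^k)\<close>\<close>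
  "CB_Hk k v \<longleftrightarrow>
     (\<forall>t\<ge>0. v t \<in> Hk k) \<and>
     (\<forall>t\<ge>0. ((\<lambda>s. Hk_norm k (\<lambda>x. v s x - v t x)) \<longlongrightarrow> 0) (at t within {0..})) \<and>
     (\<exists>B. \<forall>t\<ge>0. Hk_norm k (v t) \<le> B)"

definition L2loc_Hk :: "nat \<Rightarrow> (real \<Rightarrow> real \<Rightarrow> real) \<Rightarrow> bool" where
  \<comment> \<open>\<open>v\<close> belongs to \<open>L^2_loc(0,\<infinity>; H^k)\<close>: strong (Bochner) measurability, and square
      integrability of the norm on compact subintervals of the open half line\<close>
  "L2loc_Hk k v \<longleftrightarrow>
     (AE t in lebesgue_on {0<..}. v t \<in> Hk k) \<and>
     (\<exists>s. (\<forall>n. simple_function (lebesgue_on {0<..}) (s n) \<and> (\<forall>t>0. s n t \<in> Hk k)) \<and>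
          (AE t in lebesgue_on {0<..}. (\<lambda>n. Hk_norm k (\<lambda>x. s n t x - v t x)) \<longlonglongrightarrow> 0)) \<and>
     (\<forall>a b. 0 < a \<longrightarrow> a < b \<longrightarrow> set_integrable lebesgue {a..b} (\<lambda>t. (Hk_norm k (v t))\<^sup>2))"

text \<open>
  Since the time derivative of a solution is required to be continuous with values in \<open>L^2\<close>
  on the closed half line, it is the limit in \<open>L^2\<close> of the difference quotients
  (one-sided at time zero).  The function \<open>v\<close> itself need not be in \<open>L^2\<close>,
  only its increments in time.
\<close>

definition has_time_deriv :: "(real \<Rightarrow> real \<Rightarrow> real) \<Rightarrow> (real \<Rightarrow> real \<Rightarrow> real) \<Rightarrow> bool" where
  "has_time_deriv v v' \<longleftrightarrow>
     (\<forall>t\<ge>0. (\<forall>s\<ge>0. (\<lambda>x. v s x - v t x) \<in> Lq 2) \<and> v' t \<in> Lq 2 \<and>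
       ((\<lambda>s. Lq_norm 2 (\<lambda>x. (v s x - v t x) / (s - t) - v' t x)) \<longlongrightarrow> 0)
          (at t within {0..}))"

section \<open>The Riemann data, the rarefaction wave and the Cauchy problem\<close>

text \<open>The value of the Riemann data at the origin is immaterial.\<close>

definition riemann_data :: "real \<Rightarrow> real \<Rightarrow> real \<Rightarrow> real" where
  "riemann_data um up x = (if x < 0 then um else up)"

definition rarefaction :: "(real \<Rightarrow> real) \<Rightarrow> real \<Rightarrow> real \<Rightarrow> real \<Rightarrow> real \<Rightarrow> real" where
  "rarefaction f um up t x =
     (if t = 0 then riemann_data um up x
      else if x \<le> deriv f um * t then um
      else if x \<le> deriv f up * t then inv (deriv f) (x / t)
      else up)"

text \<open>
  The equation is \<open>u_t + (f(u) - \<sigma>(u_x))_x = 0\<close>.  Here \<open>ux\<close> and \<open>ut\<close> are the partial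
  derivatives of \<open>u\<close>, and the equation says that the flux at each positive time has the weak
  \<open>x\<close>-derivative \<open>- ut\<close>.
\<close>

definition global_solution ::
  "(real \<Rightarrow> real) \<Rightarrow> (real \<Rightarrow> real) \<Rightarrow> real \<Rightarrow> real \<Rightarrow> (real \<Rightarrow> real) \<Rightarrow>
   (real \<Rightarrow> real \<Rightarrow> real) \<Rightarrow> bool" where
  "global_solution f \<sigma> um up u0 u \<longleftrightarrow>
     (\<exists>ux ut.
        CB_Hk 0 (\<lambda>t x. u t x - riemann_data um up x) \<and>
        (\<forall>t\<ge>0. has_weak_deriv (u t) (ux t)) \<and> CB_Hk 1 ux \<and> L2loc_Hk 2 ux \<and>
        has_time_deriv u ut \<and> CB_Hk 0 ut \<and> L2loc_Hk 1 ut \<and>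
        (\<forall>t>0. has_weak_deriv (\<lambda>x. f (u t x) - \<sigma> (ux t x)) (\<lambda>x. - ut t x)) \<and>
        (AE x in lebesgue. u 0 x = u0 x))"

end

theory Submission
  imports Defs "HOL-Computational_Algebra.Polynomial"
begin

text \<open>Let \<open>u\<close> be a solution and \<open>\<phi> t = u\<^sup>r (1 + t)\<close> the rarefaction wave started one unit of time earlier.
  The regularity class bounds \<open>u\<^sub>x\<close> uniformly, so \<open>\<sigma>'\<close> stays above a positive constant along the solution
  and the equation is uniformly parabolic there.  The wave \<open>\<phi>\<close> is Lipschitz, solves the inviscid
  conservation law exactly off its two corners, and differs from \<open>u\<^sup>r t\<close> by \<open>O(1 / (1 + t))\<close> on an interval of
  length \<open>O(1 + t)\<close> and by nothing outside, which is at least as good as each of the claimed rates.  It remains to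
  estimate \<open>w = u - \<phi>\<close>.

  The engine is one energy inequality for all convex \<open>\<eta>\<close> with \<open>\<eta> 0 = \<eta>' 0 = 0\<close>
  (lemma \<open>energy_dissipation\<close>): the time derivative of \<open>\<integral>\<eta>(w)\<close> is at most
  \<open>C sup |\<eta>'(w)| / (1 + t) - c \<integral>\<eta>''(w) w\<^sub>x\<^sup>2\<close>.  The convective part of the derivative is nonpositive because
  \<open>f'\<close> and \<open>\<phi> t\<close> are increasing (\<open>convection_dissipative\<close>), and the first term is the work of the stress
  \<open>\<sigma>(\<phi>\<^sub>x)\<close> of the wave itself, which has size and total variation \<open>O(1 / (1 + t))\<close> (\<open>wave_stress_bound\<close>).

  With \<open>\<eta>\<close> close to \<open>|w|\<close> the inequality says that the mass \<open>\<integral>|w|\<close> grows at most logarithmically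
  (\<open>L1_growth\<close>).  With \<open>\<eta> = w^(2m)\<close> the dissipation controls the supremum of \<open>|w|\<close> through the mass
  (\<open>sup_by_mass_and_dissipation\<close>, a Nash inequality), and a barrier argument gives the heat-equation rate
  for every even moment, up to powers of the logarithm (\<open>even_moment_decay\<close>).  Interpolation between the mass and
  a large even moment yields all the spaces \<open>L^q\<close>.  For the supremum, \<open>sup |w|^(2m+2)\<close> is at most a constant
  times \<open>\<integral>w^(2m) \<integral>w\<^sub>x\<^sup>2\<close>, the last factor is bounded by the regularity class, and the exponent obtained
  tends to \<open>1/2\<close> as \<open>m\<close> grows.

  The constants found in this way depend on the solution through its bounds.  Solutions with the
  same initial data agree almost everywhere at each time (\<open>regular_solution_unique\<close>, Gronwall's
  inequality for the \<open>L\<^sup>2\<close> distance), so the constants of one solution serve for all.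

  To compute with solutions that are only given in the weak sense, a function with a locally
  integrable weak derivative is shown to be a primitive of it up to a null set
  (\<open>weak_deriv_imp_is_primitive\<close>).  Primitives obey the product rule (\<open>is_primitive_mult\<close>), so integrations by
  parts are legitimate for the flux, whose derivative is merely square integrable.\<close>

section \<open>Smooth functions with compact support\<close>

text \<open>The functions \<open>p(1/x) exp(-1/x)\<close>, extended by zero to \<open>x \<le> 0\<close>: this family contains all the
  derivatives of its member with \<open>p = 1\<close>.\<close>

definition flat_exp :: "real poly \<Rightarrow> real \<Rightarrow> real" where
  "flat_exp p x = (if x > 0 then poly p (1 / x) * exp (- (1 / x)) else 0)"

lemma poly_mult_exp_tendsto_0: "((\<lambda>y. poly p y * exp (- y)) \<longlongrightarrow> (0::real)) at_top"
proof -
  have "((\<lambda>y. \<Sum>i\<le>degree p. coeff p i * (y ^ i / exp y)) \<longlongrightarrow> (\<Sum>i\<le>degree p. coeff p i * 0)) at_top"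
    by (intro tendsto_sum tendsto_mult tendsto_const tendsto_power_div_exp_0)
  then show ?thesis
    by (simp add: poly_altdef sum_distrib_right exp_minus divide_inverse mult.assoc)
qed

text \<open>Away from zero this is a calculation.  At zero the difference quotient is again a flat
  exponential, with \<open>x p\<close> in place of \<open>p\<close>, and the exponential beats the polynomial.\<close>

lemma flat_exp_has_derivative:
  "(flat_exp p has_real_derivative flat_exp ([:0, 0, 1:] * (p - pderiv p)) x) (at x)"
proof -
  consider "x > 0" | "x < 0" | "x = 0" by linarith
  then show ?thesis
  proof cases
    case 1
    have "((\<lambda>x. poly p (1 / x) * exp (- (1 / x))) has_real_derivative
        flat_exp ([:0, 0, 1:] * (p - pderiv p)) x) (at x)"
      using 1 by (auto intro!: derivative_eq_intros poly_DERIV[THEN DERIV_chain2] simp: flat_exp_def field_simps power2_eq_square)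
    moreover have "\<forall>\<^sub>F y in nhds x. flat_exp p y = poly p (1 / y) * exp (- (1 / y))"
      using eventually_nhds_in_open[of "{0<..}" x] 1
      by (auto elim!: eventually_mono simp: flat_exp_def)
    ultimately show ?thesis
      by (subst DERIV_cong_ev[OF refl _ refl])
  next
    case 2
    have "\<forall>\<^sub>F y in nhds x. flat_exp p y = 0"
      using eventually_nhds_in_open[of "{..<0}" x] 2
      by (auto elim!: eventually_mono simp: flat_exp_def)
    then show ?thesis using 2
      by (subst DERIV_cong_ev[OF refl _ refl, where g = "\<lambda>_. 0"]) (auto simp: flat_exp_def)
  next
    case 3
    have "((\<lambda>h. poly ([:0,1:] * p) (inverse h) * exp (- (inverse h))) \<longlongrightarrow> 0) (at_right 0)"
      by (rule filterlim_compose[OF poly_mult_exp_tendsto_0 filterlim_inverse_at_top_right])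
    then have R: "((\<lambda>h. flat_exp p h / h) \<longlongrightarrow> 0) (at_right 0)"
      by (rule Lim_transform_eventually)
         (auto simp: flat_exp_def eventually_at_filter field_simps)
    have L: "((\<lambda>h. flat_exp p h / h) \<longlongrightarrow> 0) (at_left 0)"
      by (rule Lim_transform_eventually[OF tendsto_const])
         (auto simp: flat_exp_def eventually_at_filter)
    from R L have "((\<lambda>h. flat_exp p h / h) \<longlongrightarrow> 0) (at 0)"
      using filterlim_split_at by blast
    then show ?thesis using 3
      by (auto simp: has_field_derivative_iff flat_exp_def)
  qed
qed

text \<open>A set of functions that is closed under differentiation, so that smoothness of its members needs no
  formula for their higher derivatives.  The generators vanish outside \<open>(a, b)\<close> if \<open>c > 0\<close>.\<close>

inductive_set bump_span :: "(real \<Rightarrow> real) set" where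
  base: "(\<lambda>x. flat_exp p (c * (x - a)) * flat_exp q (c * (b - x))) \<in> bump_span"
| add: "g \<in> bump_span \<Longrightarrow> h \<in> bump_span \<Longrightarrow> (\<lambda>x. g x + h x) \<in> bump_span"
| scale: "g \<in> bump_span \<Longrightarrow> (\<lambda>x. k * g x) \<in> bump_span"

lemma bump_span_closed_deriv:
  "g \<in> bump_span \<Longrightarrow> \<exists>g' \<in> bump_span. \<forall>x. (g has_real_derivative g' x) (at x)"
proof (induction rule: bump_span.induct)
  case (base p c a q b)
  let ?D = "\<lambda>p. [:0, 0, 1:] * (p - pderiv p)"
  let ?g = "\<lambda>x. c * (flat_exp (?D p) (c * (x - a)) * flat_exp q (c * (b - x)))
     + (- c) * (flat_exp p (c * (x - a)) * flat_exp (?D q) (c * (b - x)))"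
  have "?g \<in> bump_span" by (intro bump_span.intros)
  moreover have "((\<lambda>x. flat_exp p (c * (x - a)) * flat_exp q (c * (b - x))) has_real_derivative ?g x) (at x)" for x
  proof -
    have 1: "((\<lambda>x. flat_exp p (c * (x - a))) has_real_derivative flat_exp (?D p) (c * (x - a)) * c) (at x)"
      by (rule DERIV_chain2[OF flat_exp_has_derivative]) (auto intro!: derivative_eq_intros)
    have 2: "((\<lambda>x. flat_exp q (c * (b - x))) has_real_derivative flat_exp (?D q) (c * (b - x)) * (- c)) (at x)"
      by (rule DERIV_chain2[OF flat_exp_has_derivative]) (auto intro!: derivative_eq_intros)
    show ?thesis
      by (rule DERIV_cong[OF DERIV_mult[OF 1 2]]) (simp add: algebra_simps)
  qed
  ultimately show ?case by (intro bexI[where x = ?g]) auto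
next
  case (add g h)
  then obtain g' h' where "g' \<in> bump_span" "h' \<in> bump_span"
    "\<forall>x. (g has_real_derivative g' x) (at x)" "\<forall>x. (h has_real_derivative h' x) (at x)" by blast
  then show ?case
    by (intro bexI[where x = "\<lambda>x. g' x + h' x"]) (auto intro: bump_span.add DERIV_add)
next
  case (scale g k)
  then obtain g' where "g' \<in> bump_span" "\<forall>x. (g has_real_derivative g' x) (at x)" by blast
  then show ?case
    by (intro bexI[where x = "\<lambda>x. k * g' x"]) (auto intro: bump_span.scale DERIV_cmult)
qed

lemma C_diff_if_closed_deriv:
  assumes "g \<in> S" and S: "\<And>g. g \<in> S \<Longrightarrow> \<exists>g' \<in> S. \<forall>x. (g has_real_derivative g' x) (at x)"
  shows "C_diff n g"
proof -
  have *: "(deriv ^^ n) g \<in> S" for n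
  proof (induction n)
    case (Suc n)
    obtain g' where "g' \<in> S" "\<forall>x. ((deriv ^^ n) g has_real_derivative g' x) (at x)"
      using S[OF Suc] by blast
    moreover from this have "deriv ((deriv ^^ n) g) = g'"
      by (auto simp: DERIV_imp_deriv)
    ultimately show ?case by simp
  qed (use assms in simp)
  have "h differentiable_on UNIV" if "h \<in> S" for h
    using S[OF that] by (auto simp: differentiable_on_def intro: differentiableI has_field_derivative_imp_has_derivative)
  then show ?thesis unfolding C_diff_def using * differentiable_imp_continuous_on by blast
qed

section \<open>Primitives of locally integrable functions\<close>

text \<open>Up to the choice of \<open>F'\<close> on null sets, these are the locally absolutely continuous functions
  \<open>F\<close> with their derivatives.\<close>

definition is_primitive :: "(real \<Rightarrow> real) \<Rightarrow> (real \<Rightarrow> real) \<Rightarrow> bool" where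
  "is_primitive F F' \<longleftrightarrow> locally_integrable F' \<and>
     (\<forall>a b. a \<le> b \<longrightarrow> F b - F a = integral {a..b} F')"

lemma locally_integrableD: "locally_integrable k \<Longrightarrow> k absolutely_integrable_on {a..b}"
  by (simp add: locally_integrable_def)

lemma locally_integrable_integrable_on: "locally_integrable k \<Longrightarrow> k integrable_on {a..b}"
  using locally_integrableD set_lebesgue_integral_eq_integral(1) by blast

lemma locally_integrable_borel [measurable_dest]:
  assumes "locally_integrable k" shows "k \<in> borel_measurable lebesgue"
proof (rule borel_measurable_LIMSEQ_real)
  fix n :: nat
  have "set_integrable lebesgue {- real n..real n} k"
    using assms by (simp add: locally_integrable_def)
  then show "(\<lambda>x. indicator {- real n..real n} x *\<^sub>R k x) \<in> borel_measurable lebesgue"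
    unfolding set_integrable_def by (rule borel_measurable_integrable)
next
  fix x :: real
  obtain N :: nat where N: "\<bar>x\<bar> \<le> N" using real_arch_simple by blast
  have "\<forall>\<^sub>F n in sequentially. k x = indicator {- real n..real n} x *\<^sub>R k x"
    using eventually_ge_at_top[of N]
    by (rule eventually_mono) (use N in \<open>auto simp: indicator_def\<close>)
  then show "(\<lambda>n. indicator {- real n..real n} x *\<^sub>R k x) \<longlonglongrightarrow> k x"
    by (rule Lim_transform_eventually[OF tendsto_const])
qed

lemma locally_integrable_add:
  "locally_integrable k \<Longrightarrow> locally_integrable l \<Longrightarrow> locally_integrable (\<lambda>x. k x + l x)"
  by (simp add: locally_integrable_def set_integral_add)

lemma locally_integrable_diff:
  "locally_integrable k \<Longrightarrow> locally_integrable l \<Longrightarrow> locally_integrable (\<lambda>x. k x - l x)"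
  by (simp add: locally_integrable_def set_integral_diff)

lemma locally_integrable_continuous: "continuous_on UNIV k \<Longrightarrow> locally_integrable k"
  unfolding locally_integrable_def
  by (meson absolutely_integrable_continuous_real continuous_on_subset subset_UNIV)

lemma locally_integrable_mult_continuous:
  assumes "continuous_on UNIV c" "locally_integrable k"
  shows "locally_integrable (\<lambda>x. c x * k x)"
  unfolding locally_integrable_def
proof (intro allI absolutely_integrable_bounded_measurable_product_real)
  fix a b :: real
  have c: "continuous_on {a..b} c" using assms(1) continuous_on_subset by blast
  show "c \<in> borel_measurable (lebesgue_on {a..b})"
    using c by (simp add: continuous_imp_measurable_on_sets_lebesgue)
  show "bounded (c ` {a..b})"
    using c compact_continuous_image compact_imp_bounded by blast
  show "k absolutely_integrable_on {a..b}" using assms(2) by (rule locally_integrableD)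
qed auto

lemma is_primitive_integral: "is_primitive F k \<Longrightarrow> a \<le> b \<Longrightarrow> integral {a..b} k = F b - F a"
  by (simp add: is_primitive_def)

lemma is_primitive_locally_integrable: "is_primitive F k \<Longrightarrow> locally_integrable k"
  by (simp add: is_primitive_def)

lemma is_primitive_continuous:
  assumes "is_primitive F k" shows "continuous_on UNIV F"
proof -
  have "isCont F x" for x
  proof -
    have "continuous_on {x - 1..x + 1} (\<lambda>y. F (x - 1) + integral {x - 1..y} k)"
      by (intro continuous_intros indefinite_integral_continuous_1 locally_integrable_integrable_on
          is_primitive_locally_integrable[OF assms])
    then have "continuous_on {x - 1..x + 1} F"
      by (rule continuous_on_eq) (auto simp: is_primitive_integral[OF assms])
    then show ?thesis
      by (rule continuous_on_interior) auto
  qed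
  then show ?thesis by (simp add: continuous_at_imp_continuous_on)
qed

text \<open>Sum the estimate over a fine partition of \<open>[a, b]\<close>: the increments of \<open>V\<close> telescope, and
  \<open>\<epsilon>\<close> is arbitrary.\<close>

lemma constant_if_locally_small_increments:
  fixes \<Delta> V :: "real \<Rightarrow> real"
  assumes "a \<le> b"
    and small: "\<And>\<epsilon>. \<epsilon> > 0 \<Longrightarrow> \<exists>\<delta>>0. \<forall>x y. a \<le> x \<longrightarrow> x \<le> y \<longrightarrow> y \<le> b \<longrightarrow> y - x < \<delta> \<longrightarrow>
       \<bar>\<Delta> y - \<Delta> x\<bar> \<le> \<epsilon> * (V y - V x)"
  shows "\<Delta> b = \<Delta> a"
proof -
  have le: "\<bar>\<Delta> b - \<Delta> a\<bar> \<le> \<epsilon> * (V b - V a)" if "\<epsilon> > 0" for \<epsilon>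
  proof -
    obtain \<delta> where "\<delta> > 0" and \<delta>: "\<And>x y. a \<le> x \<Longrightarrow> x \<le> y \<Longrightarrow> y \<le> b \<Longrightarrow> y - x < \<delta> \<Longrightarrow>
       \<bar>\<Delta> y - \<Delta> x\<bar> \<le> \<epsilon> * (V y - V x)"
      using small[OF \<open>\<epsilon> > 0\<close>] by metis
    obtain N :: nat where N: "(b - a) / \<delta> < N" using reals_Archimedean2 by blast
    define h where "h = (b - a) / N"
    have N0: "0 < real N" using N \<open>a \<le> b\<close> \<open>\<delta> > 0\<close>
      by (metis divide_nonneg_pos diff_ge_0_iff_ge order_le_less_trans)
    have h: "0 \<le> h" "h < \<delta>" "N * h = b - a"
      using N N0 \<open>a \<le> b\<close> \<open>\<delta> > 0\<close> by (auto simp: h_def field_simps)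
    have "\<bar>\<Delta> (a + k * h) - \<Delta> a\<bar> \<le> \<epsilon> * (V (a + k * h) - V a)" if "k \<le> N" for k :: nat
      using that
    proof (induction k)
      case (Suc k)
      have "(k + 1) * h \<le> N * h" using Suc.prems h by (intro mult_right_mono) auto
      then have "\<bar>\<Delta> (a + Suc k * h) - \<Delta> (a + k * h)\<bar> \<le> \<epsilon> * (V (a + Suc k * h) - V (a + k * h))"
        using h by (intro \<delta>) (auto simp: algebra_simps)
      with Suc show ?case by (simp add: algebra_simps)
    qed simp
    from this[of N] h show ?thesis by simp
  qed
  have "\<bar>\<Delta> b - \<Delta> a\<bar> \<le> 0"
  proof (rule field_le_epsilon)
    fix e :: real assume "e > 0"
    define \<epsilon> where "\<epsilon> = e / (\<bar>V b - V a\<bar> + 1)"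
    have "\<epsilon> > 0" using \<open>e > 0\<close> by (simp add: \<epsilon>_def)
    have "\<bar>\<Delta> b - \<Delta> a\<bar> \<le> \<epsilon> * (V b - V a)" using le \<open>\<epsilon> > 0\<close> .
    also have "\<dots> \<le> \<epsilon> * (\<bar>V b - V a\<bar> + 1)" using \<open>\<epsilon> > 0\<close> by (intro mult_left_mono) auto
    also have "\<dots> = e" by (simp add: \<epsilon>_def)
    finally show "\<bar>\<Delta> b - \<Delta> a\<bar> \<le> 0 + e" by simp
  qed
  then show ?thesis by simp
qed

text \<open>On a short interval \<open>[x, y]\<close> the increment of \<open>F G\<close> is exactly the integral of
  \<open>G y * f + F x * g\<close>.  By uniform continuity this differs from the integral of \<open>G f + F g\<close> by at
  most \<open>\<epsilon>\<close> times the integral of \<open>|f| + |g|\<close>, and such errors do not accumulate.\<close>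

lemma is_primitive_mult:
  assumes F: "is_primitive F f" and G: "is_primitive G g"
  shows "is_primitive (\<lambda>x. F x * G x) (\<lambda>x. G x * f x + F x * g x)"
proof -
  note cF = is_primitive_continuous[OF F] and cG = is_primitive_continuous[OF G]
  note lf = is_primitive_locally_integrable[OF F] and lg = is_primitive_locally_integrable[OF G]
  have li: "locally_integrable (\<lambda>x. G x * f x + F x * g x)"
    by (intro locally_integrable_add locally_integrable_mult_continuous cF cG lf lg)
  have "F b * G b - F a * G a = integral {a..b} (\<lambda>x. G x * f x + F x * g x)" if ab: "a \<le> b" for a b
  proof -
    let ?k = "\<lambda>x. G x * f x + F x * g x"
    let ?v = "\<lambda>x. \<bar>f x\<bar> + \<bar>g x\<bar>"
    have iv: "?v integrable_on {c..d}" for c d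
      using lf lg unfolding locally_integrable_def
      by (intro integrable_add) (auto intro!: set_integrable_abs set_lebesgue_integral_eq_integral(1))
    have ik: "?k integrable_on {c..d}" for c d using li by (rule locally_integrable_integrable_on)
    define \<Delta> where "\<Delta> x = F x * G x - integral {a..x} ?k" for x
    define V where "V x = integral {a..x} ?v" for x
    have "\<Delta> b = \<Delta> a"
    proof (rule constant_if_locally_small_increments[OF ab, where V = V])
      fix \<epsilon> :: real assume "\<epsilon> > 0"
      have "uniformly_continuous_on {a..b} F" "uniformly_continuous_on {a..b} G"
        using cF cG by (auto intro!: compact_uniformly_continuous continuous_on_subset[OF _ subset_UNIV])
      then obtain d1 d2 where d: "d1 > 0" "d2 > 0"
        and d1: "\<And>x y. x \<in> {a..b} \<Longrightarrow> y \<in> {a..b} \<Longrightarrow> dist x y < d1 \<Longrightarrow> dist (F x) (F y) < \<epsilon>"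
        and d2: "\<And>x y. x \<in> {a..b} \<Longrightarrow> y \<in> {a..b} \<Longrightarrow> dist x y < d2 \<Longrightarrow> dist (G x) (G y) < \<epsilon>"
        using \<open>\<epsilon> > 0\<close> unfolding uniformly_continuous_on_def by metis
      have "\<bar>\<Delta> y - \<Delta> x\<bar> \<le> \<epsilon> * (V y - V x)"
        if xy: "a \<le> x" "x \<le> y" "y \<le> b" "y - x < min d1 d2" for x y
      proof -
        have split: "integral {a..y} l = integral {a..x} l + integral {x..y} l"
          if "l integrable_on {a..y}" for l :: "real \<Rightarrow> real"
          using Henstock_Kurzweil_Integration.integral_combine[where a = a and c = x and b = y and f = l] that xy by simp
        have i1: "(\<lambda>s. G y * f s + F x * g s) integrable_on {x..y}"
          using lf lg by (intro integrable_add integrable_on_mult_right) (auto intro: locally_integrable_integrable_on)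
        have inc: "F y * G y - F x * G x = integral {x..y} (\<lambda>s. G y * f s + F x * g s)"
        proof -
          have "integral {x..y} (\<lambda>s. G y * f s + F x * g s)
              = G y * integral {x..y} f + F x * integral {x..y} g"
            using lf lg by (subst integral_add)
              (auto intro!: integrable_on_mult_right intro: locally_integrable_integrable_on)
          also have "\<dots> = F y * G y - F x * G x"
            using xy by (simp add: is_primitive_integral[OF F] is_primitive_integral[OF G] algebra_simps)
          finally show ?thesis by simp
        qed
        have "\<Delta> y - \<Delta> x = integral {x..y} (\<lambda>s. (G y * f s + F x * g s) - ?k s)"
          using inc split[OF ik] by (subst integral_diff[OF i1 ik]) (simp add: \<Delta>_def)
        also have "norm \<dots> \<le> integral {x..y} (\<lambda>s. \<epsilon> * ?v s)"
        proof (rule integral_norm_bound_integral)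
          show "(\<lambda>s. (G y * f s + F x * g s) - ?k s) integrable_on {x..y}"
            by (rule integrable_diff[OF i1 ik])
          show "(\<lambda>s. \<epsilon> * ?v s) integrable_on {x..y}" by (intro integrable_on_mult_right iv)
          fix s assume s: "s \<in> {x..y}"
          have "\<bar>G y - G s\<bar> \<le> \<epsilon>" "\<bar>F x - F s\<bar> \<le> \<epsilon>"
            using d1[of x s] d2[of y s] s xy by (auto simp: dist_real_def)
          then have "\<bar>(G y - G s) * f s\<bar> \<le> \<epsilon> * \<bar>f s\<bar>" "\<bar>(F x - F s) * g s\<bar> \<le> \<epsilon> * \<bar>g s\<bar>"
            by (auto simp: abs_mult intro!: mult_right_mono)
          then show "norm ((G y * f s + F x * g s) - ?k s) \<le> \<epsilon> * ?v s"
            by (simp add: algebra_simps)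
        qed
        also have "\<dots> = \<epsilon> * (V y - V x)"
          using split[OF iv] by (simp add: V_def)
        finally show ?thesis by simp
      qed
      then show "\<exists>\<delta>>0. \<forall>x y. a \<le> x \<longrightarrow> x \<le> y \<longrightarrow> y \<le> b \<longrightarrow> y - x < \<delta> \<longrightarrow> \<bar>\<Delta> y - \<Delta> x\<bar> \<le> \<epsilon> * (V y - V x)"
        using d by (intro exI[of _ "min d1 d2"]) auto
    qed
    then show ?thesis by (simp add: \<Delta>_def)
  qed
  with li show ?thesis by (simp add: is_primitive_def)
qed

lemma is_primitive_diff:
  "is_primitive F f \<Longrightarrow> is_primitive G g \<Longrightarrow> is_primitive (\<lambda>x. F x - G x) (\<lambda>x. f x - g x)"
proof -
  assume F: "is_primitive F f" and G: "is_primitive G g"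
  note l = F[THEN is_primitive_locally_integrable] G[THEN is_primitive_locally_integrable]
  have "F b - G b - (F a - G a) = integral {a..b} (\<lambda>x. f x - g x)" if "a \<le> b" for a b
    using that is_primitive_integral[OF F that] is_primitive_integral[OF G that]
    by (simp add: integral_diff l[THEN locally_integrable_integrable_on])
  with locally_integrable_diff[OF l] show ?thesis by (simp add: is_primitive_def)
qed

lemma is_primitive_cong_AE:
  assumes "is_primitive F k" "AE x in lebesgue. k x = l x" "l \<in> borel_measurable lebesgue"
  shows "is_primitive F l"
proof -
  have li: "locally_integrable l"
    unfolding locally_integrable_def set_integrable_def
  proof (intro allI)
    fix a b :: real
    have i: "integrable lebesgue (\<lambda>x. indicat_real {a..b} x *\<^sub>R k x)"
      using assms(1) by (simp add: is_primitive_def locally_integrable_def set_integrable_def)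
    show "integrable lebesgue (\<lambda>x. indicat_real {a..b} x *\<^sub>R l x)"
      by (rule integrable_cong_AE_imp[OF i])
         (use assms(2,3) in \<open>auto elim!: eventually_mono intro!: borel_measurable_times borel_measurable_indicator\<close>)
  qed
  have "integral {a..b} k = integral {a..b} l" for a b
  proof -
    have "(LINT x:{a..b}|lebesgue. k x) = (LINT x:{a..b}|lebesgue. l x)"
      unfolding set_lebesgue_integral_def using assms(2) li is_primitive_locally_integrable[OF assms(1)]
      by (intro integral_cong_AE)
         (auto elim!: eventually_mono dest!: locally_integrable_borel
           intro!: borel_measurable_times borel_measurable_indicator)
    then show ?thesis
      using set_lebesgue_integral_eq_integral(2)[OF locally_integrableD[OF li]]
        set_lebesgue_integral_eq_integral(2)[OF locally_integrableD[OF is_primitive_locally_integrable[OF assms(1)]]]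
      by simp
  qed
  with li assms(1) show ?thesis by (simp add: is_primitive_def)
qed

text \<open>The fundamental theorem of calculus with finitely many exceptional points, such as the corners of a
  rarefaction wave.\<close>

lemma is_primitive_deriv:
  assumes "finite S" "continuous_on UNIV F" "\<And>x. x \<notin> S \<Longrightarrow> (F has_real_derivative k x) (at x)"
    and bd: "\<And>R. \<exists>B. \<forall>x. \<bar>x\<bar> \<le> R \<longrightarrow> \<bar>k x\<bar> \<le> B"
  shows "is_primitive F k"
proof -
  have hi: "(k has_integral (F b - F a)) {a..b}" if "a \<le> b" for a b
    using assms(1-3) that
    by (intro fundamental_theorem_of_calculus_strong[of S])
       (auto simp: has_real_derivative_iff_has_vector_derivative intro: continuous_on_subset)
  have "k absolutely_integrable_on {a..b}" for a b
  proof (cases "a \<le> b")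
    case True
    obtain B where B: "\<forall>x. \<bar>x\<bar> \<le> max \<bar>a\<bar> \<bar>b\<bar> \<longrightarrow> \<bar>k x\<bar> \<le> B" using bd by blast
    show ?thesis
      by (rule absolutely_integrable_integrable_bound[where g = "\<lambda>_. B"])
         (use B hi[OF True] in \<open>auto simp: integrable_on_def\<close>)
  qed simp
  with hi show ?thesis
    using integral_unique[OF hi]
    by (auto simp: is_primitive_def locally_integrable_def)
qed

definition primitive_of :: "(real \<Rightarrow> real) \<Rightarrow> real \<Rightarrow> real" where
  "primitive_of k x = (if 0 \<le> x then integral {0..x} k else - integral {x..0} k)"

lemma is_primitive_primitive_of:
  assumes "locally_integrable k" shows "is_primitive (primitive_of k) k"
proof -
  have "primitive_of k b - primitive_of k a = integral {a..b} k" if "a \<le> b" for a b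
    using locally_integrable_integrable_on[OF assms] that
      Henstock_Kurzweil_Integration.integral_combine[where a = a and c = 0 and b = b and f = k]
      Henstock_Kurzweil_Integration.integral_combine[where a = 0 and c = a and b = b and f = k]
      Henstock_Kurzweil_Integration.integral_combine[where a = a and c = b and b = 0 and f = k]
    unfolding primitive_of_def by (cases "0 \<le> a"; cases "0 \<le> b") simp_all
  with assms show ?thesis by (simp add: is_primitive_def)
qed

lemma is_primitive_has_derivative:
  assumes "is_primitive F k" "continuous_on UNIV k"
  shows "(F has_real_derivative k x) (at x)"
proof -
  have "((\<lambda>y. F (x - 1) + integral {x - 1..y} k) has_real_derivative k x) (at x within {x - 1..x + 1})"
    using integral_has_real_derivative[of "x - 1" "x + 1" k x] assms(2)
    by (auto intro!: derivative_eq_intros intro: continuous_on_subset)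
  then have "(F has_real_derivative k x) (at x within {x - 1..x + 1})"
    by (rule has_field_derivative_transform_within[where d = 1]) (auto simp: is_primitive_integral[OF assms(1)])
  then show ?thesis by (simp add: at_within_Icc_at)
qed

text \<open>A locally integrable function is almost everywhere the limit of its averages over shrinking intervals.\<close>

lemma AE_eq_0_if_integrals_0:
  assumes "locally_integrable k" "\<And>a b. a < b \<Longrightarrow> integral {a..b} k = 0"
  shows "AE x in lebesgue. k x = 0"
proof -
  obtain N where N: "negligible N"
    "\<And>x e. x \<notin> N \<Longrightarrow> 0 < e \<Longrightarrow> \<exists>d>0. \<forall>h. 0 < h \<and> h < d \<longrightarrow>
        norm (integral (cbox x (x + h *\<^sub>R One)) k /\<^sub>R h ^ DIM(real) - k x) < e"
    by (rule integrable_ccontinuous_explicit[of k])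
       (auto simp: locally_integrable_integrable_on[OF assms(1)])
  have "k x = 0" if "x \<notin> N" for x
  proof (rule ccontr)
    assume "k x \<noteq> 0"
    with N(2)[OF that, of "\<bar>k x\<bar>"] obtain d where d: "d > 0" "\<forall>h. 0 < h \<and> h < d \<longrightarrow>
        norm (integral (cbox x (x + h *\<^sub>R One)) k /\<^sub>R h ^ DIM(real) - k x) < \<bar>k x\<bar>" by auto
    have "integral (cbox x (x + (d / 2) *\<^sub>R One)) k = 0"
      using assms(2)[of x "x + d / 2"] d(1) by simp
    with d(2)[rule_format, of "d / 2"] d(1) show False by simp
  qed
  moreover have "AE x in lebesgue. x \<notin> N"
    using N(1) by (simp add: AE_not_in negligible_iff_null_sets)
  ultimately show ?thesis by (auto elim: eventually_mono)
qed

lemma LINT_eq_integral_if_supported: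
  fixes k :: "real \<Rightarrow> real"
  assumes "set_integrable lebesgue {a..b} k" "\<And>x. x \<notin> {a..b} \<Longrightarrow> k x = 0"
  shows "integrable lebesgue k" "(LINT x|lebesgue. k x) = integral {a..b} k"
proof -
  have eq: "(\<lambda>x. indicator {a..b} x *\<^sub>R k x) = k" using assms(2) by (force simp: indicator_def)
  show "integrable lebesgue k" using assms(1) unfolding set_integrable_def eq .
  have "(LINT x:{a..b}|lebesgue. k x) = integral {a..b} k"
    by (rule set_lebesgue_integral_eq_integral(2)[OF assms(1)])
  then show "(LINT x|lebesgue. k x) = integral {a..b} k" unfolding set_lebesgue_integral_def eq .
qed

section \<open>Functions with a locally integrable weak derivative are primitives\<close>

lemma test_fun_props:
  assumes "test_fun \<psi>"
  obtains R where "R > 0" "\<And>x. \<bar>x\<bar> \<ge> R \<Longrightarrow> \<psi> x = 0" "\<And>x. \<bar>x\<bar> \<ge> R \<Longrightarrow> deriv \<psi> x = 0"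
    "is_primitive \<psi> (deriv \<psi>)" "continuous_on UNIV \<psi>" "continuous_on UNIV (deriv \<psi>)"
proof -
  have C1: "C_diff 1 \<psi>" using assms by (simp add: test_fun_def)
  then have d: "\<psi> differentiable_on UNIV" and c': "continuous_on UNIV (deriv \<psi>)"
    by (auto simp: C_diff_def)
  then have c: "continuous_on UNIV \<psi>" by (rule_tac differentiable_imp_continuous_on)
  have der: "(\<psi> has_real_derivative deriv \<psi> x) (at x)" for x
    using d by (auto simp: differentiable_on_def field_differentiable_derivI real_differentiable_def
        field_differentiable_def DERIV_deriv_iff_real_differentiable)
  from assms obtain R where R: "\<And>x. \<psi> x \<noteq> 0 \<Longrightarrow> \<bar>x\<bar> \<le> R"
    by (auto simp: test_fun_def bounded_iff)
  have z: "\<psi> x = 0" if "\<bar>x\<bar> \<ge> \<bar>R\<bar> + 1" for x using R[of x] that by linarith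
  have "deriv \<psi> x = 0" if "\<bar>x\<bar> \<ge> \<bar>R\<bar> + 1" for x
  proof -
    have "open {y::real. \<bar>y\<bar> > \<bar>R\<bar>}" by (intro open_Collect_less continuous_intros)
    then have "\<forall>\<^sub>F y in nhds x. y \<in> {y::real. \<bar>y\<bar> > \<bar>R\<bar>}"
      by (rule eventually_nhds_in_open) (use that in auto)
    then have "\<forall>\<^sub>F y in nhds x. \<psi> y = 0"
      by (rule eventually_mono) (use R in force)
    then have "(\<psi> has_real_derivative 0) (at x)"
      by (subst DERIV_cong_ev[OF refl _ refl, where g = "\<lambda>_. 0"]) auto
    then show ?thesis by (rule DERIV_imp_deriv)
  qed
  moreover have "is_primitive \<psi> (deriv \<psi>)"
  proof (rule is_primitive_deriv[of "{}"])
    fix K :: real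
    have "compact (deriv \<psi> ` {- K..K})"
      by (intro compact_continuous_image continuous_on_subset[OF c']) auto
    then obtain B where "\<forall>x\<in>{- K..K}. \<bar>deriv \<psi> x\<bar> \<le> B"
      by (auto dest!: compact_imp_bounded simp: bounded_iff)
    then show "\<exists>B. \<forall>x. \<bar>x\<bar> \<le> K \<longrightarrow> \<bar>deriv \<psi> x\<bar> \<le> B"
      by (intro exI[of _ B]) (auto simp: abs_le_iff)
  qed (use c der in auto)
  ultimately show ?thesis using that[of "\<bar>R\<bar> + 1"] z c c' by auto
qed

lemma locally_integrable_LINT:
  fixes k :: "real \<Rightarrow> real"
  assumes "locally_integrable k" "\<And>x. \<bar>x\<bar> \<ge> R \<Longrightarrow> k x = 0"
  shows "integrable lebesgue k" "(LINT x|lebesgue. k x) = integral {- R..R} k"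
proof -
  have "k x = 0" if "x \<notin> {- R..R}" for x
    using assms(2)[of x] that by (auto simp: abs_if split: if_splits)
  then show "integrable lebesgue k" "(LINT x|lebesgue. k x) = integral {- R..R} k"
    using LINT_eq_integral_if_supported[OF locally_integrableD[OF assms(1)], of "- R" R] by auto
qed

lemma is_primitive_imp_weak_deriv:
  assumes U: "is_primitive U k" and "test_fun \<psi>"
  shows "(LINT x|lebesgue. U x * deriv \<psi> x) = - (LINT x|lebesgue. k x * \<psi> x)"
proof -
  obtain R where R: "R > 0" "\<And>x. \<bar>x\<bar> \<ge> R \<Longrightarrow> \<psi> x = 0" "\<And>x. \<bar>x\<bar> \<ge> R \<Longrightarrow> deriv \<psi> x = 0"
    and P: "is_primitive \<psi> (deriv \<psi>)" and c: "continuous_on UNIV \<psi>" "continuous_on UNIV (deriv \<psi>)"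
    using test_fun_props[OF assms(2)] by blast
  have l1: "locally_integrable (\<lambda>x. U x * deriv \<psi> x)"
    by (intro locally_integrable_continuous continuous_intros is_primitive_continuous[OF U] c)
  have l2: "locally_integrable (\<lambda>x. \<psi> x * k x)"
    by (intro locally_integrable_mult_continuous c is_primitive_locally_integrable[OF U])
  have "(LINT x|lebesgue. U x * deriv \<psi> x) + (LINT x|lebesgue. \<psi> x * k x)
      = integral {- R..R} (\<lambda>x. U x * deriv \<psi> x) + integral {- R..R} (\<lambda>x. \<psi> x * k x)"
    using locally_integrable_LINT(2)[OF l1, of R] locally_integrable_LINT(2)[OF l2, of R] R by simp
  also have "\<dots> = integral {- R..R} (\<lambda>x. \<psi> x * k x + U x * deriv \<psi> x)"
    using l1 l2 by (subst integral_add) (auto intro: locally_integrable_integrable_on)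
  also have "\<dots> = U R * \<psi> R - U (- R) * \<psi> (- R)"
    using is_primitive_integral[OF is_primitive_mult[OF U P]] R by simp
  also have "\<dots> = 0" using R by simp
  finally show ?thesis by (simp add: mult.commute)
qed

lemma bump_span_continuous: "g \<in> bump_span \<Longrightarrow> continuous_on UNIV g"
  using bump_span_closed_deriv by (metis DERIV_continuous_on has_field_derivative_at_within)

text \<open>Vanishing of the total integral makes the primitive that starts at \<open>-R\<close> return to zero
  at \<open>R\<close>.\<close>

lemma test_fun_primitive_of_bump_span:
  assumes "\<omega> \<in> bump_span" "R > 0" "\<And>x. \<bar>x\<bar> \<ge> R \<Longrightarrow> \<omega> x = 0" "integral {- R..R} \<omega> = 0"
  shows "\<exists>\<psi>. test_fun \<psi> \<and> deriv \<psi> = \<omega>"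
proof -
  have c: "continuous_on UNIV \<omega>" using assms(1) by (rule bump_span_continuous)
  note P = is_primitive_primitive_of[OF locally_integrable_continuous[OF c]]
  define \<psi> where "\<psi> x = primitive_of \<omega> x - primitive_of \<omega> (- R)" for x
  have d: "(\<psi> has_real_derivative \<omega> x) (at x)" for x
    unfolding \<psi>_def using is_primitive_has_derivative[OF P c]
    by (auto intro!: derivative_eq_intros)
  have "\<psi> x = 0" if "\<bar>x\<bar> \<ge> R" for x
  proof -
    have zero: "integral {a..b} \<omega> = 0" if "\<And>x. x \<in> {a..b} \<Longrightarrow> \<omega> x = 0" for a b
      using that integral_cong[of "{a..b}" \<omega> "\<lambda>_. 0"] by simp
    show ?thesis
    proof (cases "x \<ge> R")
      case True
      have "integral {R..x} \<omega> = 0" using assms(2,3) by (intro zero) auto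
      then show ?thesis using is_primitive_integral[OF P, of R x] True
          is_primitive_integral[OF P, of "- R" R] assms(2,4) by (simp add: \<psi>_def)
    next
      case False
      then have x: "x \<le> - R" using that by auto
      have "integral {x..- R} \<omega> = 0" using assms(2,3) x by (intro zero) auto
      then show ?thesis using is_primitive_integral[OF P x] by (simp add: \<psi>_def)
    qed
  qed
  then have "{x. \<psi> x \<noteq> 0} \<subseteq> {- R..R}" by (force simp: abs_le_iff)
  then have "bounded {x. \<psi> x \<noteq> 0}" using bounded_closed_interval bounded_subset by blast
  moreover have "C_diff n \<psi>" for n
    by (rule C_diff_if_closed_deriv[of _ "insert \<psi> bump_span"])
       (use d assms(1) bump_span_closed_deriv in blast)+
  ultimately have "test_fun \<psi>" by (simp add: test_fun_def)
  moreover have "deriv \<psi> = \<omega>" using d by (auto simp: DERIV_imp_deriv)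
  ultimately show ?thesis by blast
qed

text \<open>Smooth functions with values in \<open>[0, 1]\<close> that converge to the indicator of \<open>(a, b)\<close>.\<close>

definition bump :: "nat \<Rightarrow> real \<Rightarrow> real \<Rightarrow> real \<Rightarrow> real" where
  "bump n a b x = flat_exp 1 (real n * (x - a)) * flat_exp 1 (real n * (b - x))"

lemma bump_in_span: "bump n a b \<in> bump_span"
  unfolding bump_def[abs_def] by (rule bump_span.base)

lemma bump_bounds: "0 \<le> bump n a b x" "bump n a b x \<le> 1"
  by (auto simp: bump_def flat_exp_def intro!: mult_le_one)

lemma bump_outside: "x \<notin> {a<..<b} \<Longrightarrow> bump n a b x = 0"
  by (auto simp: bump_def flat_exp_def zero_less_mult_iff)

lemma bump_tendsto:
  assumes "x \<in> {a<..<b}" shows "(\<lambda>n. bump n a b x) \<longlonglongrightarrow> 1"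
proof -
  have *: "(\<lambda>n. flat_exp 1 (real n * y)) \<longlonglongrightarrow> 1" if "y > 0" for y
  proof -
    have "(\<lambda>n. exp (- (1 / y * (1 / real n)))) \<longlonglongrightarrow> exp (- (1 / y * 0))"
      by (intro tendsto_intros lim_1_over_n)
    moreover have "\<forall>\<^sub>F n in sequentially. exp (- (1 / y * (1 / real n))) = flat_exp 1 (real n * y)"
      using eventually_gt_at_top[of 0]
      by (rule eventually_mono) (use that in \<open>auto simp: flat_exp_def field_simps\<close>)
    ultimately show ?thesis by (simp add: Lim_transform_eventually)
  qed
  show ?thesis
    unfolding bump_def using tendsto_mult[OF *[of "x - a"] *[of "b - x"]] assms by simp
qed

lemma LINT_bump_tendsto:
  assumes h: "locally_integrable h"
  shows "(\<lambda>n. LINT x|lebesgue. h x * bump n a b x) \<longlonglongrightarrow> integral {a..b} h"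
proof -
  have hi: "set_integrable lebesgue {a..b} h" using h by (simp add: locally_integrable_def)
  have [measurable]: "h \<in> borel_measurable lebesgue" using h by (rule locally_integrable_borel)
  have mb: "bump n a b \<in> borel_measurable lebesgue" for n
    using borel_measurable_continuous_onI[OF bump_span_continuous[OF bump_in_span]]
    by (rule borel_measurable_if_D[where S=UNIV, simplified] | simp add: measurable_completion)+
  have "(\<lambda>n. LINT x|lebesgue. h x * bump n a b x) \<longlonglongrightarrow> (LINT x|lebesgue. h x * indicator {a<..<b} x)"
  proof (rule integral_dominated_convergence[where w = "\<lambda>x. indicator {a..b} x * \<bar>h x\<bar>"])
    show "integrable lebesgue (\<lambda>x. indicator {a..b} x * \<bar>h x\<bar>)"
      using set_integrable_abs[OF hi] by (simp add: set_integrable_def)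
    show "AE x in lebesgue. (\<lambda>n. h x * bump n a b x) \<longlonglongrightarrow> h x * indicator {a<..<b} x"
    proof (intro always_eventually allI tendsto_mult tendsto_const)
      fix x show "(\<lambda>n. bump n a b x) \<longlonglongrightarrow> indicator {a<..<b} x"
        using bump_tendsto[of x a b] bump_outside[of x a b] by (cases "x \<in> {a<..<b}") auto
    qed
    show "AE x in lebesgue. norm (h x * bump n a b x) \<le> indicator {a..b} x * \<bar>h x\<bar>" for n
    proof (intro always_eventually allI)
      fix x show "norm (h x * bump n a b x) \<le> indicator {a..b} x * \<bar>h x\<bar>"
        using bump_bounds[of n a b x] bump_outside[of x a b n]
        by (cases "x \<in> {a<..<b}") (auto simp: abs_mult intro!: mult_left_le)
    qed
  qed (auto intro!: borel_measurable_times mb borel_measurable_indicator)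
  also have "(LINT x|lebesgue. h x * indicator {a<..<b} x) = (LINT x:{a<..<b}|lebesgue. h x)"
    by (simp add: set_lebesgue_integral_def mult.commute)
  also have "\<dots> = integral {a<..<b} h"
    by (intro set_lebesgue_integral_eq_integral(2) set_integrable_subset[OF hi]) auto
  also have "\<dots> = integral {a..b} h" by (simp add: integral_open_interval_real)
  finally show ?thesis .
qed

text \<open>The lemma of du Bois-Reymond.  Two bumps, combined so that the total integral vanishes, form the
  derivative of a test function; hence the averages of \<open>h\<close> against any two bumps agree.  In the
  limit the averages of \<open>h\<close> over any two intervals agree.\<close>

lemma constant_if_weak_deriv_zero:
  assumes h: "locally_integrable h"
    and zero: "\<And>\<psi>. test_fun \<psi> \<Longrightarrow> (LINT x|lebesgue. h x * deriv \<psi> x) = 0"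
  shows "\<exists>c. AE x in lebesgue. h x = c"
proof -
  let ?I = "\<lambda>n a b. LINT x|lebesgue. 1 * bump n a b x"
  let ?J = "\<lambda>n a b. LINT x|lebesgue. h x * bump n a b x"
  have l1: "locally_integrable (\<lambda>_. 1::real)" by (intro locally_integrable_continuous continuous_intros)
  have "?J n a b * ?I n 0 1 = ?J n 0 1 * ?I n a b" for n a b
  proof -
    define R where "R = max 1 (max \<bar>a\<bar> \<bar>b\<bar>)"
    have R: "R > 0" "bump n a b x = 0" "bump n 0 1 x = 0" if "\<bar>x\<bar> \<ge> R" for x
    proof -
      have "\<not> (a < x \<and> x < b)" "\<not> (0 < x \<and> x < 1)"
        using that by (auto simp: R_def abs_if split: if_splits)
      then show "R > 0" "bump n a b x = 0" "bump n 0 1 x = 0"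
        using bump_outside[of x a b n] bump_outside[of x 0 1 n] by (auto simp: R_def)
    qed
    have R0: "R > 0" by (simp add: R_def)
    \<comment> \<open>The weights are chosen such that \<open>\<omega>\<close> has integral zero.\<close>
    define \<omega> where "\<omega> x = ?I n 0 1 * bump n a b x + (- ?I n a b) * bump n 0 1 x" for x
    have span: "\<omega> \<in> bump_span"
      unfolding \<omega>_def[abs_def] by (intro bump_span.add bump_span.scale bump_in_span)
    have li: "locally_integrable (\<lambda>x. k x * bump n c d x)" if "locally_integrable k" for k c d
      using locally_integrable_mult_continuous[OF bump_span_continuous[OF bump_in_span] that]
      by (simp add: mult.commute)
    have lin: "(LINT x|lebesgue. k x * \<omega> x) =
        ?I n 0 1 * (LINT x|lebesgue. k x * bump n a b x) - ?I n a b * (LINT x|lebesgue. k x * bump n 0 1 x)"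
      if "locally_integrable k" for k
    proof -
      have i: "integrable lebesgue (\<lambda>x. k x * bump n a b x)" "integrable lebesgue (\<lambda>x. k x * bump n 0 1 x)"
        using R by (auto intro!: locally_integrable_LINT(1)[of _ R] li that)
      have "(LINT x|lebesgue. k x * \<omega> x) =
          (LINT x|lebesgue. ?I n 0 1 * (k x * bump n a b x) - ?I n a b * (k x * bump n 0 1 x))"
        by (intro Bochner_Integration.integral_cong) (auto simp: \<omega>_def algebra_simps)
      then show ?thesis using i by simp
    qed
    have \<omega>0: "\<omega> x = 0" if "\<bar>x\<bar> \<ge> R" for x using R(2,3)[OF that] by (simp add: \<omega>_def)
    have "integral {- R..R} \<omega> = (LINT x|lebesgue. \<omega> x)"
      using locally_integrable_LINT(2)[of \<omega> R] \<omega>0 bump_span_continuous[OF span] locally_integrable_continuous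
      by auto
    also have "\<dots> = 0" using lin[OF l1] by simp
    finally obtain \<psi> where "test_fun \<psi>" "deriv \<psi> = \<omega>"
      using test_fun_primitive_of_bump_span[OF span R0 \<omega>0] by blast
    then have "(LINT x|lebesgue. h x * \<omega> x) = 0" using zero[of \<psi>] by simp
    then show ?thesis using lin[OF h] by (simp add: mult.commute)
  qed
  moreover have "(\<lambda>n. ?J n a b * ?I n 0 1) \<longlonglongrightarrow> integral {a..b} h * integral {0..1::real} (\<lambda>_. 1::real)" for a b
    by (intro tendsto_mult LINT_bump_tendsto[OF h] LINT_bump_tendsto[OF l1])
  moreover have "(\<lambda>n. ?J n 0 1 * ?I n a b) \<longlonglongrightarrow> integral {0..1} h * integral {a..b} (\<lambda>_. 1::real)" for a b
    by (intro tendsto_mult LINT_bump_tendsto[OF h] LINT_bump_tendsto[OF l1])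
  ultimately have eq: "integral {a..b} h * integral {0..1::real} (\<lambda>_. 1::real)
      = integral {0..1} h * integral {a..b} (\<lambda>_. 1::real)" for a b
    using LIMSEQ_unique by (metis (no_types, lifting) ext)
  define c where "c = integral {0..1} h"
  have "integral {a..b} (\<lambda>x. h x - c) = 0" if "a < b" for a b
  proof -
    have "integral {a..b} (\<lambda>x. h x - c) = integral {a..b} h - integral {a..b} (\<lambda>_. c)"
      using h by (intro Henstock_Kurzweil_Integration.integral_diff) (auto intro: locally_integrable_integrable_on)
    then show ?thesis using eq[of a b] that by (simp add: c_def)
  qed
  then have "AE x in lebesgue. h x - c = 0"
    by (intro AE_eq_0_if_integrals_0 locally_integrable_diff h locally_integrable_continuous continuous_intros)
  then show ?thesis by auto
qed

text \<open>The difference of \<open>g\<close> and any primitive of its weak derivative has weak derivative zero.\<close>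

lemma weak_deriv_imp_is_primitive:
  assumes "has_weak_deriv g k"
  obtains G where "is_primitive G k" "AE x in lebesgue. g x = G x"
proof -
  have lg: "locally_integrable g" and lk: "locally_integrable k"
    and w: "\<And>\<psi>. test_fun \<psi> \<Longrightarrow> (LINT x|lebesgue. g x * deriv \<psi> x) = - (LINT x|lebesgue. k x * \<psi> x)"
    using assms by (auto simp: has_weak_deriv_def)
  define U where "U = primitive_of k"
  have U: "is_primitive U k" using is_primitive_primitive_of[OF lk] by (simp add: U_def)
  have lU: "locally_integrable U" using is_primitive_continuous[OF U] by (rule locally_integrable_continuous)
  have "\<exists>c. AE x in lebesgue. g x - U x = c"
  proof (rule constant_if_weak_deriv_zero)
    show "locally_integrable (\<lambda>x. g x - U x)" by (intro locally_integrable_diff lg lU)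
    fix \<psi> assume t: "test_fun \<psi>"
    obtain R where R: "\<And>x. \<bar>x\<bar> \<ge> R \<Longrightarrow> deriv \<psi> x = 0" and c: "continuous_on UNIV (deriv \<psi>)"
      using test_fun_props[OF t] by metis
    have i: "integrable lebesgue (\<lambda>x. l x * deriv \<psi> x)" if "locally_integrable l" for l
      using locally_integrable_LINT(1)[of "\<lambda>x. deriv \<psi> x * l x" R] R
        locally_integrable_mult_continuous[OF c that] by (simp add: mult.commute)
    have "(LINT x|lebesgue. (g x - U x) * deriv \<psi> x)
       = (LINT x|lebesgue. g x * deriv \<psi> x) - (LINT x|lebesgue. U x * deriv \<psi> x)"
      using i[OF lg] i[OF lU] by (simp add: left_diff_distrib)
    then show "(LINT x|lebesgue. (g x - U x) * deriv \<psi> x) = 0"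
      using w[OF t] is_primitive_imp_weak_deriv[OF U t] by simp
  qed
  then obtain c where c: "AE x in lebesgue. g x - U x = c" by blast
  show ?thesis
  proof (rule that[of "\<lambda>x. U x + c"])
    show "is_primitive (\<lambda>x. U x + c) k" using U by (simp add: is_primitive_def)
    show "AE x in lebesgue. g x = U x + c" using c by (auto elim!: eventually_mono)
  qed
qed

section \<open>Square integrable functions on the line\<close>

lemma mem_Lq2: "g \<in> Lq 2 \<longleftrightarrow> g \<in> borel_measurable lebesgue \<and> integrable lebesgue (\<lambda>x. (g x)\<^sup>2)"
  by (simp add: Lq_def)

lemma Lq2_borel [measurable_dest]: "g \<in> Lq 2 \<Longrightarrow> g \<in> borel_measurable lebesgue"
  by (simp add: mem_Lq2)

lemma Lq2_square: "g \<in> Lq 2 \<Longrightarrow> integrable lebesgue (\<lambda>x. (g x)\<^sup>2)"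
  by (simp add: mem_Lq2)

lemma Lq_norm2: "Lq_norm 2 g = sqrt (LINT x|lebesgue. (g x)\<^sup>2)"
  by (simp add: Lq_norm_def powr_half_sqrt)

lemma Lq2_bound:
  assumes "g \<in> Lq 2" "h \<in> borel_measurable lebesgue" "AE x in lebesgue. \<bar>h x\<bar> \<le> K * \<bar>g x\<bar>"
  shows "h \<in> Lq 2"
proof -
  have "integrable lebesgue (\<lambda>x. (h x)\<^sup>2)"
  proof (rule Bochner_Integration.integrable_bound)
    show "integrable lebesgue (\<lambda>x. K\<^sup>2 * (g x)\<^sup>2)" using Lq2_square[OF assms(1)] by simp
    show "AE x in lebesgue. norm ((h x)\<^sup>2) \<le> norm (K\<^sup>2 * (g x)\<^sup>2)"
      using assms(3)
    proof eventually_elim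
      case (elim x)
      then have "\<bar>h x\<bar>\<^sup>2 \<le> (K * \<bar>g x\<bar>)\<^sup>2" by (intro power_mono) auto
      then show ?case by (simp add: power_mult_distrib)
    qed
  qed (use assms(2) in simp)
  then show ?thesis using assms(2) by (simp add: mem_Lq2)
qed

lemma Lq2_cong_AE:
  "g \<in> Lq 2 \<Longrightarrow> h \<in> borel_measurable lebesgue \<Longrightarrow> AE x in lebesgue. g x = h x \<Longrightarrow> h \<in> Lq 2"
  by (erule Lq2_bound[where K = 1]) (auto elim!: eventually_mono)

lemma Lq2_mult_integrable:
  assumes "g \<in> Lq 2" "h \<in> Lq 2" shows "integrable lebesgue (\<lambda>x. g x * h x)"
proof (rule Bochner_Integration.integrable_bound)
  show "integrable lebesgue (\<lambda>x. (g x)\<^sup>2 + (h x)\<^sup>2)"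
    using assms by (intro Bochner_Integration.integrable_add Lq2_square)
  show "AE x in lebesgue. norm (g x * h x) \<le> norm ((g x)\<^sup>2 + (h x)\<^sup>2)"
  proof (intro always_eventually allI)
    fix x
    have "0 \<le> (\<bar>g x\<bar> - \<bar>h x\<bar>)\<^sup>2" by simp
    then have "2 * (\<bar>g x\<bar> * \<bar>h x\<bar>) \<le> (g x)\<^sup>2 + (h x)\<^sup>2" by (simp add: power2_diff)
    moreover have "0 \<le> \<bar>g x\<bar> * \<bar>h x\<bar>" by (rule mult_nonneg_nonneg) auto
    ultimately have "\<bar>g x\<bar> * \<bar>h x\<bar> \<le> (g x)\<^sup>2 + (h x)\<^sup>2" by linarith
    then show "norm (g x * h x) \<le> norm ((g x)\<^sup>2 + (h x)\<^sup>2)" by (simp add: abs_mult)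
  qed
qed (use assms in \<open>auto simp: mem_Lq2\<close>)

lemma Lq2_add: assumes "g \<in> Lq 2" "h \<in> Lq 2" shows "(\<lambda>x. g x + h x) \<in> Lq 2"
proof -
  have "integrable lebesgue (\<lambda>x. (g x)\<^sup>2 + (h x)\<^sup>2 + 2 * (g x * h x))"
    using assms Lq2_square Lq2_mult_integrable by (intro Bochner_Integration.integrable_add integrable_mult_right) auto
  then show ?thesis using assms by (auto simp: mem_Lq2 power2_sum mult.assoc intro!: borel_measurable_add)
qed

lemma Lq2_cmult: "g \<in> Lq 2 \<Longrightarrow> (\<lambda>x. c * g x) \<in> Lq 2"
  by (auto simp: mem_Lq2 power_mult_distrib intro!: borel_measurable_times)

lemma Lq2_uminus: "g \<in> Lq 2 \<Longrightarrow> (\<lambda>x. - g x) \<in> Lq 2"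
  by (simp add: mem_Lq2)

lemma Lq2_diff: "g \<in> Lq 2 \<Longrightarrow> h \<in> Lq 2 \<Longrightarrow> (\<lambda>x. g x - h x) \<in> Lq 2"
  using Lq2_add[OF _ Lq2_uminus, of g h] by simp

lemma Lq2_bounded_mult:
  assumes "g \<in> Lq 2" "b \<in> borel_measurable lebesgue" "\<And>x. \<bar>b x\<bar> \<le> K"
  shows "(\<lambda>x. b x * g x) \<in> Lq 2"
  by (rule Lq2_bound[OF assms(1), where K = K])
     (use assms Lq2_borel in \<open>auto simp: abs_mult intro!: mult_right_mono borel_measurable_times\<close>)

lemma Lq2_square_add_le:
  assumes "g \<in> Lq 2" "h \<in> Lq 2"
  shows "(LINT x|lebesgue. (g x + h x)\<^sup>2) \<le> 2 * (LINT x|lebesgue. (g x)\<^sup>2) + 2 * (LINT x|lebesgue. (h x)\<^sup>2)"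
proof -
  have "(LINT x|lebesgue. (g x + h x)\<^sup>2) \<le> (LINT x|lebesgue. 2 * (g x)\<^sup>2 + 2 * (h x)\<^sup>2)"
  proof (rule integral_mono)
    fix x
    have "0 \<le> (g x - h x)\<^sup>2" by simp
    then show "(g x + h x)\<^sup>2 \<le> 2 * (g x)\<^sup>2 + 2 * (h x)\<^sup>2" by (simp add: power2_sum power2_diff)
  qed (use assms Lq2_square[OF Lq2_add[OF assms]] Lq2_square in auto)
  then show ?thesis using assms by (simp add: Lq2_square)
qed

lemma Lq2_square_diff_le:
  assumes "g \<in> Lq 2" "h \<in> Lq 2"
  shows "(LINT x|lebesgue. (g x - h x)\<^sup>2) \<le> 2 * (LINT x|lebesgue. (g x)\<^sup>2) + 2 * (LINT x|lebesgue. (h x)\<^sup>2)"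
  using Lq2_square_add_le[OF assms(1) Lq2_uminus[OF assms(2)]] by simp

text \<open>The quadratic \<open>s \<mapsto> \<integral>(g + s h)\<^sup>2\<close> is nonnegative; evaluate it at its minimum, or far out if it is
  affine.\<close>

lemma Lq2_Cauchy_Schwarz:
  assumes "g \<in> Lq 2" "h \<in> Lq 2"
  shows "(LINT x|lebesgue. g x * h x)\<^sup>2 \<le> (LINT x|lebesgue. (g x)\<^sup>2) * (LINT x|lebesgue. (h x)\<^sup>2)"
proof -
  let ?A = "LINT x|lebesgue. (g x)\<^sup>2" and ?B = "LINT x|lebesgue. (h x)\<^sup>2" and ?C = "LINT x|lebesgue. g x * h x"
  have q: "0 \<le> ?A + 2 * s * ?C + s\<^sup>2 * ?B" for s
  proof -
    have "0 \<le> (LINT x|lebesgue. (g x + s * h x)\<^sup>2)" by simp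
    also have "\<dots> = (LINT x|lebesgue. (g x)\<^sup>2 + 2 * s * (g x * h x) + s\<^sup>2 * (h x)\<^sup>2)"
      by (intro Bochner_Integration.integral_cong refl) (simp add: power2_sum power_mult_distrib)
    also have "\<dots> = ?A + 2 * s * ?C + s\<^sup>2 * ?B"
      using assms by (simp add: Lq2_square Lq2_mult_integrable)
    finally show ?thesis .
  qed
  have "?B \<ge> 0" by simp
  show ?thesis
  proof (cases "?B = 0")
    case True
    have "?C = 0"
    proof (rule ccontr)
      assume "?C \<noteq> 0"
      then show False using q[of "- (?A + 1) / (2 * ?C)"] True by (simp add: field_simps)
    qed
    then show ?thesis by simp
  next
    case False
    with \<open>?B \<ge> 0\<close> have "?B > 0" by linarith
    have "0 \<le> ?A - ?C\<^sup>2 / ?B"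
      using q[of "- ?C / ?B"] \<open>?B > 0\<close> by (simp add: field_simps power2_eq_square)
    then show ?thesis using \<open>?B > 0\<close> by (simp add: field_simps)
  qed
qed

lemma Lq2_Cauchy_Schwarz_abs:
  assumes "g \<in> Lq 2" "h \<in> Lq 2"
  shows "(LINT x|lebesgue. \<bar>g x\<bar> * \<bar>h x\<bar>)\<^sup>2 \<le> (LINT x|lebesgue. (g x)\<^sup>2) * (LINT x|lebesgue. (h x)\<^sup>2)"
  using Lq2_Cauchy_Schwarz[of "\<lambda>x. \<bar>g x\<bar>" "\<lambda>x. \<bar>h x\<bar>"] assms by (simp add: mem_Lq2)

text \<open>A substitute for decay at infinity: an integrable function is small somewhere in every
  interval that is long enough.\<close>

lemma integrable_small_values:
  fixes F :: "real \<Rightarrow> real"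
  assumes "integrable lebesgue F" "\<epsilon> > 0"
  shows "\<exists>B\<ge>0. \<forall>a b. b - a > B \<longrightarrow> (\<exists>y\<in>{a..b}. \<bar>F y\<bar> \<le> (\<epsilon>::real))"
proof -
  define B where "B = (LINT x|lebesgue. \<bar>F x\<bar>) / \<epsilon>"
  have "0 \<le> B" using assms(2) by (simp add: B_def)
  have "\<exists>y\<in>{a..b}. \<bar>F y\<bar> \<le> \<epsilon>" if ab: "b - a > B" for a b :: real
  proof (rule ccontr)
    have "a < b" using ab \<open>0 \<le> B\<close> by linarith
    assume "\<not> ?thesis"
    then have gt: "\<bar>F y\<bar> > \<epsilon>" if "y \<in> {a..b}" for y using that by force
    have "(b - a) * \<epsilon> = (LINT x|lebesgue. indicator {a..b} x * \<epsilon>)"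
      using \<open>a < b\<close> by (simp add: measure_completion)
    also have "\<dots> \<le> (LINT x|lebesgue. \<bar>F x\<bar>)"
    proof (rule integral_mono)
      show "integrable lebesgue (\<lambda>x. indicat_real {a..b} x * \<epsilon>)"
        by (intro integrable_mult_left integrable_real_indicator) (auto simp: emeasure_lborel_Icc_eq)
      show "integrable lebesgue (\<lambda>x. \<bar>F x\<bar>)" using assms(1) by simp
      show "indicat_real {a..b} x * \<epsilon> \<le> \<bar>F x\<bar>" for x
        using gt[of x] by (auto simp: indicator_def)
    qed
    finally show False using ab assms(2) by (simp add: B_def field_simps)
  qed
  with \<open>0 \<le> B\<close> show ?thesis by blast
qed

lemma is_primitive_set_integral:
  assumes "is_primitive F k" "integrable lebesgue k" "a \<le> b"
  shows "(LINT x|lebesgue. indicator {a..b} x * k x) = F b - F a"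
  using set_lebesgue_integral_eq_integral(2)[OF locally_integrableD[OF is_primitive_locally_integrable[OF assms(1)], of a b]]
    is_primitive_integral[OF assms(1,3)] by (simp add: set_lebesgue_integral_def)

text \<open>Compare the value at \<open>x\<close> with the value at some point where \<open>F\<close> is small.\<close>

lemma is_primitive_integrable_bound:
  assumes F: "is_primitive F k" and "integrable lebesgue F" "integrable lebesgue k"
  shows "\<bar>F x\<bar> \<le> (LINT x|lebesgue. \<bar>k x\<bar>)"
proof (rule field_le_epsilon)
  fix \<epsilon> :: real assume "\<epsilon> > 0"
  then obtain B where "B \<ge> 0" "\<And>a b. b - a > B \<Longrightarrow> \<exists>y\<in>{a..b}. \<bar>F y\<bar> \<le> \<epsilon>"
    using integrable_small_values[OF assms(2)] by metis
  from this(2)[where a = x and b = "x + B + 1"] obtain y where y: "y \<ge> x" "\<bar>F y\<bar> \<le> \<epsilon>" by auto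
  have "\<bar>F y - F x\<bar> = \<bar>LINT z|lebesgue. indicator {x..y} z * k z\<bar>"
    using is_primitive_set_integral[OF F assms(3) y(1)] by simp
  also have "\<dots> \<le> (LINT z|lebesgue. \<bar>indicator {x..y} z * k z\<bar>)"
    by (rule integral_abs_bound)
  also have "\<dots> \<le> (LINT z|lebesgue. \<bar>k z\<bar>)"
  proof (rule integral_mono)
    have "integrable lebesgue (\<lambda>z. indicator {x..y} z *\<^sub>R k z)"
      by (intro integrable_mult_indicator assms) auto
    then show "integrable lebesgue (\<lambda>z. \<bar>indicator {x..y} z * k z\<bar>)" by simp
  qed (use assms(3) in \<open>auto simp: indicator_def\<close>)
  finally show "\<bar>F x\<bar> \<le> (LINT x|lebesgue. \<bar>k x\<bar>) + \<epsilon>" using y by linarith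
qed

text \<open>Integrate over intervals that exhaust the line and whose end points are chosen such that
  \<open>F\<close> is small there.\<close>

lemma is_primitive_integral_zero:
  assumes F: "is_primitive F k" and "integrable lebesgue F" "integrable lebesgue k"
  shows "(LINT x|lebesgue. k x) = 0"
proof -
  have "\<exists>a b. a \<le> - real n \<and> real n \<le> b \<and> \<bar>F a\<bar> \<le> 1 / real (Suc n) \<and> \<bar>F b\<bar> \<le> 1 / real (Suc n)" for n
  proof -
    obtain B where "B \<ge> 0" and B: "\<And>a b. b - a > B \<Longrightarrow> \<exists>y\<in>{a..b}. \<bar>F y\<bar> \<le> 1 / real (Suc n)"
      using integrable_small_values[OF assms(2), of "1 / real (Suc n)"] by auto
    from B[where a = "- real n - B - 1" and b = "- real n"] B[where a = "real n" and b = "real n + B + 1"]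
    obtain y z where "y \<le> - real n" "\<bar>F y\<bar> \<le> 1 / real (Suc n)" "real n \<le> z" "\<bar>F z\<bar> \<le> 1 / real (Suc n)"
      by auto
    then show ?thesis by blast
  qed
  then obtain a b where ab: "\<And>n. a n \<le> - real n" "\<And>n. real n \<le> b n"
    "\<And>n. \<bar>F (a n)\<bar> \<le> 1 / real (Suc n)" "\<And>n. \<bar>F (b n)\<bar> \<le> 1 / real (Suc n)" by metis
  have "(\<lambda>n. LINT x|lebesgue. indicator {a n..b n} x * k x) \<longlonglongrightarrow> (LINT x|lebesgue. k x)"
  proof (rule integral_dominated_convergence[where w = "\<lambda>x. \<bar>k x\<bar>"])
    show "AE x in lebesgue. (\<lambda>n. indicator {a n..b n} x * k x) \<longlonglongrightarrow> k x"
    proof (intro always_eventually allI)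
      fix x :: real
      obtain N :: nat where N: "\<bar>x\<bar> \<le> N" using real_arch_simple by blast
      have "\<forall>\<^sub>F n in sequentially. k x = indicator {a n..b n} x * k x"
        using eventually_ge_at_top[of N]
      proof eventually_elim
        case (elim n)
        then have "\<bar>x\<bar> \<le> real n" using N by linarith
        then have "x \<in> {a n..b n}" using ab(1)[of n] ab(2)[of n] by auto
        then show ?case by simp
      qed
      then show "(\<lambda>n. indicator {a n..b n} x * k x) \<longlonglongrightarrow> k x"
        by (rule Lim_transform_eventually[OF tendsto_const])
    qed
  qed (use assms(3) in \<open>auto split: split_indicator intro!: borel_measurable_times borel_measurable_indicator\<close>)
  moreover have "(\<lambda>n. LINT x|lebesgue. indicator {a n..b n} x * k x) = (\<lambda>n. F (b n) - F (a n))"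
  proof
    fix n show "(LINT x|lebesgue. indicator {a n..b n} x * k x) = F (b n) - F (a n)"
      using ab(1)[of n] ab(2)[of n] by (intro is_primitive_set_integral F assms) linarith
  qed
  moreover have "(\<lambda>n. F (b n) - F (a n)) \<longlonglongrightarrow> 0"
  proof -
    have "(\<lambda>n. F (b n)) \<longlonglongrightarrow> 0"
      by (rule Lim_null_comparison[OF _ LIMSEQ_Suc[OF lim_1_over_n]])
         (intro always_eventually allI, use ab(4) in simp)
    moreover have "(\<lambda>n. F (a n)) \<longlonglongrightarrow> 0"
      by (rule Lim_null_comparison[OF _ LIMSEQ_Suc[OF lim_1_over_n]])
         (intro always_eventually allI, use ab(3) in simp)
    ultimately show ?thesis using tendsto_diff[of "\<lambda>n. F (b n)" 0 sequentially "\<lambda>n. F (a n)" 0] by simp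
  qed
  ultimately show ?thesis using LIMSEQ_unique by metis
qed

lemma integral_by_parts_line:
  assumes F: "is_primitive F f" and G: "is_primitive G g"
    and "F \<in> Lq 2" "f \<in> Lq 2" "G \<in> Lq 2" "g \<in> Lq 2"
  shows "(LINT x|lebesgue. f x * G x) = - (LINT x|lebesgue. F x * g x)"
proof -
  have i: "integrable lebesgue (\<lambda>x. F x * G x)" "integrable lebesgue (\<lambda>x. G x * f x)"
    "integrable lebesgue (\<lambda>x. F x * g x)"
    using assms by (auto intro: Lq2_mult_integrable)
  have "(LINT x|lebesgue. G x * f x + F x * g x) = 0"
    using i by (intro is_primitive_integral_zero[OF is_primitive_mult[OF F G]]) auto
  then show ?thesis using i by (simp add: mult.commute)
qed

text \<open>The Sobolev embedding of \<open>H\<^sup>1\<close> into \<open>L\<^sup>\<infinity>\<close>: the square of \<open>F\<close> is a primitive of \<open>2 F f\<close>.\<close>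

lemma is_primitive_sup_bound:
  assumes F: "is_primitive F f" and "F \<in> Lq 2" "f \<in> Lq 2"
  shows "(F x)\<^sup>2 \<le> (LINT x|lebesgue. (F x)\<^sup>2) + (LINT x|lebesgue. (f x)\<^sup>2)"
proof -
  have i: "integrable lebesgue (\<lambda>x. F x * f x)" "integrable lebesgue (\<lambda>x. F x * F x)"
    using assms by (auto intro: Lq2_mult_integrable)
  have "\<bar>F x * F x\<bar> \<le> (LINT x|lebesgue. \<bar>F x * f x + F x * f x\<bar>)"
    using i by (intro is_primitive_integrable_bound[OF is_primitive_mult[OF F F]]) auto
  also have "\<dots> \<le> (LINT x|lebesgue. (F x)\<^sup>2 + (f x)\<^sup>2)"
  proof (rule integral_mono)
    show "\<bar>F x * f x + F x * f x\<bar> \<le> (F x)\<^sup>2 + (f x)\<^sup>2" for x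
    proof -
      have "0 \<le> (F x - f x)\<^sup>2" "0 \<le> (F x + f x)\<^sup>2" by simp_all
      then show ?thesis by (simp add: power2_sum power2_diff abs_le_iff)
    qed
  qed (use i assms in \<open>auto intro: Lq2_square\<close>)
  also have "\<dots> = (LINT x|lebesgue. (F x)\<^sup>2) + (LINT x|lebesgue. (f x)\<^sup>2)"
    using assms by (simp add: Lq2_square)
  finally show ?thesis by (simp add: power2_eq_square)
qed

lemma continuous_eq_if_AE_eq:
  fixes F G :: "real \<Rightarrow> real"
  assumes "continuous_on UNIV F" "continuous_on UNIV G" "AE x in lebesgue. F x = G x"
  shows "F = G"
proof (rule ccontr)
  assume "F \<noteq> G"
  then have ne: "{x. F x \<noteq> G x} \<noteq> {}" by auto
  have "open {x. F x \<noteq> G x}" using assms(1,2) by (rule open_Collect_neq)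
  then have "\<not> negligible {x. F x \<noteq> G x}" using ne by (rule open_not_negligible)
  moreover have "negligible {x. F x \<noteq> G x}"
    using assms(3) by (simp add: negligible_iff_null_sets completion.AE_iff_null_sets)
  ultimately show False by blast
qed

section \<open>Regular representatives of solutions\<close>

lemma bounded_support_powr:
  fixes g :: "real \<Rightarrow> real"
  assumes "g \<in> borel_measurable lebesgue" "\<And>x. \<bar>g x\<bar> \<le> K" "\<And>x. \<bar>x\<bar> > R \<Longrightarrow> g x = 0" "R \<ge> 0" "q > 0"
  shows "integrable lebesgue (\<lambda>x. \<bar>g x\<bar> powr q)"
    and "(LINT x|lebesgue. \<bar>g x\<bar> powr q) \<le> K powr q * (2 * R)"
proof -
  have le: "\<bar>g x\<bar> powr q \<le> indicator {- R..R} x * K powr q" for x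
    using assms(2)[of x] assms(3)[of x] \<open>q > 0\<close>
    by (cases "\<bar>x\<bar> \<le> R") (auto intro!: powr_mono2 simp: abs_le_iff indicator_def)
  have i: "integrable lebesgue (\<lambda>x. indicator {- R..R} x * K powr q)"
    by (intro integrable_mult_left integrable_real_indicator) (auto simp: emeasure_lborel_Icc_eq)
  show g: "integrable lebesgue (\<lambda>x. \<bar>g x\<bar> powr q)"
    by (rule Bochner_Integration.integrable_bound[OF i])
       (use assms(1) le in \<open>auto intro!: always_eventually\<close>)
  have "(LINT x|lebesgue. \<bar>g x\<bar> powr q) \<le> (LINT x|lebesgue. indicator {- R..R} x * K powr q)"
    by (rule integral_mono[OF g i le])
  also have "\<dots> = K powr q * (2 * R)" using \<open>R \<ge> 0\<close> by (simp add: measure_completion)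
  finally show "(LINT x|lebesgue. \<bar>g x\<bar> powr q) \<le> K powr q * (2 * R)" .
qed

lemma bounded_support_Lq:
  fixes g :: "real \<Rightarrow> real"
  assumes "g \<in> borel_measurable lebesgue" "\<And>x. \<bar>g x\<bar> \<le> K" "\<And>x. \<bar>x\<bar> > R \<Longrightarrow> g x = 0" "R \<ge> 0" "q > 0"
  shows "g \<in> Lq q"
  using bounded_support_powr(1)[OF assms] assms(1) by (simp add: Lq_def)

lemma borel_imp_lebesgue: "g \<in> borel_measurable borel \<Longrightarrow> g \<in> borel_measurable lebesgue"
  by (simp add: measurable_completion)

lemma continuous_imp_lebesgue:
  fixes g :: "real \<Rightarrow> real"
  shows "continuous_on UNIV g \<Longrightarrow> g \<in> borel_measurable lebesgue"
  by (intro borel_imp_lebesgue borel_measurable_continuous_onI)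

text \<open>The choice made in \<open>weak_deriv\<close> is immaterial: two weak derivatives have the same
  continuous primitive, hence the same integrals over all intervals.\<close>

lemma weak_deriv_in_Lq2:
  assumes "has_weak_deriv v w" "w \<in> Lq 2"
  shows "weak_deriv v \<in> Lq 2" "has_weak_deriv v (weak_deriv v)"
proof -
  show 1: "has_weak_deriv v (weak_deriv v)"
    unfolding weak_deriv_def by (rule someI[of "has_weak_deriv v", OF assms(1)])
  obtain G where G: "is_primitive G w" "AE x in lebesgue. v x = G x"
    using weak_deriv_imp_is_primitive[OF assms(1)] by blast
  obtain H where H: "is_primitive H (weak_deriv v)" "AE x in lebesgue. v x = H x"
    using weak_deriv_imp_is_primitive[OF 1] by blast
  have "AE x in lebesgue. G x = H x" using G(2) H(2) by eventually_elim simp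
  then have "G = H"
    by (intro continuous_eq_if_AE_eq is_primitive_continuous[OF G(1)] is_primitive_continuous[OF H(1)])
  then have d: "is_primitive (\<lambda>x. G x - G x) (\<lambda>x. w x - weak_deriv v x)"
    using is_primitive_diff[OF G(1) H(1)] by simp
  have "AE x in lebesgue. w x - weak_deriv v x = 0"
    using is_primitive_integral[OF d]
    by (intro AE_eq_0_if_integrals_0 is_primitive_locally_integrable[OF d]) simp
  then have "AE x in lebesgue. w x = weak_deriv v x" by eventually_elim simp
  moreover have "weak_deriv v \<in> borel_measurable lebesgue"
    using is_primitive_locally_integrable[OF H(1)] by (rule locally_integrable_borel)
  ultimately show "weak_deriv v \<in> Lq 2" using assms(2) Lq2_cong_AE by blast
qed

lemma H1_representative:
  assumes "v \<in> Hk 1" "Hk_norm 1 v \<le> B"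
  obtains V V' where "is_primitive V V'" "AE x in lebesgue. v x = V x" "V \<in> Lq 2" "V' \<in> Lq 2"
    "(LINT x|lebesgue. (V x)\<^sup>2) \<le> B\<^sup>2" "(LINT x|lebesgue. (V' x)\<^sup>2) \<le> B\<^sup>2"
proof -
  from assms(1) obtain w where v: "v \<in> Lq 2" and w: "has_weak_deriv v w" "w \<in> Lq 2"
    by (auto simp: One_nat_def)
  note wd = weak_deriv_in_Lq2[OF w]
  obtain V where V: "is_primitive V (weak_deriv v)" "AE x in lebesgue. v x = V x"
    using weak_deriv_imp_is_primitive[OF wd(2)] by blast
  have Vm: "V \<in> borel_measurable lebesgue"
    using is_primitive_continuous[OF V(1)] by (rule continuous_imp_lebesgue)
  have VL: "V \<in> Lq 2" using Lq2_cong_AE[OF v Vm V(2)] .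
  have eq: "(LINT x|lebesgue. (V x)\<^sup>2) = (LINT x|lebesgue. (v x)\<^sup>2)"
    using V(2) by (intro integral_cong_AE) (use v VL Lq2_borel in \<open>auto elim!: eventually_mono\<close>)
  have "sqrt ((LINT x|lebesgue. (v x)\<^sup>2) + (LINT x|lebesgue. (weak_deriv v x)\<^sup>2)) \<le> B"
    using assms(2) by (simp add: Hk_norm_def Lq_norm2)
  then have "(LINT x|lebesgue. (v x)\<^sup>2) + (LINT x|lebesgue. (weak_deriv v x)\<^sup>2) \<le> B\<^sup>2"
    by (rule sqrt_le_D)
  moreover have "(LINT x|lebesgue. (v x)\<^sup>2) \<ge> 0" "(LINT x|lebesgue. (weak_deriv v x)\<^sup>2) \<ge> 0" by simp_all
  ultimately show ?thesis using that[OF V VL wd(1)] eq by linarith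
qed

text \<open>A solution with its smooth representatives: at each time \<open>U t\<close> is continuously differentiable with
  derivative \<open>V t\<close>, it agrees almost everywhere with \<open>u t\<close>, and the bounds \<open>M\<close> are uniform in time.  The
  equation is expressed pointwise for the flux of the representatives.\<close>

definition regular_solution ::
  "(real \<Rightarrow> real) \<Rightarrow> (real \<Rightarrow> real) \<Rightarrow> real \<Rightarrow> real \<Rightarrow> real \<Rightarrow> (real \<Rightarrow> real \<Rightarrow> real) \<Rightarrow>
   (real \<Rightarrow> real \<Rightarrow> real) \<Rightarrow> (real \<Rightarrow> real \<Rightarrow> real) \<Rightarrow> (real \<Rightarrow> real \<Rightarrow> real) \<Rightarrow> bool" where
  "regular_solution f \<sigma> um up M u ut U V \<longleftrightarrow>
     has_time_deriv u ut \<and>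
     (\<forall>t\<ge>0. (AE x in lebesgue. u t x = U t x) \<and>
        (\<forall>x. (U t has_real_derivative V t x) (at x)) \<and> continuous_on UNIV (V t) \<and>
        (\<forall>x. \<bar>U t x\<bar> \<le> M) \<and> (\<forall>x. \<bar>V t x\<bar> \<le> M) \<and>
        V t \<in> Lq 2 \<and> (LINT x|lebesgue. (V t x)\<^sup>2) \<le> M \<and>
        (\<lambda>x. U t x - riemann_data um up x) \<in> Lq 2) \<and>
     (\<forall>t>0. is_primitive (\<lambda>x. f (U t x) - \<sigma> (V t x)) (\<lambda>x. - ut t x))"

lemma riemann_data_borel [measurable]: "riemann_data um up \<in> borel_measurable borel"
  unfolding riemann_data_def by measurable

text \<open>Since \<open>u\<^sub>x\<close> is in \<open>H\<^sup>1\<close>, it has a bounded continuous representative, whose primitive represents \<open>u\<close>.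
  The flux is continuous for these representatives, hence it is equal to, not just almost everywhere
  equal to, a primitive of \<open>-u\<^sub>t\<close>.\<close>

lemma global_solution_imp_regular:
  assumes sol: "global_solution f \<sigma> um up u0 u"
    and cf: "continuous_on UNIV f" and cs: "continuous_on UNIV \<sigma>"
  shows "\<exists>M ut U V. M > 0 \<and> regular_solution f \<sigma> um up M u ut U V"
proof -
  obtain ux ut where CB0: "CB_Hk 0 (\<lambda>t x. u t x - riemann_data um up x)"
    and wd: "\<And>t. t \<ge> 0 \<Longrightarrow> has_weak_deriv (u t) (ux t)" and CB1: "CB_Hk 1 ux"
    and td: "has_time_deriv u ut"
    and eqn: "\<And>t. t > 0 \<Longrightarrow> has_weak_deriv (\<lambda>x. f (u t x) - \<sigma> (ux t x)) (\<lambda>x. - ut t x)"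
    using sol unfolding global_solution_def by blast
  obtain B0 where B0: "\<And>t. t \<ge> 0 \<Longrightarrow> (\<lambda>x. u t x - riemann_data um up x) \<in> Lq 2"
    "\<And>t. t \<ge> 0 \<Longrightarrow> Hk_norm 0 (\<lambda>x. u t x - riemann_data um up x) \<le> B0"
    using CB0 unfolding CB_Hk_def by auto
  obtain B where B: "\<And>t. t \<ge> 0 \<Longrightarrow> ux t \<in> Hk 1" "\<And>t. t \<ge> 0 \<Longrightarrow> Hk_norm 1 (ux t) \<le> B"
    using CB1 unfolding CB_Hk_def by auto
  \<comment> \<open>The Riemann data jump, so \<open>u\<close> is compared with a continuous interpolation of them.\<close>
  define \<zeta> where "\<zeta> x = um + (up - um) * max 0 (min 1 x)" for x
  define \<zeta>' where "\<zeta>' x = (up - um) * indicator {0<..<1} x" for x :: real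
  have c\<zeta>: "continuous_on UNIV \<zeta>" unfolding \<zeta>_def by (intro continuous_intros)
  have prim\<zeta>: "is_primitive \<zeta> \<zeta>'"
  proof (rule is_primitive_deriv[of "{0, 1}"])
    fix x :: real assume x: "x \<notin> {0, 1}"
    consider "x < 0" | "0 < x" "x < 1" | "x > 1" using x by force
    then show "(\<zeta> has_real_derivative \<zeta>' x) (at x)"
    proof cases
      case 1
      have "\<forall>\<^sub>F y in nhds x. \<zeta> y = um"
        by (rule eventually_mono[OF eventually_nhds_in_open[of "{..<0}" x]]) (use 1 in \<open>auto simp: \<zeta>_def\<close>)
      then show ?thesis using 1
        by (subst DERIV_cong_ev[OF refl _ refl, where g = "\<lambda>_. um"]) (auto simp: \<zeta>'_def)
    next
      case 2
      have "\<forall>\<^sub>F y in nhds x. \<zeta> y = um + (up - um) * y"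
        by (rule eventually_mono[OF eventually_nhds_in_open[of "{0<..<1}" x]]) (use 2 in \<open>auto simp: \<zeta>_def\<close>)
      then show ?thesis using 2
        by (subst DERIV_cong_ev[OF refl _ refl, where g = "\<lambda>y. um + (up - um) * y"])
           (auto simp: \<zeta>'_def intro!: derivative_eq_intros)
    next
      case 3
      have "\<forall>\<^sub>F y in nhds x. \<zeta> y = up"
        by (rule eventually_mono[OF eventually_nhds_in_open[of "{1<..}" x]]) (use 3 in \<open>auto simp: \<zeta>_def\<close>)
      then show ?thesis using 3
        by (subst DERIV_cong_ev[OF refl _ refl, where g = "\<lambda>_. up"]) (auto simp: \<zeta>'_def)
    qed
  next
    show "\<exists>B. \<forall>x. \<bar>x\<bar> \<le> R \<longrightarrow> \<bar>\<zeta>' x\<bar> \<le> B" for R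
      by (intro exI[of _ "\<bar>up - um\<bar>"]) (auto simp: \<zeta>'_def indicator_def)
  qed (use c\<zeta> in auto)
  have \<zeta>b: "\<bar>\<zeta> x\<bar> \<le> \<bar>um\<bar> + \<bar>up - um\<bar>" for x
  proof -
    have "\<bar>(up - um) * max 0 (min 1 x)\<bar> \<le> \<bar>up - um\<bar> * 1"
      unfolding abs_mult by (intro mult_left_mono) auto
    then show ?thesis unfolding \<zeta>_def
      by (intro order_trans[OF abs_triangle_ineq] add_left_mono) simp
  qed
  have r\<zeta>: "(\<lambda>x. riemann_data um up x - \<zeta> x) \<in> Lq 2"
  proof (rule bounded_support_Lq[where R = 1 and K = "2 * \<bar>um\<bar> + \<bar>up\<bar> + \<bar>up - um\<bar>"])
    show "(\<lambda>x. riemann_data um up x - \<zeta> x) \<in> borel_measurable lebesgue"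
      using borel_imp_lebesgue[OF riemann_data_borel] continuous_imp_lebesgue[OF c\<zeta>] by (intro borel_measurable_diff)
    show "\<bar>riemann_data um up x - \<zeta> x\<bar> \<le> 2 * \<bar>um\<bar> + \<bar>up\<bar> + \<bar>up - um\<bar>" for x
      using \<zeta>b[of x] unfolding riemann_data_def by (smt (verit))
  qed (auto simp: riemann_data_def \<zeta>_def)
  have \<zeta>'L: "\<zeta>' \<in> Lq 2"
  proof (rule bounded_support_Lq[where R = 1 and K = "\<bar>up - um\<bar>"])
    show "\<zeta>' \<in> borel_measurable lebesgue"
      using is_primitive_locally_integrable[OF prim\<zeta>] by (rule locally_integrable_borel)
  qed (auto simp: \<zeta>'_def indicator_def)
  define n1 where "n1 = (LINT x|lebesgue. (riemann_data um up x - \<zeta> x)\<^sup>2)"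
  define n2 where "n2 = (LINT x|lebesgue. (\<zeta>' x)\<^sup>2)"
  have n0: "n1 \<ge> 0" "n2 \<ge> 0" by (simp_all add: n1_def n2_def)
  define K where "K = 2 * B0\<^sup>2 + 2 * n1 + (2 * B\<^sup>2 + 2 * n2)"
  define M where "M = \<bar>um\<bar> + \<bar>up - um\<bar> + K + 2 * B\<^sup>2 + 1"
  have K0: "K \<ge> 0" using n0 by (simp add: K_def)
  have M0: "M > 0" using K0 unfolding M_def by (simp add: add_nonneg_pos)
  have sq_le: "\<bar>a\<bar> \<le> b + 1" if "a\<^sup>2 \<le> b" for a b :: real
  proof -
    have "0 \<le> (\<bar>a\<bar> - 1)\<^sup>2" by simp
    then have "2 * \<bar>a\<bar> \<le> a\<^sup>2 + 1" by (simp add: power2_diff)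
    moreover have "0 \<le> b" using that zero_le_power2[of a] by linarith
    ultimately show ?thesis using that by linarith
  qed
  define Q where "Q t U V \<longleftrightarrow> (AE x in lebesgue. u t x = U x) \<and>
        (\<forall>x. (U has_real_derivative V x) (at x)) \<and> continuous_on UNIV V \<and>
        (\<forall>x. \<bar>U x\<bar> \<le> M) \<and> (\<forall>x. \<bar>V x\<bar> \<le> M) \<and> V \<in> Lq 2 \<and> (LINT x|lebesgue. (V x)\<^sup>2) \<le> M \<and>
        (\<lambda>x. U x - riemann_data um up x) \<in> Lq 2 \<and>
        (t > 0 \<longrightarrow> is_primitive (\<lambda>x. f (U x) - \<sigma> (V x)) (\<lambda>x. - ut t x))" for t U V
  have ex: "\<exists>U V. Q t U V" if t: "t \<ge> 0" for t
  proof -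
    obtain V V' where V: "is_primitive V V'" "AE x in lebesgue. ux t x = V x" "V \<in> Lq 2" "V' \<in> Lq 2"
      "(LINT x|lebesgue. (V x)\<^sup>2) \<le> B\<^sup>2" "(LINT x|lebesgue. (V' x)\<^sup>2) \<le> B\<^sup>2"
      using H1_representative[OF B[OF t]] by blast
    obtain U where U: "is_primitive U (ux t)" "AE x in lebesgue. u t x = U x"
      using weak_deriv_imp_is_primitive[OF wd[OF t]] by blast
    have cV: "continuous_on UNIV V" using is_primitive_continuous[OF V(1)] .
    have cU: "continuous_on UNIV U" using is_primitive_continuous[OF U(1)] .
    have UV: "is_primitive U V" using is_primitive_cong_AE[OF U(1) V(2)] V(3) Lq2_borel by blast
    have dU: "(U has_real_derivative V x) (at x)" for x
      by (rule is_primitive_has_derivative[OF UV cV])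
    have Vsup: "\<bar>V x\<bar> \<le> M" for x
      using sq_le[OF order_trans[OF is_primitive_sup_bound[OF V(1,3,4), of x] add_mono[OF V(5,6)]]] K0
      by (simp add: M_def)
    have Ur: "(\<lambda>x. U x - riemann_data um up x) \<in> Lq 2"
    proof (rule Lq2_cong_AE[OF B0(1)[OF t]])
      show "(\<lambda>x. U x - riemann_data um up x) \<in> borel_measurable lebesgue"
        using borel_imp_lebesgue[OF riemann_data_borel] continuous_imp_lebesgue[OF cU] by (intro borel_measurable_diff)
      show "AE x in lebesgue. u t x - riemann_data um up x = U x - riemann_data um up x"
        using U(2) by eventually_elim simp
    qed
    have Ur2: "(LINT x|lebesgue. (U x - riemann_data um up x)\<^sup>2) \<le> B0\<^sup>2"
    proof -
      have "(LINT x|lebesgue. (U x - riemann_data um up x)\<^sup>2) = (LINT x|lebesgue. (u t x - riemann_data um up x)\<^sup>2)"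
        using U(2) by (intro integral_cong_AE)
          (use Lq2_borel[OF Ur] Lq2_borel[OF B0(1)[OF t]] in \<open>auto elim!: eventually_mono\<close>)
      moreover have "sqrt (LINT x|lebesgue. (u t x - riemann_data um up x)\<^sup>2) \<le> B0"
        using B0(2)[OF t] by (simp add: Hk_norm_def Lq_norm2)
      ultimately show ?thesis using sqrt_le_D by auto
    qed
    have eP: "is_primitive (\<lambda>x. U x - \<zeta> x) (\<lambda>x. V x - \<zeta>' x)"
      by (rule is_primitive_diff[OF UV prim\<zeta>])
    have eL: "(\<lambda>x. U x - \<zeta> x) \<in> Lq 2" using Lq2_add[OF Ur r\<zeta>] by simp
    have eL': "(\<lambda>x. V x - \<zeta>' x) \<in> Lq 2" by (rule Lq2_diff[OF V(3) \<zeta>'L])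
    have "(LINT x|lebesgue. (U x - \<zeta> x)\<^sup>2) \<le> 2 * B0\<^sup>2 + 2 * n1"
      using Lq2_square_add_le[OF Ur r\<zeta>] Ur2 by (simp add: n1_def)
    moreover have "(LINT x|lebesgue. (V x - \<zeta>' x)\<^sup>2) \<le> 2 * B\<^sup>2 + 2 * n2"
      using Lq2_square_diff_le[OF V(3) \<zeta>'L] V(5) by (simp add: n2_def)
    ultimately have "(U x - \<zeta> x)\<^sup>2 \<le> K" for x
      using is_primitive_sup_bound[OF eP eL eL', of x] by (simp add: K_def)
    then have "\<bar>U x - \<zeta> x\<bar> \<le> K + 1" for x using sq_le by blast
    then have Usup: "\<bar>U x\<bar> \<le> M" for x
    proof -
      have "\<bar>U x\<bar> \<le> \<bar>\<zeta> x\<bar> + \<bar>U x - \<zeta> x\<bar>" by simp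
      then show ?thesis using \<zeta>b[of x] \<open>\<bar>U x - \<zeta> x\<bar> \<le> K + 1\<close> zero_le_power2[of B] unfolding M_def by linarith
    qed
    have flux: "is_primitive (\<lambda>x. f (U x) - \<sigma> (V x)) (\<lambda>x. - ut t x)" if t0: "t > 0"
    proof -
      obtain J where J: "is_primitive J (\<lambda>x. - ut t x)" "AE x in lebesgue. f (u t x) - \<sigma> (ux t x) = J x"
        using weak_deriv_imp_is_primitive[OF eqn[OF t0]] by blast
      have "AE x in lebesgue. f (U x) - \<sigma> (V x) = J x"
        using J(2) U(2) V(2) by eventually_elim simp
      then have "(\<lambda>x. f (U x) - \<sigma> (V x)) = J"
        using cU cV by (intro continuous_eq_if_AE_eq is_primitive_continuous[OF J(1)] continuous_intros
            continuous_on_compose2[OF cf] continuous_on_compose2[OF cs]) auto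
      then show ?thesis using J(1) by simp
    qed
    have "(LINT x|lebesgue. (V x)\<^sup>2) \<le> M" using V(5) K0 zero_le_power2[of B] unfolding M_def by linarith
    then show ?thesis using U(2) dU cV Usup Vsup V(3) Ur flux unfolding Q_def by blast
  qed
  obtain U V where "\<And>t. t \<ge> 0 \<Longrightarrow> Q t (U t) (V t)"
    using ex by metis
  then have "regular_solution f \<sigma> um up M u ut U V"
    using td unfolding regular_solution_def Q_def by simp
  then show ?thesis using M0 by blast
qed

section \<open>Entropies and their time derivative\<close>

lemma bounded_on_compact_interval:
  fixes g :: "real \<Rightarrow> real"
  assumes "continuous_on UNIV g"
  shows "\<exists>K>0. \<forall>x. \<bar>x\<bar> \<le> M \<longrightarrow> \<bar>g x\<bar> \<le> K"
proof -
  have "compact (g ` {- M..M})"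
    by (intro compact_continuous_image continuous_on_subset[OF assms]) auto
  then obtain K where "\<forall>x\<in>{- M..M}. \<bar>g x\<bar> \<le> K"
    by (auto dest!: compact_imp_bounded simp: bounded_iff)
  then show ?thesis
    by (intro exI[of _ "max K 1"]) (auto simp: abs_le_iff max.coboundedI1)
qed

lemma mean_value_between:
  fixes g g1 :: "real \<Rightarrow> real"
  assumes "\<And>x. (g has_real_derivative g1 x) (at x)"
  shows "\<exists>\<xi>. \<xi> \<in> {min a b..max a b} \<and> g a - g b = g1 \<xi> * (a - b)"
proof -
  consider "a < b" | "a = b" | "b < a" by linarith
  then show ?thesis
  proof cases
    case 1
    from MVT2[OF 1, of g g1] assms obtain z where "a < z" "z < b" "g b - g a = (b - a) * g1 z" by blast
    then show ?thesis by (intro exI[of _ z]) (auto simp: algebra_simps)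
  next
    case 2 then show ?thesis by auto
  next
    case 3
    from MVT2[OF 3, of g g1] assms obtain z where "b < z" "z < a" "g a - g b = (a - b) * g1 z" by blast
    then show ?thesis by (intro exI[of _ z]) (auto simp: algebra_simps)
  qed
qed

lemma lipschitz_on_compact_interval:
  fixes g g1 :: "real \<Rightarrow> real"
  assumes "\<And>x. (g has_real_derivative g1 x) (at x)" "continuous_on UNIV g1"
  shows "\<exists>L>0. \<forall>a b. \<bar>a\<bar> \<le> M \<longrightarrow> \<bar>b\<bar> \<le> M \<longrightarrow> \<bar>g a - g b\<bar> \<le> L * \<bar>a - b\<bar>"
proof -
  obtain L where L: "L > 0" "\<And>x. \<bar>x\<bar> \<le> M \<Longrightarrow> \<bar>g1 x\<bar> \<le> L"
    using bounded_on_compact_interval[OF assms(2)] by metis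
  have "\<bar>g a - g b\<bar> \<le> L * \<bar>a - b\<bar>" if "\<bar>a\<bar> \<le> M" "\<bar>b\<bar> \<le> M" for a b
  proof -
    obtain z where z: "z \<in> {min a b..max a b}" "g a - g b = g1 z * (a - b)"
      using mean_value_between[OF assms(1)] by metis
    have "\<bar>z\<bar> \<le> M" using z(1) that by (auto simp: min_def max_def split: if_splits)
    then show ?thesis using L(2)[of z] z(2) by (auto simp: abs_mult intro!: mult_right_mono)
  qed
  with L(1) show ?thesis by blast
qed

text \<open>This is where strict positivity of \<open>\<sigma>'\<close> and the bound on \<open>u\<^sub>x\<close> combine to uniform parabolicity.\<close>

lemma strongly_monotone_on_compact_interval:
  fixes g g1 :: "real \<Rightarrow> real"
  assumes "\<And>x. (g has_real_derivative g1 x) (at x)" "continuous_on UNIV g1" "\<And>x. g1 x > 0"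
  shows "\<exists>c>0. \<forall>a b. \<bar>a\<bar> \<le> M \<longrightarrow> \<bar>b\<bar> \<le> M \<longrightarrow> c * (a - b)\<^sup>2 \<le> (g a - g b) * (a - b)"
proof -
  have "continuous_on UNIV (\<lambda>x. inverse (g1 x))"
    using assms(2,3) by (intro continuous_intros) (auto simp: less_imp_neq[symmetric])
  then obtain K where K: "K > 0" "\<And>x. \<bar>x\<bar> \<le> M \<Longrightarrow> \<bar>inverse (g1 x)\<bar> \<le> K"
    using bounded_on_compact_interval by metis
  have "inverse K * (a - b)\<^sup>2 \<le> (g a - g b) * (a - b)" if "\<bar>a\<bar> \<le> M" "\<bar>b\<bar> \<le> M" for a b
  proof -
    obtain z where z: "z \<in> {min a b..max a b}" "g a - g b = g1 z * (a - b)"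
      using mean_value_between[OF assms(1)] by metis
    have "\<bar>z\<bar> \<le> M" using z(1) that by (auto simp: min_def max_def split: if_splits)
    then have "inverse (g1 z) \<le> K" using K(2)[of z] by linarith
    then have "inverse K \<le> inverse (inverse (g1 z))"
      using assms(3)[of z] by (intro le_imp_inverse_le) auto
    then have "inverse K * (a - b)\<^sup>2 \<le> g1 z * (a - b)\<^sup>2"
      by (intro mult_right_mono) auto
    then show ?thesis by (simp add: z(2) power2_eq_square mult.assoc)
  qed
  with K(1) show ?thesis by (intro exI[of _ "inverse K"]) auto
qed

text \<open>A convex function with its first two derivatives, normalised such that \<open>\<eta>(w)\<close> is at most of the
  order of \<open>w\<^sup>2\<close> on bounded sets and therefore integrable for bounded square integrable \<open>w\<close>.\<close>

definition entropy :: "(real \<Rightarrow> real) \<Rightarrow> (real \<Rightarrow> real) \<Rightarrow> (real \<Rightarrow> real) \<Rightarrow> bool" where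
  "entropy \<eta> \<eta>1 \<eta>2 \<longleftrightarrow>
     (\<forall>x. (\<eta> has_real_derivative \<eta>1 x) (at x)) \<and> (\<forall>x. (\<eta>1 has_real_derivative \<eta>2 x) (at x)) \<and>
     continuous_on UNIV \<eta>2 \<and> (\<forall>x. 0 \<le> \<eta>2 x) \<and> \<eta> 0 = 0 \<and> \<eta>1 0 = 0"

lemma entropy_continuous:
  assumes "entropy \<eta> \<eta>1 \<eta>2"
  shows "continuous_on UNIV \<eta>" "continuous_on UNIV \<eta>1" "continuous_on UNIV \<eta>2"
  using assms by (auto simp: entropy_def intro!: continuous_at_imp_continuous_on intro: DERIV_isCont)

lemma entropy_bounds:
  assumes "entropy \<eta> \<eta>1 \<eta>2"
  shows "\<exists>K>0. (\<forall>x. \<bar>x\<bar> \<le> M \<longrightarrow> \<bar>\<eta>2 x\<bar> \<le> K) \<and> (\<forall>x. \<bar>x\<bar> \<le> M \<longrightarrow> \<bar>\<eta>1 x\<bar> \<le> K * \<bar>x\<bar>) \<and>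
     (\<forall>x. \<bar>x\<bar> \<le> M \<longrightarrow> \<bar>\<eta> x\<bar> \<le> K * x\<^sup>2) \<and>
     (\<forall>a b. \<bar>a\<bar> \<le> M \<longrightarrow> \<bar>b\<bar> \<le> M \<longrightarrow> \<bar>\<eta> a - \<eta> b - \<eta>1 b * (a - b)\<bar> \<le> K * (a - b)\<^sup>2)"
proof -
  have d: "\<And>x. (\<eta> has_real_derivative \<eta>1 x) (at x)" "\<And>x. (\<eta>1 has_real_derivative \<eta>2 x) (at x)"
    and z: "\<eta> 0 = 0" "\<eta>1 0 = 0" using assms by (auto simp: entropy_def)
  obtain K where K: "K > 0" "\<And>x. \<bar>x\<bar> \<le> M \<Longrightarrow> \<bar>\<eta>2 x\<bar> \<le> K"
    using bounded_on_compact_interval[OF entropy_continuous(3)[OF assms]] by metis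
  have lip: "\<bar>\<eta>1 a - \<eta>1 b\<bar> \<le> K * \<bar>a - b\<bar>" if "\<bar>a\<bar> \<le> M" "\<bar>b\<bar> \<le> M" for a b
  proof -
    obtain z where z: "z \<in> {min a b..max a b}" "\<eta>1 a - \<eta>1 b = \<eta>2 z * (a - b)"
      using mean_value_between[OF d(2)] by metis
    have "\<bar>z\<bar> \<le> M" using z(1) that by (auto simp: min_def max_def split: if_splits)
    then show ?thesis using K(2)[of z] z(2) by (auto simp: abs_mult intro!: mult_right_mono)
  qed
  have taylor: "\<bar>\<eta> a - \<eta> b - \<eta>1 b * (a - b)\<bar> \<le> K * (a - b)\<^sup>2" if ab: "\<bar>a\<bar> \<le> M" "\<bar>b\<bar> \<le> M" for a b
  proof -
    obtain z where z: "z \<in> {min a b..max a b}" "\<eta> a - \<eta> b = \<eta>1 z * (a - b)"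
      using mean_value_between[OF d(1)] by metis
    have "\<bar>z\<bar> \<le> M" using z(1) that by (auto simp: min_def max_def split: if_splits)
    then have "\<bar>\<eta>1 z - \<eta>1 b\<bar> \<le> K * \<bar>z - b\<bar>" using lip ab by blast
    also have "\<dots> \<le> K * \<bar>a - b\<bar>"
      using z(1) K(1) by (intro mult_left_mono) (auto simp: min_def max_def split: if_splits)
    finally have "\<bar>\<eta>1 z - \<eta>1 b\<bar> * \<bar>a - b\<bar> \<le> (K * \<bar>a - b\<bar>) * \<bar>a - b\<bar>" by (rule mult_right_mono) simp
    then show ?thesis
      by (simp add: z(2) left_diff_distrib[symmetric] abs_mult power2_eq_square mult.assoc)
  qed
  have "\<bar>\<eta>1 x\<bar> \<le> K * \<bar>x\<bar>" "\<bar>\<eta> x\<bar> \<le> K * x\<^sup>2" if "\<bar>x\<bar> \<le> M" for x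
    using lip[of x 0] taylor[of x 0] that z by auto
  with K lip taylor show ?thesis by blast
qed

lemma has_time_deriv_diff:
  assumes u: "has_time_deriv u ut" and v: "has_time_deriv v vt"
  shows "has_time_deriv (\<lambda>t x. u t x - v t x) (\<lambda>t x. ut t x - vt t x)"
  unfolding has_time_deriv_def
proof (intro allI impI conjI)
  fix t :: real assume t: "t \<ge> 0"
  have uL: "\<And>s. s \<ge> 0 \<Longrightarrow> (\<lambda>x. u s x - u t x) \<in> Lq 2" "ut t \<in> Lq 2"
    and vL: "\<And>s. s \<ge> 0 \<Longrightarrow> (\<lambda>x. v s x - v t x) \<in> Lq 2" "vt t \<in> Lq 2"
    using u v t by (auto simp: has_time_deriv_def)
  show "(\<lambda>x. u s x - v s x - (u t x - v t x)) \<in> Lq 2" if "s \<ge> 0" for s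
    using Lq2_diff[OF uL(1)[OF that] vL(1)[OF that]] by (simp add: algebra_simps)
  show "(\<lambda>x. ut t x - vt t x) \<in> Lq 2" by (rule Lq2_diff[OF uL(2) vL(2)])
  define a where "a s x = (u s x - u t x) / (s - t) - ut t x" for s x
  define b where "b s x = (v s x - v t x) / (s - t) - vt t x" for s x
  have aL: "a s \<in> Lq 2" "b s \<in> Lq 2" if "s \<ge> 0" for s
    using Lq2_diff[OF Lq2_cmult[OF uL(1)[OF that], of "1 / (s - t)"] uL(2)]
      Lq2_diff[OF Lq2_cmult[OF vL(1)[OF that], of "1 / (s - t)"] vL(2)]
    by (simp_all add: a_def[abs_def] b_def[abs_def])
  have lim: "((\<lambda>s. Lq_norm 2 (a s)) \<longlongrightarrow> 0) (at t within {0..})" "((\<lambda>s. Lq_norm 2 (b s)) \<longlongrightarrow> 0) (at t within {0..})"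
    using u v t by (simp_all add: has_time_deriv_def a_def[abs_def] b_def[abs_def])
  have "((\<lambda>s. sqrt (2 * (Lq_norm 2 (a s))\<^sup>2 + 2 * (Lq_norm 2 (b s))\<^sup>2)) \<longlongrightarrow> sqrt (2 * 0\<^sup>2 + 2 * 0\<^sup>2)) (at t within {0..})"
    by (intro tendsto_intros lim)
  then have "((\<lambda>s. sqrt (2 * (Lq_norm 2 (a s))\<^sup>2 + 2 * (Lq_norm 2 (b s))\<^sup>2)) \<longlongrightarrow> 0) (at t within {0..})" by simp
  then have "((\<lambda>s. Lq_norm 2 (\<lambda>x. a s x - b s x)) \<longlongrightarrow> 0) (at t within {0..})"
  proof (rule Lim_null_comparison[rotated])
    show "\<forall>\<^sub>F s in at t within {0..}. norm (Lq_norm 2 (\<lambda>x. a s x - b s x))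
        \<le> sqrt (2 * (Lq_norm 2 (a s))\<^sup>2 + 2 * (Lq_norm 2 (b s))\<^sup>2)"
      unfolding eventually_at_filter
      using Lq2_square_diff_le[OF aL] by (intro always_eventually) (auto simp: Lq_norm2)
  qed
  moreover have "a s x - b s x = (u s x - v s x - (u t x - v t x)) / (s - t) - (ut t x - vt t x)" for s x
    by (simp add: a_def b_def diff_divide_distrib)
  ultimately show "((\<lambda>s. Lq_norm 2 (\<lambda>x. (u s x - v s x - (u t x - v t x)) / (s - t) - (ut t x - vt t x))) \<longlongrightarrow> 0)
      (at t within {0..})" by simp
qed

lemma energy_integrable:
  assumes "entropy \<eta> \<eta>1 \<eta>2" "w \<in> Lq 2" "AE x in lebesgue. \<bar>w x\<bar> \<le> M"
  shows "integrable lebesgue (\<lambda>x. \<eta> (w x))" "(\<lambda>x. \<eta>1 (w x)) \<in> Lq 2"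
proof -
  obtain K where K: "\<forall>x. \<bar>x\<bar> \<le> M \<longrightarrow> \<bar>\<eta>1 x\<bar> \<le> K * \<bar>x\<bar>" "\<forall>x. \<bar>x\<bar> \<le> M \<longrightarrow> \<bar>\<eta> x\<bar> \<le> K * x\<^sup>2"
    using entropy_bounds[OF assms(1), of M] by metis
  have m: "(\<lambda>x. h (w x)) \<in> borel_measurable lebesgue" if "continuous_on UNIV h" for h :: "real \<Rightarrow> real"
    using measurable_compose[OF Lq2_borel[OF assms(2)] borel_measurable_continuous_onI[OF that]] .
  show "integrable lebesgue (\<lambda>x. \<eta> (w x))"
  proof (rule Bochner_Integration.integrable_bound)
    show "integrable lebesgue (\<lambda>x. K * (w x)\<^sup>2)" using Lq2_square[OF assms(2)] by simp
    show "AE x in lebesgue. norm (\<eta> (w x)) \<le> norm (K * (w x)\<^sup>2)"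
      using assms(3) by eventually_elim (use K(2) in fastforce)
  qed (rule m[OF entropy_continuous(1)[OF assms(1)]])
  show "(\<lambda>x. \<eta>1 (w x)) \<in> Lq 2"
    by (rule Lq2_bound[OF assms(2) m[OF entropy_continuous(2)[OF assms(1)]], where K = K])
       (use assms(3) K(1) in \<open>auto elim!: eventually_mono\<close>)
qed

text \<open>By Taylor's formula the increment of \<open>\<integral>\<eta>(w)\<close> differs from \<open>\<integral>\<eta>1(w t) (w s - w t)\<close> by at most
  \<open>K \<integral>(w s - w t)\<^sup>2\<close>, which is of second order in \<open>s - t\<close> since the difference quotients are bounded
  in \<open>L\<^sup>2\<close>.  The linear term converges by the Cauchy-Schwarz inequality.\<close>

lemma energy_has_derivative:
  assumes \<eta>: "entropy \<eta> \<eta>1 \<eta>2" and td: "has_time_deriv w w'" and t: "t \<ge> 0" and wt: "w t \<in> Lq 2"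
    and bd: "\<And>s. s \<ge> 0 \<Longrightarrow> AE x in lebesgue. \<bar>w s x\<bar> \<le> M"
  shows "((\<lambda>s. LINT x|lebesgue. \<eta> (w s x)) has_real_derivative (LINT x|lebesgue. \<eta>1 (w t x) * w' t x))
     (at t within {0..})"
proof -
  obtain K where K: "K > 0" "\<And>a b. \<bar>a\<bar> \<le> M \<Longrightarrow> \<bar>b\<bar> \<le> M \<Longrightarrow> \<bar>\<eta> a - \<eta> b - \<eta>1 b * (a - b)\<bar> \<le> K * (a - b)\<^sup>2"
    using entropy_bounds[OF \<eta>, of M] by metis
  have inc: "\<And>s. s \<ge> 0 \<Longrightarrow> (\<lambda>x. w s x - w t x) \<in> Lq 2" and w'L: "w' t \<in> Lq 2"
    and lim: "((\<lambda>s. Lq_norm 2 (\<lambda>x. (w s x - w t x) / (s - t) - w' t x)) \<longlongrightarrow> 0) (at t within {0..})"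
    using td t by (auto simp: has_time_deriv_def)
  have ws: "w s \<in> Lq 2" if "s \<ge> 0" for s using Lq2_add[OF inc[OF that] wt] by simp
  define E where "E s = (LINT x|lebesgue. \<eta> (w s x))" for s
  define D where "D = (LINT x|lebesgue. \<eta>1 (w t x) * w' t x)"
  define r where "r s x = (w s x - w t x) / (s - t) - w' t x" for s x
  define N where "N s = Lq_norm 2 (r s)" for s
  define P where "P = (LINT x|lebesgue. (w' t x)\<^sup>2)"
  define Q where "Q = (LINT x|lebesgue. (\<eta>1 (w t x))\<^sup>2)"
  have \<eta>1L: "(\<lambda>x. \<eta>1 (w t x)) \<in> Lq 2" by (rule energy_integrable(2)[OF \<eta> wt bd[OF t]])
  have rL: "r s \<in> Lq 2" if "s \<ge> 0" for s
    using Lq2_diff[OF Lq2_cmult[OF inc[OF that], of "1 / (s - t)"] w'L] by (simp add: r_def[abs_def])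
  have N2: "(LINT x|lebesgue. (r s x)\<^sup>2) = (N s)\<^sup>2" for s by (simp add: N_def Lq_norm2)
  have main: "\<bar>(E s - E t) / (s - t) - D\<bar> \<le> K * \<bar>s - t\<bar> * (2 * (N s)\<^sup>2 + 2 * P) + sqrt Q * N s"
    if s: "s \<ge> 0" "s \<noteq> t" for s
  proof -
    have i1: "integrable lebesgue (\<lambda>x. \<eta> (w s x))" "integrable lebesgue (\<lambda>x. \<eta> (w t x))"
      using energy_integrable(1)[OF \<eta>] ws wt bd s t by blast+
    have i2: "integrable lebesgue (\<lambda>x. \<eta>1 (w t x) * (w s x - w t x))"
      "integrable lebesgue (\<lambda>x. \<eta>1 (w t x) * w' t x)" "integrable lebesgue (\<lambda>x. \<eta>1 (w t x) * r s x)"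
      using Lq2_mult_integrable[OF \<eta>1L] inc s w'L rL by auto
    have "\<bar>E s - E t - (LINT x|lebesgue. \<eta>1 (w t x) * (w s x - w t x))\<bar>
        = \<bar>LINT x|lebesgue. \<eta> (w s x) - \<eta> (w t x) - \<eta>1 (w t x) * (w s x - w t x)\<bar>"
      using i1 i2 by (simp add: E_def)
    also have "\<dots> \<le> (LINT x|lebesgue. \<bar>\<eta> (w s x) - \<eta> (w t x) - \<eta>1 (w t x) * (w s x - w t x)\<bar>)"
      by (rule integral_abs_bound)
    also have "\<dots> \<le> (LINT x|lebesgue. K * (w s x - w t x)\<^sup>2)"
    proof (rule integral_mono_AE)
      show "AE x in lebesgue. \<bar>\<eta> (w s x) - \<eta> (w t x) - \<eta>1 (w t x) * (w s x - w t x)\<bar> \<le> K * (w s x - w t x)\<^sup>2"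
        using bd[OF s(1)] bd[OF t] by eventually_elim (rule K(2))
    qed (use i1 i2 Lq2_square[OF inc[OF s(1)]] in auto)
    also have "\<dots> = K * (s - t)\<^sup>2 * (LINT x|lebesgue. (r s x + w' t x)\<^sup>2)"
    proof -
      have "(w s x - w t x)\<^sup>2 = (s - t)\<^sup>2 * (r s x + w' t x)\<^sup>2" for x
        using s(2) by (simp add: r_def power_divide)
      then show ?thesis by (simp add: mult.assoc)
    qed
    also have "\<dots> \<le> K * (s - t)\<^sup>2 * (2 * (N s)\<^sup>2 + 2 * P)"
      using Lq2_square_add_le[OF rL[OF s(1)] w'L] K(1) by (intro mult_left_mono) (auto simp: N2 P_def)
    finally have A: "\<bar>E s - E t - (LINT x|lebesgue. \<eta>1 (w t x) * (w s x - w t x))\<bar>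
       \<le> K * (s - t)\<^sup>2 * (2 * (N s)\<^sup>2 + 2 * P)" .
    have B: "(LINT x|lebesgue. \<eta>1 (w t x) * (w s x - w t x)) = (s - t) * (D + (LINT x|lebesgue. \<eta>1 (w t x) * r s x))"
    proof -
      have "(LINT x|lebesgue. \<eta>1 (w t x) * (w s x - w t x))
        = (LINT x|lebesgue. (s - t) * (\<eta>1 (w t x) * w' t x + \<eta>1 (w t x) * r s x))"
        using s(2) by (intro Bochner_Integration.integral_cong) (auto simp: r_def field_simps)
      also have "\<dots> = (s - t) * (D + (LINT x|lebesgue. \<eta>1 (w t x) * r s x))"
        using i2 by (simp add: D_def)
      finally show ?thesis .
    qed
    have C: "\<bar>LINT x|lebesgue. \<eta>1 (w t x) * r s x\<bar> \<le> sqrt Q * N s"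
    proof -
      have "(LINT x|lebesgue. \<eta>1 (w t x) * r s x)\<^sup>2 \<le> Q * (N s)\<^sup>2"
        using Lq2_Cauchy_Schwarz[OF \<eta>1L rL[OF s(1)]] by (simp add: Q_def N2)
      then have "\<bar>LINT x|lebesgue. \<eta>1 (w t x) * r s x\<bar> \<le> sqrt (Q * (N s)\<^sup>2)"
        by (metis real_sqrt_abs real_sqrt_le_mono)
      then show ?thesis by (simp add: real_sqrt_mult N_def Lq_norm2)
    qed
    let ?R = "LINT x|lebesgue. \<eta>1 (w t x) * r s x"
    have "(E s - E t) / (s - t) - D = (E s - E t - (s - t) * (D + ?R)) / (s - t) + ?R"
      using s(2) by (simp add: field_simps)
    also have "\<bar>\<dots>\<bar> \<le> \<bar>E s - E t - (s - t) * (D + ?R)\<bar> / \<bar>s - t\<bar> + \<bar>?R\<bar>"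
      by (rule order_trans[OF abs_triangle_ineq]) (simp add: abs_divide)
    also have "\<dots> \<le> K * (s - t)\<^sup>2 * (2 * (N s)\<^sup>2 + 2 * P) / \<bar>s - t\<bar> + sqrt Q * N s"
      using A C unfolding B by (intro add_mono divide_right_mono) auto
    also have "\<dots> = K * \<bar>s - t\<bar> * (2 * (N s)\<^sup>2 + 2 * P) + sqrt Q * N s"
    proof -
      have "(s - t)\<^sup>2 / \<bar>s - t\<bar> = \<bar>s - t\<bar>"
        using s(2) by (cases "s < t") (auto simp: power2_eq_square field_simps abs_if)
      moreover have "K * (s - t)\<^sup>2 * a / \<bar>s - t\<bar> = K * ((s - t)\<^sup>2 / \<bar>s - t\<bar>) * a" for a
        by simp
      ultimately show ?thesis by presburger
    qed
    finally show ?thesis .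
  qed
  have "((\<lambda>s. K * \<bar>s - t\<bar> * (2 * (N s)\<^sup>2 + 2 * P) + sqrt Q * N s) \<longlongrightarrow>
      K * \<bar>t - t\<bar> * (2 * 0\<^sup>2 + 2 * P) + sqrt Q * 0) (at t within {0..})"
    using lim unfolding N_def r_def[abs_def] by (intro tendsto_intros)
  then have "((\<lambda>s. K * \<bar>s - t\<bar> * (2 * (N s)\<^sup>2 + 2 * P) + sqrt Q * N s) \<longlongrightarrow> 0) (at t within {0..})" by simp
  then have "((\<lambda>s. (E s - E t) / (s - t) - D) \<longlongrightarrow> 0) (at t within {0..})"
    by (rule Lim_null_comparison[rotated])
       (use main in \<open>auto simp: eventually_at_filter intro!: always_eventually\<close>)
  then have "((\<lambda>s. (E s - E t) / (s - t)) \<longlongrightarrow> D) (at t within {0..})"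
    by (simp add: LIM_zero_iff)
  then show ?thesis by (simp add: has_field_derivative_iff E_def D_def)
qed

section \<open>Uniqueness of solutions\<close>

lemma is_primitive_C1:
  assumes "\<And>x. (F has_real_derivative F' x) (at x)" "continuous_on UNIV F'"
  shows "is_primitive F F'"
  using bounded_on_compact_interval[OF assms(2)] assms(1)
  by (intro is_primitive_deriv[of "{}"] continuous_at_imp_continuous_on) (blast intro: DERIV_isCont)+

lemma Lq2_lipschitz_comp:
  fixes f :: "real \<Rightarrow> real"
  assumes "(\<lambda>x. U x - V x) \<in> Lq 2" "continuous_on UNIV f" "U \<in> borel_measurable lebesgue" "V \<in> borel_measurable lebesgue"
    "\<And>x. \<bar>f (U x) - f (V x)\<bar> \<le> L * \<bar>U x - V x\<bar>"
  shows "(\<lambda>x. f (U x) - f (V x)) \<in> Lq 2"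
  by (rule Lq2_bound[OF assms(1), where K = L])
     (use assms(5) measurable_compose[OF assms(3) borel_measurable_continuous_onI[OF assms(2)]]
       measurable_compose[OF assms(4) borel_measurable_continuous_onI[OF assms(2)]] in auto)

lemma gronwall_zero:
  fixes E E' :: "real \<Rightarrow> real"
  assumes "continuous_on {0..T} E" "\<And>t. 0 < t \<Longrightarrow> t < T \<Longrightarrow> (E has_real_derivative E' t) (at t)"
    "\<And>t. 0 < t \<Longrightarrow> t < T \<Longrightarrow> E' t \<le> C * E t" "E 0 = 0" "T \<ge> 0"
  shows "E T \<le> 0"
proof -
  have "E T * exp (- C * T) \<le> E 0 * exp (- C * 0)"
  proof (rule DERIV_nonpos_imp_decreasing_open[of 0 T])
    fix t :: real assume t: "0 < t" "t < T"
    have "((\<lambda>t. E t * exp (- C * t)) has_real_derivative (E' t - C * E t) * exp (- C * t)) (at t)"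
      using assms(2)[OF t] by (auto intro!: derivative_eq_intros simp: algebra_simps)
    moreover have "(E' t - C * E t) * exp (- C * t) \<le> 0"
      using assms(3)[OF t] by (intro mult_nonpos_nonneg) auto
    ultimately show "\<exists>y. ((\<lambda>t. E t * exp (- C * t)) has_real_derivative y) (at t) \<and> y \<le> 0" by blast
  qed (use assms in \<open>auto intro!: continuous_intros\<close>)
  then show ?thesis using assms(4) by (simp add: mult_le_0_iff)
qed

lemma at_within_nonneg: "0 < (t::real) \<Longrightarrow> at t within {0..} = at t"
  by (rule at_within_interior) (simp add: interior_Ici[of "-1"])

lemma entropy_square: "entropy (\<lambda>x. x\<^sup>2) (\<lambda>x. 2 * x) (\<lambda>_. 2)"
  by (auto simp: entropy_def intro!: derivative_eq_intros)

text \<open>For the difference \<open>w\<close> of two solutions, the viscous part of the derivative of \<open>\<integral>w\<^sup>2\<close> is at most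
  \<open>-2c \<integral>w\<^sub>x\<^sup>2\<close>, which absorbs the convective part up to a multiple of \<open>\<integral>w\<^sup>2\<close>.\<close>

lemma regular_solution_unique:
  fixes f f1 \<sigma> \<sigma>1 :: "real \<Rightarrow> real"
  assumes f: "\<And>x. (f has_real_derivative f1 x) (at x)" "continuous_on UNIV f1"
    and \<sigma>: "\<And>x. (\<sigma> has_real_derivative \<sigma>1 x) (at x)" "continuous_on UNIV \<sigma>1" "\<And>x. \<sigma>1 x > 0"
    and u: "regular_solution f \<sigma> um up M u ut U U1" and v: "regular_solution f \<sigma> um up N v vt V V1"
    and init: "AE x in lebesgue. u 0 x = v 0 x" and T: "T \<ge> 0"
  shows "AE x in lebesgue. u T x = v T x"
proof -
  define B where "B = max M N"
  obtain L where L: "L > 0" "\<And>a b. \<bar>a\<bar> \<le> B \<Longrightarrow> \<bar>b\<bar> \<le> B \<Longrightarrow> \<bar>f a - f b\<bar> \<le> L * \<bar>a - b\<bar>"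
    using lipschitz_on_compact_interval[OF f] by metis
  obtain L' where L': "L' > 0" "\<And>a b. \<bar>a\<bar> \<le> B \<Longrightarrow> \<bar>b\<bar> \<le> B \<Longrightarrow> \<bar>\<sigma> a - \<sigma> b\<bar> \<le> L' * \<bar>a - b\<bar>"
    using lipschitz_on_compact_interval[OF \<sigma>(1,2)] by metis
  obtain c where c: "c > 0" "\<And>a b. \<bar>a\<bar> \<le> B \<Longrightarrow> \<bar>b\<bar> \<le> B \<Longrightarrow> c * (a - b)\<^sup>2 \<le> (\<sigma> a - \<sigma> b) * (a - b)"
    using strongly_monotone_on_compact_interval[OF \<sigma>] by metis
  have cf: "continuous_on UNIV f" "continuous_on UNIV \<sigma>"
    using f(1) \<sigma>(1) by (auto intro!: continuous_at_imp_continuous_on intro: DERIV_isCont)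
  define w where "w t x = u t x - v t x" for t x
  define w' where "w' t x = ut t x - vt t x" for t x
  have td: "has_time_deriv w w'"
    using has_time_deriv_diff[of u ut v vt] u v by (simp add: regular_solution_def w_def[abs_def] w'_def[abs_def])
  have U: "AE x in lebesgue. u t x = U t x" "\<And>x. (U t has_real_derivative U1 t x) (at x)" "continuous_on UNIV (U1 t)"
    "\<And>x. \<bar>U t x\<bar> \<le> B" "\<And>x. \<bar>U1 t x\<bar> \<le> B" "U1 t \<in> Lq 2" "(\<lambda>x. U t x - riemann_data um up x) \<in> Lq 2"
    and V: "AE x in lebesgue. v t x = V t x" "\<And>x. (V t has_real_derivative V1 t x) (at x)" "continuous_on UNIV (V1 t)"
    "\<And>x. \<bar>V t x\<bar> \<le> B" "\<And>x. \<bar>V1 t x\<bar> \<le> B" "V1 t \<in> Lq 2" "(\<lambda>x. V t x - riemann_data um up x) \<in> Lq 2" if "t \<ge> 0" for t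
    using u v that by (auto simp: regular_solution_def B_def max.coboundedI1 max.coboundedI2)
  have flux: "is_primitive (\<lambda>x. f (U t x) - \<sigma> (U1 t x)) (\<lambda>x. - ut t x)"
     "is_primitive (\<lambda>x. f (V t x) - \<sigma> (V1 t x)) (\<lambda>x. - vt t x)" if "t > 0" for t
    using u v that by (auto simp: regular_solution_def)
  define W where "W t x = U t x - V t x" for t x
  have cU: "continuous_on UNIV (U t)" and cV: "continuous_on UNIV (V t)" if "t \<ge> 0" for t
    using U(2)[OF that] V(2)[OF that] by (auto intro!: continuous_at_imp_continuous_on intro: DERIV_isCont)
  have wW: "AE x in lebesgue. w t x = W t x" if "t \<ge> 0" for t
    using U(1)[OF that] V(1)[OF that] by eventually_elim (simp add: w_def W_def)
  have WL: "W t \<in> Lq 2" if "t \<ge> 0" for t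
    using Lq2_diff[OF U(7)[OF that] V(7)[OF that]] by (simp add: W_def[abs_def])
  have Ww: "AE x in lebesgue. W t x = w t x" if "t \<ge> 0" for t
    using wW[OF that] by eventually_elim simp
  have w'L: "w' t \<in> Lq 2" "w t \<in> borel_measurable lebesgue" if "t \<ge> 0" for t
    using td that borel_measurable_AE[OF Lq2_borel[OF WL[OF that]] Ww[OF that]]
    by (auto simp: has_time_deriv_def)
  have wL: "w t \<in> Lq 2" if "t \<ge> 0" for t
    by (rule Lq2_cong_AE[OF WL[OF that] w'L(2)[OF that] Ww[OF that]])
  have wb: "AE x in lebesgue. \<bar>w s x\<bar> \<le> 2 * B" if "s \<ge> 0" for s
    using wW[OF that]
  proof eventually_elim
    case (elim x)
    then show ?case using U(4)[OF that, of x] V(4)[OF that, of x] by (simp add: W_def)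
  qed
  define E where "E t = (LINT x|lebesgue. (w t x)\<^sup>2)" for t
  define D where "D t = (LINT x|lebesgue. 2 * w t x * w' t x)" for t
  have dE: "(E has_real_derivative D t) (at t within {0..})" if "t \<ge> 0" for t
    using energy_has_derivative[OF entropy_square td that wL[OF that] wb]
    by (simp add: E_def[abs_def] D_def)
  have EW: "E t = (LINT x|lebesgue. (W t x)\<^sup>2)" if "t \<ge> 0" for t
    unfolding E_def using wW[OF that] wL[OF that] WL[OF that]
    by (intro integral_cong_AE) (auto elim!: eventually_mono dest!: Lq2_square)
  have D_le: "D t \<le> (L\<^sup>2 / (2 * c)) * E t" if t: "t > 0" for t
  proof -
    note t0 = less_imp_le[OF t]
    define J where "J x = f (U t x) - \<sigma> (U1 t x) - (f (V t x) - \<sigma> (V1 t x))" for x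
    define W' where "W' x = U1 t x - V1 t x" for x
    have J: "is_primitive J (\<lambda>x. - w' t x)"
      using is_primitive_diff[OF flux[OF t]] by (simp add: J_def[abs_def] w'_def)
    have UP: "is_primitive (U t) (U1 t)" "is_primitive (V t) (V1 t)"
      using U(2,3)[OF t0] V(2,3)[OF t0] by (auto intro: is_primitive_C1)
    have WP: "is_primitive (W t) W'"
      using is_primitive_diff[OF UP] by (simp add: W_def[abs_def] W'_def[abs_def])
    have W'L: "W' \<in> Lq 2" using Lq2_diff[OF U(6)[OF t0] V(6)[OF t0]] by (simp add: W'_def[abs_def])
    have "(\<lambda>x. f (U t x) - f (V t x)) \<in> Lq 2"
      using WL[OF t0] U(4)[OF t0] V(4)[OF t0]
      by (intro Lq2_lipschitz_comp[of "U t" "V t" f L, OF _ cf(1) continuous_imp_lebesgue[OF cU[OF t0]]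
            continuous_imp_lebesgue[OF cV[OF t0]] L(2)]) (auto simp: W_def[abs_def])
    moreover have "(\<lambda>x. \<sigma> (U1 t x) - \<sigma> (V1 t x)) \<in> Lq 2"
      using W'L U(5)[OF t0] V(5)[OF t0]
      by (intro Lq2_lipschitz_comp[of "U1 t" "V1 t" \<sigma> L', OF _ cf(2) continuous_imp_lebesgue[OF U(3)[OF t0]]
            continuous_imp_lebesgue[OF V(3)[OF t0]] L'(2)]) (auto simp: W'_def[abs_def])
    ultimately have "(\<lambda>x. (f (U t x) - f (V t x)) - (\<sigma> (U1 t x) - \<sigma> (V1 t x))) \<in> Lq 2" by (rule Lq2_diff)
    then have JL: "J \<in> Lq 2" by (simp add: J_def[abs_def] algebra_simps)
    have "D t = (LINT x|lebesgue. 2 * (w' t x * W t x))"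
      unfolding D_def
    proof (rule integral_cong_AE)
      show "AE x in lebesgue. 2 * w t x * w' t x = 2 * (w' t x * W t x)"
        using wW[OF t0] by eventually_elim simp
      show "(\<lambda>x. 2 * w t x * w' t x) \<in> borel_measurable lebesgue"
        using Lq2_mult_integrable[OF Lq2_cmult[OF wL[OF t0], of 2] w'L(1)[OF t0]] by (rule borel_measurable_integrable)
      show "(\<lambda>x. 2 * (w' t x * W t x)) \<in> borel_measurable lebesgue"
        using integrable_mult_right[OF Lq2_mult_integrable[OF w'L(1)[OF t0] WL[OF t0]], of 2] by (rule borel_measurable_integrable)
    qed
    also have "\<dots> = 2 * (LINT x|lebesgue. J x * W' x)"
      using integral_by_parts_line[OF J WP JL Lq2_uminus[OF w'L(1)[OF t0]] WL[OF t0] W'L] by simp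
    also have "\<dots> \<le> 2 * (LINT x|lebesgue. (L\<^sup>2 / (4 * c)) * (W t x)\<^sup>2)"
    proof (intro mult_left_mono integral_mono)
      fix x
      have "(f (U t x) - f (V t x)) * W' x \<le> \<bar>f (U t x) - f (V t x)\<bar> * \<bar>W' x\<bar>"
        by (metis abs_ge_self abs_mult)
      also have "\<dots> \<le> (L * \<bar>W t x\<bar>) * \<bar>W' x\<bar>"
        unfolding W_def using U(4)[OF t0] V(4)[OF t0] by (intro mult_right_mono L(2)) auto
      finally have 1: "(f (U t x) - f (V t x)) * W' x \<le> L * \<bar>W t x\<bar> * \<bar>W' x\<bar>" .
      have 2: "c * (W' x)\<^sup>2 \<le> (\<sigma> (U1 t x) - \<sigma> (V1 t x)) * W' x"
        unfolding W'_def using U(5)[OF t0] V(5)[OF t0] by (intro c(2)) auto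
      \<comment> \<open>Young's inequality, weighted such that the dissipation absorbs the product.\<close>
      have "0 \<le> (L * \<bar>W t x\<bar> - 2 * c * \<bar>W' x\<bar>)\<^sup>2" by simp
      then have "L * \<bar>W t x\<bar> * \<bar>W' x\<bar> * (4 * c) \<le> L\<^sup>2 * (W t x)\<^sup>2 + 4 * c * (c * (W' x)\<^sup>2)"
        by (simp add: power2_diff power_mult_distrib) (simp add: power2_eq_square mult_ac)
      then have 3: "L * \<bar>W t x\<bar> * \<bar>W' x\<bar> \<le> (L\<^sup>2 / (4 * c)) * (W t x)\<^sup>2 + c * (W' x)\<^sup>2"
        using c(1) by (simp add: field_simps)
      have "J x * W' x = (f (U t x) - f (V t x)) * W' x - (\<sigma> (U1 t x) - \<sigma> (V1 t x)) * W' x"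
        by (simp add: J_def algebra_simps)
      then show "J x * W' x \<le> (L\<^sup>2 / (4 * c)) * (W t x)\<^sup>2" using 1 2 3 by linarith
    qed (use Lq2_mult_integrable[OF JL W'L] Lq2_square[OF WL[OF t0]] in auto)
    also have "\<dots> = (L\<^sup>2 / (2 * c)) * E t" using EW[OF t0] by simp
    finally show ?thesis .
  qed
  have "E T \<le> 0"
  proof (rule gronwall_zero[of T E D "L\<^sup>2 / (2 * c)"])
    show "continuous_on {0..T} E"
      by (rule DERIV_continuous_on[where D = D], rule has_field_derivative_subset[OF dE]) auto
    show "(E has_real_derivative D t) (at t)" if "0 < t" "t < T" for t
      using dE[of t] that by (simp add: at_within_nonneg)
    show "E 0 = 0"
      unfolding E_def using init by (intro integral_eq_zero_AE) (auto elim!: eventually_mono simp: w_def)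
  qed (use D_le T in auto)
  moreover have "E T \<ge> 0" by (simp add: E_def)
  ultimately have "E T = 0" by (rule order_antisym)
  then have "(LINT x|lebesgue. (w T x)\<^sup>2) = 0" by (simp add: E_def)
  then have "AE x in lebesgue. (w T x)\<^sup>2 = 0"
    using integral_nonneg_eq_0_iff_AE[OF Lq2_square[OF wL[OF T]]] by simp
  then show ?thesis by eventually_elim (simp add: w_def)
qed

section \<open>The approximate rarefaction wave\<close>

locale convex_flux =
  fixes f f1 f2 f3 :: "real \<Rightarrow> real" and um up :: real
  assumes f: "\<And>x. (f has_real_derivative f1 x) (at x)"
    and f1: "\<And>x. (f1 has_real_derivative f2 x) (at x)"
    and f2: "\<And>x. (f2 has_real_derivative f3 x) (at x)"
    and f3: "continuous_on UNIV f3"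
    and convex: "\<And>x. f2 x > 0"
    and um_less_up: "um < up"
begin

lemma f1_strict_mono: "a < b \<Longrightarrow> f1 a < f1 b"
  using DERIV_pos_imp_increasing[of a b f1] f1 convex by blast

lemma inj_f1: "inj f1"
  by (rule linorder_injI) (use f1_strict_mono in force)

lemma f1_mono: "a \<le> b \<Longrightarrow> f1 a \<le> f1 b"
  using f1_strict_mono[of a b] by (cases "a = b") auto

lemma cont: "continuous_on UNIV f" "continuous_on UNIV f1" "continuous_on UNIV f2"
  using f f1 f2 by (auto intro!: continuous_at_imp_continuous_on intro: DERIV_isCont)

definition clamp :: "real \<Rightarrow> real" where "clamp y = max (f1 um) (min (f1 up) y)"

text \<open>The self-similar profile: the rarefaction wave at time \<open>t > 0\<close> is \<open>x \<mapsto> fan (x / t)\<close>.\<close>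

definition fan :: "real \<Rightarrow> real" where "fan y = inv f1 (clamp y)"

text \<open>The derivative of \<open>fan\<close> off the corners; the value zero at the corners makes it vanish
  wherever the wave is constant.\<close>

definition fan' :: "real \<Rightarrow> real" where
  "fan' y = (if f1 um < y \<and> y < f1 up then inverse (f2 (fan y)) else 0)"

text \<open>The largest speed occurring in the wave, so that the wave at time \<open>t\<close> is constant on each side of
  \<open>|x| \<le> \<Lambda> t\<close>.\<close>

definition \<Lambda> :: real where "\<Lambda> = max \<bar>f1 um\<bar> \<bar>f1 up\<bar>"

lemma clamp_range: "f1 um \<le> clamp y" "clamp y \<le> f1 up"
  using f1_mono[of um up] um_less_up by (auto simp: clamp_def)

lemma clamp_lipschitz: "\<bar>clamp a - clamp b\<bar> \<le> \<bar>a - b\<bar>"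
  by (auto simp: clamp_def max_def min_def)

lemma fan_range: "um \<le> fan y" "fan y \<le> up" and f1_fan: "f1 (fan y) = clamp y"
proof -
  have "\<exists>u. um \<le> u \<and> u \<le> up \<and> f1 u = clamp y"
    using clamp_range[of y] um_less_up continuous_on_subset[OF cont(2)] by (intro IVT') auto
  then obtain u where u: "um \<le> u" "u \<le> up" "f1 u = clamp y" by blast
  then have "fan y = u" using inj_f1 by (metis fan_def inv_f_f)
  with u show "um \<le> fan y" "fan y \<le> up" "f1 (fan y) = clamp y" by auto
qed

lemma fan_left: "y \<le> f1 um \<Longrightarrow> fan y = um"
  using f1_mono[of um up] um_less_up inj_f1 by (simp add: fan_def clamp_def)

lemma fan_right: "f1 up \<le> y \<Longrightarrow> fan y = up"
  using f1_mono[of um up] um_less_up inj_f1 by (simp add: fan_def clamp_def)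

lemma \<Lambda>_nonneg: "\<Lambda> \<ge> 0" by (simp add: \<Lambda>_def)

lemma fan_outside: "\<Lambda> < \<bar>y\<bar> \<Longrightarrow> fan y = (if y < 0 then um else up)" "\<Lambda> < \<bar>y\<bar> \<Longrightarrow> fan' y = 0"
  by (auto simp: \<Lambda>_def fan'_def abs_if intro!: fan_left fan_right split: if_splits)

lemma slope_bound: "\<exists>L>0. \<forall>x. um \<le> x \<longrightarrow> x \<le> up \<longrightarrow> inverse (f2 x) \<le> L"
proof -
  have "continuous_on UNIV (\<lambda>x. inverse (f2 x))"
    using cont(3) convex by (intro continuous_intros) (auto simp: less_imp_neq[symmetric])
  then obtain K where "K > 0" "\<And>x. \<bar>x\<bar> \<le> max \<bar>um\<bar> \<bar>up\<bar> \<Longrightarrow> \<bar>inverse (f2 x)\<bar> \<le> K"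
    using bounded_on_compact_interval by metis
  moreover have "\<bar>x\<bar> \<le> max \<bar>um\<bar> \<bar>up\<bar>" if "um \<le> x" "x \<le> up" for x
    using that by auto
  ultimately show ?thesis by (intro exI[of _ K]) (blast dest: abs_le_D1)
qed

text \<open>A bound for the slope of the inverse of \<open>f'\<close> on the range of the wave, hence a Lipschitz constant
  of \<open>fan\<close>.\<close>

definition L :: real where "L = (SOME L. L > 0 \<and> (\<forall>x. um \<le> x \<longrightarrow> x \<le> up \<longrightarrow> inverse (f2 x) \<le> L))"

lemma L: "L > 0" "um \<le> x \<Longrightarrow> x \<le> up \<Longrightarrow> inverse (f2 x) \<le> L"
  using someI_ex[OF slope_bound] by (auto simp: L_def)

lemma fan'_bounds: "0 \<le> fan' y" "fan' y \<le> L"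
  using L fan_range[of y] convex[of "fan y"] by (auto simp: fan'_def less_imp_le)

text \<open>Apply the mean value theorem to \<open>f1\<close> rather than to its inverse: \<open>f1\<close> maps the values of the profile
  to the clamped arguments.\<close>

lemma fan_lipschitz: "\<bar>fan a - fan b\<bar> \<le> L * \<bar>a - b\<bar>"
proof -
  obtain z where z: "z \<in> {min (fan a) (fan b)..max (fan a) (fan b)}" "f1 (fan a) - f1 (fan b) = f2 z * (fan a - fan b)"
    using mean_value_between[OF f1] by metis
  have zr: "um \<le> z" "z \<le> up" using z(1) fan_range[of a] fan_range[of b] by auto
  have "fan a - fan b = inverse (f2 z) * (clamp a - clamp b)"
    using z(2) convex[of z] by (simp add: f1_fan)
  then have "\<bar>fan a - fan b\<bar> = inverse (f2 z) * \<bar>clamp a - clamp b\<bar>"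
    using convex[of z] by (simp add: abs_mult)
  also have "\<dots> \<le> L * \<bar>a - b\<bar>"
    using L(2)[OF zr] L(1) clamp_lipschitz[of a b] by (intro mult_mono) auto
  finally show ?thesis .
qed

lemma fan_continuous: "continuous_on UNIV fan"
proof (rule continuous_onI)
  fix x e :: real assume "e > 0"
  then show "\<exists>d>0. \<forall>x'\<in>UNIV. dist x' x < d \<longrightarrow> dist (fan x') (fan x) \<le> e"
  proof (intro exI[of _ "e / L"] conjI ballI impI)
    fix y assume "dist y x < e / L"
    then have "L * \<bar>y - x\<bar> \<le> e" using L(1) by (simp add: dist_real_def field_simps)
    then show "dist (fan y) (fan x) \<le> e" using fan_lipschitz[of y x] by (simp add: dist_real_def)
  qed (use L(1) in simp)
qed

lemma fan_has_derivative:
  assumes "y \<noteq> f1 um" "y \<noteq> f1 up" shows "(fan has_real_derivative fan' y) (at y)"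
proof -
  consider "y < f1 um" | "f1 up < y" | "f1 um < y" "y < f1 up" using assms by linarith
  then show ?thesis
  proof cases
    case 1
    have "\<forall>\<^sub>F z in nhds y. fan z = um"
      by (rule eventually_mono[OF eventually_nhds_in_open[of "{..<f1 um}" y]]) (use 1 fan_left in auto)
    then show ?thesis using 1
      by (subst DERIV_cong_ev[OF refl _ refl, where g = "\<lambda>_. um"]) (auto simp: fan'_def)
  next
    case 2
    have "\<forall>\<^sub>F z in nhds y. fan z = up"
      by (rule eventually_mono[OF eventually_nhds_in_open[of "{f1 up<..}" y]]) (use 2 fan_right in auto)
    then show ?thesis using 2
      by (subst DERIV_cong_ev[OF refl _ refl, where g = "\<lambda>_. up"]) (auto simp: fan'_def)
  next
    case 3
    have "(fan has_real_derivative inverse (f2 (fan y))) (at y)"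
    proof (rule DERIV_inverse_function[where f = f1 and a = "f1 um" and b = "f1 up"])
      show "isCont fan y" using fan_continuous by (simp add: continuous_on_eq_continuous_at)
      show "f1 (fan z) = z" if "f1 um < z" "z < f1 up" for z
        using that by (simp add: f1_fan clamp_def)
    qed (use 3 f1 convex[of "fan y"] in auto)
    then show ?thesis using 3 by (simp add: fan'_def)
  qed
qed

text \<open>The rarefaction wave at time \<open>1 + t\<close>, with its derivatives in space and time.  The shift in time makes it
  Lipschitz up to \<open>t = 0\<close>.\<close>

definition \<phi> :: "real \<Rightarrow> real \<Rightarrow> real" where "\<phi> t x = fan (x / (1 + t))"
definition \<phi>x :: "real \<Rightarrow> real \<Rightarrow> real" where "\<phi>x t x = fan' (x / (1 + t)) / (1 + t)"
definition \<phi>t :: "real \<Rightarrow> real \<Rightarrow> real" where "\<phi>t t x = - (x / (1 + t)\<^sup>2 * fan' (x / (1 + t)))"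
definition corners :: "real \<Rightarrow> real set" where "corners t = {f1 um * (1 + t), f1 up * (1 + t)}"

lemma corners: "t \<ge> 0 \<Longrightarrow> x \<notin> corners t \<Longrightarrow> x / (1 + t) \<noteq> f1 um \<and> x / (1 + t) \<noteq> f1 up" "finite (corners t)"
  by (auto simp: corners_def field_simps)

lemma \<phi>_continuous: "t \<ge> 0 \<Longrightarrow> continuous_on UNIV (\<phi> t)"
  unfolding \<phi>_def by (intro continuous_on_compose2[OF fan_continuous] continuous_intros) auto

lemma \<phi>_range: "um \<le> \<phi> t x" "\<phi> t x \<le> up" "\<bar>\<phi> t x\<bar> \<le> \<bar>um\<bar> + \<bar>up\<bar>"
  using fan_range[of "x / (1 + t)"] by (auto simp: \<phi>_def)

lemma \<phi>x_bounds: "t \<ge> 0 \<Longrightarrow> 0 \<le> \<phi>x t x" "t \<ge> 0 \<Longrightarrow> \<phi>x t x \<le> L / (1 + t)"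
  using fan'_bounds[of "x / (1 + t)"] by (auto simp: \<phi>x_def intro!: divide_right_mono)

lemma abs_div_gt: "t \<ge> 0 \<Longrightarrow> \<bar>x\<bar> > \<Lambda> * (1 + t) \<Longrightarrow> \<bar>x / (1 + t)\<bar> > \<Lambda>"
  by (simp add: field_simps abs_divide)

lemma \<phi>_outside: "t \<ge> 0 \<Longrightarrow> \<bar>x\<bar> > \<Lambda> * (1 + t) \<Longrightarrow> \<phi> t x = riemann_data um up x"
  using fan_outside(1)[OF abs_div_gt, of t x] by (auto simp: \<phi>_def riemann_data_def divide_less_0_iff)

lemma \<phi>'_outside: "t \<ge> 0 \<Longrightarrow> \<bar>x\<bar> > \<Lambda> * (1 + t) \<Longrightarrow> \<phi>x t x = 0 \<and> \<phi>t t x = 0"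
  using fan_outside(2)[OF abs_div_gt, of t x] by (auto simp: \<phi>x_def \<phi>t_def)

lemma \<phi>_has_x_derivative:
  assumes "t \<ge> 0" "x \<notin> corners t" shows "(\<phi> t has_real_derivative \<phi>x t x) (at x)"
  unfolding \<phi>_def[abs_def] \<phi>x_def
  by (rule DERIV_cong[OF DERIV_chain2[OF fan_has_derivative, where g = "\<lambda>x. x / (1 + t)"]])
     (use assms corners in \<open>auto intro!: derivative_eq_intros\<close>)

lemma \<phi>_has_t_derivative:
  assumes "t \<ge> 0" "x \<notin> corners t" shows "((\<lambda>s. \<phi> s x) has_real_derivative \<phi>t t x) (at t)"
  unfolding \<phi>_def[abs_def] \<phi>t_def
  by (rule DERIV_cong[OF DERIV_chain2[OF fan_has_derivative, where g = "\<lambda>s. x / (1 + s)"]])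
     (use assms corners in \<open>auto intro!: derivative_eq_intros simp: power2_eq_square\<close>)

lemma \<phi>_primitive: "t \<ge> 0 \<Longrightarrow> is_primitive (\<phi> t) (\<phi>x t)"
  by (rule is_primitive_deriv[OF corners(2) \<phi>_continuous])
     (use \<phi>_has_x_derivative \<phi>x_bounds in \<open>auto intro!: exI[of _ "L / (1 + t)"]\<close>)

text \<open>Inside the fan the characteristic speed \<open>f1 (\<phi> t x)\<close> is \<open>x / (1 + t)\<close>.\<close>

lemma \<phi>_conservation_law: "t \<ge> 0 \<Longrightarrow> f1 (\<phi> t x) * \<phi>x t x = - \<phi>t t x"
  by (auto simp: \<phi>_def \<phi>x_def \<phi>t_def f1_fan fan'_def clamp_def power2_eq_square)

lemma f_\<phi>_primitive:
  assumes t: "t \<ge> 0" shows "is_primitive (\<lambda>x. f (\<phi> t x)) (\<lambda>x. - \<phi>t t x)"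
proof (rule is_primitive_deriv[OF corners(2)])
  show "continuous_on UNIV (\<lambda>x. f (\<phi> t x))"
    by (rule continuous_on_compose2[OF cont(1) \<phi>_continuous[OF t]]) auto
  show "((\<lambda>x. f (\<phi> t x)) has_real_derivative - \<phi>t t x) (at x)" if "x \<notin> corners t" for x
    using DERIV_chain2[OF f \<phi>_has_x_derivative[OF t that]] by (simp add: \<phi>_conservation_law[OF t])
  obtain K where K: "K > 0" "\<And>x. \<bar>x\<bar> \<le> \<bar>um\<bar> + \<bar>up\<bar> \<Longrightarrow> \<bar>f1 x\<bar> \<le> K"
    using bounded_on_compact_interval[OF cont(2)] by metis
  have "\<bar>- \<phi>t t x\<bar> \<le> K * (L / (1 + t))" for x
    unfolding \<phi>_conservation_law[OF t, symmetric] abs_mult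
    using K \<phi>_range(3) \<phi>x_bounds[OF t] by (intro mult_mono) auto
  then show "\<exists>B. \<forall>x. \<bar>x\<bar> \<le> R \<longrightarrow> \<bar>- \<phi>t t x\<bar> \<le> B" for R by blast
qed

lemma \<phi>_riemann: "t \<ge> 0 \<Longrightarrow> (\<lambda>x. \<phi> t x - riemann_data um up x) \<in> Lq 2"
proof (rule bounded_support_Lq[where K = "2 * (\<bar>um\<bar> + \<bar>up\<bar>)" and R = "\<Lambda> * (1 + t)"])
  assume t: "t \<ge> 0"
  show "(\<lambda>x. \<phi> t x - riemann_data um up x) \<in> borel_measurable lebesgue"
    using continuous_imp_lebesgue[OF \<phi>_continuous[OF t]] borel_imp_lebesgue[OF riemann_data_borel]
    by (intro borel_measurable_diff)
  show "\<bar>\<phi> t x - riemann_data um up x\<bar> \<le> 2 * (\<bar>um\<bar> + \<bar>up\<bar>)" for x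
    using \<phi>_range(3)[of t x] by (auto simp: riemann_data_def)
qed (use \<phi>_outside \<Lambda>_nonneg in auto)

lemma \<phi>x_Lq2:
  assumes t: "t \<ge> 0"
  shows "\<phi>x t \<in> Lq 2" "(LINT x|lebesgue. (\<phi>x t x)\<^sup>2) \<le> 2 * L\<^sup>2 * \<Lambda>"
proof -
  have m: "\<phi>x t \<in> borel_measurable lebesgue"
    using \<phi>_primitive[OF t] is_primitive_locally_integrable locally_integrable_borel by blast
  show "\<phi>x t \<in> Lq 2"
    by (rule bounded_support_Lq[where K = "L / (1 + t)" and R = "\<Lambda> * (1 + t)"])
       (use t m \<phi>x_bounds[OF t] \<phi>'_outside[OF t] \<Lambda>_nonneg in auto)
  have "(LINT x|lebesgue. \<bar>\<phi>x t x\<bar> powr 2) \<le> (L / (1 + t)) powr 2 * (2 * (\<Lambda> * (1 + t)))"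
    by (rule bounded_support_powr(2))
       (use t m \<phi>x_bounds[OF t] \<phi>'_outside[OF t] \<Lambda>_nonneg in auto)
  also have "\<dots> = 2 * L\<^sup>2 * \<Lambda> / (1 + t)"
  proof -
    have "(L / \<tau>)\<^sup>2 * (2 * (\<Lambda> * \<tau>)) = 2 * L\<^sup>2 * \<Lambda> / \<tau>" if "\<tau> > 0" for \<tau>
      using that by (simp add: power2_eq_square field_simps)
    from this[of "1 + t"] show ?thesis using t L(1) by simp
  qed
  also have "\<dots> \<le> 2 * L\<^sup>2 * \<Lambda>"
    using t \<Lambda>_nonneg by (simp add: field_simps mult_left_le)
  finally show "(LINT x|lebesgue. (\<phi>x t x)\<^sup>2) \<le> 2 * L\<^sup>2 * \<Lambda>" by simp
qed

lemma \<phi>_time_lipschitz: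
  assumes "s \<ge> 0" "t \<ge> 0" shows "\<bar>\<phi> s x - \<phi> t x\<bar> \<le> L * \<bar>x\<bar> * \<bar>s - t\<bar>"
proof -
  have "x / (1 + s) - x / (1 + t) = x * (t - s) / ((1 + s) * (1 + t))"
    using assms by (simp add: field_simps)
  then have "\<bar>x / (1 + s) - x / (1 + t)\<bar> = \<bar>x\<bar> * \<bar>s - t\<bar> / ((1 + s) * (1 + t))"
    using assms by (simp add: abs_mult abs_divide abs_minus_commute)
  also have "\<dots> \<le> \<bar>x\<bar> * \<bar>s - t\<bar> / 1"
  proof (rule divide_left_mono)
    show "1 \<le> (1 + s) * (1 + t)" using mult_mono[of 1 "1 + s" 1 "1 + t"] assms by simp
    then show "0 < (1 + s) * (1 + t) * 1" by linarith
  qed simp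
  finally have "\<bar>x / (1 + s) - x / (1 + t)\<bar> \<le> \<bar>x\<bar> * \<bar>s - t\<bar>" by simp
  then have "L * \<bar>x / (1 + s) - x / (1 + t)\<bar> \<le> L * (\<bar>x\<bar> * \<bar>s - t\<bar>)"
    using L(1) by (intro mult_left_mono) auto
  then show ?thesis
    using fan_lipschitz[of "x / (1 + s)" "x / (1 + t)"] by (simp add: \<phi>_def mult.assoc)
qed

lemma \<phi>t_bound: "t \<ge> 0 \<Longrightarrow> \<bar>\<phi>t t x\<bar> \<le> L * \<bar>x\<bar>"
proof -
  assume t: "t \<ge> 0"
  have "\<bar>\<phi>t t x\<bar> = \<bar>x\<bar> / (1 + t)\<^sup>2 * fan' (x / (1 + t))"
    using fan'_bounds(1) by (simp add: \<phi>t_def abs_mult)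
  also have "\<dots> \<le> \<bar>x\<bar> / 1 * L"
  proof (intro mult_mono divide_left_mono)
    show "1 \<le> (1 + t)\<^sup>2" using t by (intro one_le_power) simp
    then show "0 < (1 + t)\<^sup>2 * 1" by linarith
  qed (use fan'_bounds in auto)
  finally show ?thesis by (simp add: mult.commute)
qed

text \<open>Off the corners the difference quotients converge pointwise.  They are dominated because they are
  bounded and, for times in a bounded set, vanish outside a fixed interval.\<close>

lemma \<phi>_has_time_deriv: "has_time_deriv \<phi> \<phi>t"
  unfolding has_time_deriv_def
proof (intro allI impI conjI)
  fix t :: real assume t: "t \<ge> 0"
  have m: "\<phi>t t \<in> borel_measurable lebesgue"
    using is_primitive_locally_integrable[OF f_\<phi>_primitive[OF t]]
    by (auto dest!: locally_integrable_borel)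
  have mm: "\<phi> s \<in> borel_measurable lebesgue" if "s \<ge> 0" for s
    using continuous_imp_lebesgue[OF \<phi>_continuous[OF that]] .
  show "\<phi>t t \<in> Lq 2"
  proof (rule bounded_support_Lq[where K = "L * (\<Lambda> * (1 + t))" and R = "\<Lambda> * (1 + t)"])
    fix x
    show "\<bar>\<phi>t t x\<bar> \<le> L * (\<Lambda> * (1 + t))"
    proof (cases "\<bar>x\<bar> > \<Lambda> * (1 + t)")
      case True then show ?thesis using \<phi>'_outside[OF t True] t L(1) \<Lambda>_nonneg by simp
    next
      case False then show ?thesis using \<phi>t_bound[OF t, of x] L(1)
        by (auto intro: order_trans[OF _ mult_left_mono])
    qed
  qed (use t m \<phi>'_outside[OF t] \<Lambda>_nonneg in auto)
  show "(\<lambda>x. \<phi> s x - \<phi> t x) \<in> Lq 2" if "s \<ge> 0" for s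
    using Lq2_diff[OF \<phi>_riemann[OF that] \<phi>_riemann[OF t]] by simp
  show "((\<lambda>s. Lq_norm 2 (\<lambda>x. (\<phi> s x - \<phi> t x) / (s - t) - \<phi>t t x)) \<longlongrightarrow> 0) (at t within {0..})"
    unfolding tendsto_at_iff_sequentially comp_def
  proof (intro allI impI)
    fix X :: "nat \<Rightarrow> real" assume X: "\<forall>i. X i \<in> {0..} - {t}" and lim: "X \<longlonglongrightarrow> t"
    have "Bseq X" using lim by (intro convergent_imp_Bseq convergentI)
    then obtain S where S: "\<And>i. \<bar>X i\<bar> \<le> S" by (auto simp: Bseq_def)
    define T where "T = max S t"
    define R where "R = \<Lambda> * (1 + T)"
    have XT: "X i \<ge> 0" "X i \<noteq> t" "X i \<le> T" for i using X S[of i] by (auto simp: T_def)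
    have tT: "t \<le> T" by (simp add: T_def)
    let ?r = "\<lambda>i x. (\<phi> (X i) x - \<phi> t x) / (X i - t) - \<phi>t t x"
    have "(\<lambda>i. LINT x|lebesgue. (?r i x)\<^sup>2) \<longlonglongrightarrow> (LINT x|(lebesgue :: real measure). (0::real))"
    proof (rule integral_dominated_convergence[where w = "\<lambda>x. indicator {- R..R} x * (2 * L * R)\<^sup>2"])
      show "integrable lebesgue (\<lambda>x. indicator {- R..R} x * (2 * L * R)\<^sup>2)"
        by (intro integrable_mult_left integrable_real_indicator) (auto simp: emeasure_lborel_Icc_eq)
      show "(\<lambda>x. (?r i x)\<^sup>2) \<in> borel_measurable lebesgue" for i
        using mm[OF XT(1)[of i]] mm[OF t] m by (intro borel_measurable_power borel_measurable_diff borel_measurable_divide) auto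
      have "AE x in lebesgue. x \<notin> corners t"
        using corners(2)[of t] by (intro AE_not_in) (simp add: negligible_iff_null_sets[symmetric] negligible_finite)
      then show "AE x in lebesgue. (\<lambda>i. (?r i x)\<^sup>2) \<longlonglongrightarrow> 0"
      proof eventually_elim
        case (elim x)
        have "((\<lambda>s. (\<phi> s x - \<phi> t x) / (s - t)) \<longlongrightarrow> \<phi>t t x) (at t)"
          using \<phi>_has_t_derivative[OF t elim] by (simp add: has_field_derivative_iff)
        then have "(\<lambda>i. (\<phi> (X i) x - \<phi> t x) / (X i - t)) \<longlonglongrightarrow> \<phi>t t x"
          using X lim by (auto simp: tendsto_at_iff_sequentially comp_def)
        then have "(\<lambda>i. (?r i x)\<^sup>2) \<longlonglongrightarrow> (\<phi>t t x - \<phi>t t x)\<^sup>2" by (intro tendsto_intros)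
        then show ?case by simp
      qed
      show "AE x in lebesgue. norm ((?r i x)\<^sup>2) \<le> indicator {- R..R} x * (2 * L * R)\<^sup>2" for i
      proof (intro always_eventually allI)
        fix x :: real
        show "norm ((?r i x)\<^sup>2) \<le> indicator {- R..R} x * (2 * L * R)\<^sup>2"
        proof (cases "\<bar>x\<bar> \<le> R")
          case True
          have "\<bar>(\<phi> (X i) x - \<phi> t x) / (X i - t)\<bar> \<le> L * \<bar>x\<bar>"
            using \<phi>_time_lipschitz[OF XT(1)[of i] t, of x] XT(2)[of i] by (simp add: abs_divide field_simps)
          then have "\<bar>?r i x\<bar> \<le> 2 * L * \<bar>x\<bar>" using \<phi>t_bound[OF t, of x] by linarith
          also have "\<dots> \<le> 2 * L * R" using True L(1) by (intro mult_left_mono) auto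
          finally have "\<bar>?r i x\<bar>\<^sup>2 \<le> (2 * L * R)\<^sup>2" by (intro power_mono) auto
          then show ?thesis using True by (auto simp: indicator_def abs_le_iff)
        next
          case False
          have "\<Lambda> * (1 + X i) \<le> R" "\<Lambda> * (1 + t) \<le> R"
            unfolding R_def using XT(3)[of i] tT \<Lambda>_nonneg by (auto intro!: mult_left_mono)
          then have "\<bar>x\<bar> > \<Lambda> * (1 + X i)" "\<bar>x\<bar> > \<Lambda> * (1 + t)" using False by linarith+
          then show ?thesis
            using \<phi>_outside[OF XT(1)[of i], of x] \<phi>_outside[OF t, of x] \<phi>'_outside[OF t, of x] by simp
        qed
      qed
    qed auto
    then have "(\<lambda>i. sqrt (LINT x|lebesgue. (?r i x)\<^sup>2)) \<longlonglongrightarrow> sqrt 0" by (intro tendsto_intros) simp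
    then show "(\<lambda>i. Lq_norm 2 (?r i)) \<longlonglongrightarrow> 0" by (simp add: Lq_norm2)
  qed
qed

end

section \<open>A primitive of the convective term\<close>

text \<open>The function \<open>\<integral>\<^sub>0\<^sup>w (f(b + s) - f(b)) \<eta>2(s) ds\<close>, whose derivative in \<open>w\<close> is the factor of \<open>w\<^sub>x\<close> in the
  convective term of the energy balance.  Its derivative in \<open>b\<close> is the same expression for \<open>f'\<close>, which
  is nonnegative if \<open>f'\<close> is increasing.\<close>

definition rel_flux :: "(real \<Rightarrow> real) \<Rightarrow> (real \<Rightarrow> real) \<Rightarrow> real \<Rightarrow> real \<Rightarrow> real" where
  "rel_flux f \<eta>2 w b = primitive_of (\<lambda>s. (f (b + s) - f b) * \<eta>2 s) w"

lemma rel_flux_integrand_continuous: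
  assumes "continuous_on UNIV f" "continuous_on UNIV \<eta>2"
  shows "continuous_on UNIV (\<lambda>s. (f (b + s) - f b) * \<eta>2 (s::real) :: real)"
  using assms by (intro continuous_intros continuous_on_compose2[OF assms(1)]) auto

lemma rel_flux_deriv_w:
  assumes "continuous_on UNIV f" "continuous_on UNIV \<eta>2"
  shows "((\<lambda>w. rel_flux f \<eta>2 w b) has_real_derivative (f (b + w) - f b) * \<eta>2 w) (at w)"
  unfolding rel_flux_def
  by (intro is_primitive_has_derivative is_primitive_primitive_of locally_integrable_continuous
      rel_flux_integrand_continuous assms)

lemma rel_flux_deriv_b:
  fixes f f1 \<eta>2 :: "real \<Rightarrow> real"
  assumes f: "\<And>x. (f has_real_derivative f1 x) (at x)" and c: "continuous_on UNIV f1" "continuous_on UNIV \<eta>2"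
  shows "((\<lambda>b. rel_flux f \<eta>2 w b) has_real_derivative rel_flux f1 \<eta>2 w b) (at b)"
proof -
  have cf: "continuous_on UNIV f" using f by (auto intro!: continuous_at_imp_continuous_on intro: DERIV_isCont)
  have *: "((\<lambda>b. integral (cbox x y) (\<lambda>s. (f (b + s) - f b) * \<eta>2 s)) has_real_derivative
     integral (cbox x y) (\<lambda>s. (f1 (b + s) - f1 b) * \<eta>2 s)) (at b within UNIV)" for x y :: real
  proof (rule leibniz_rule_field_derivative)
    show "((\<lambda>b. (f (b + s) - f b) * \<eta>2 s) has_real_derivative (f1 (b + s) - f1 b) * \<eta>2 s) (at b within UNIV)" for b s
      by (auto intro!: derivative_eq_intros DERIV_chain2[OF f])
    show "(\<lambda>s. (f (b + s) - f b) * \<eta>2 s) integrable_on cbox x y" for b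
      using rel_flux_integrand_continuous[OF cf c(2)] by (intro integrable_continuous) (auto intro: continuous_on_subset)
    show "continuous_on (UNIV \<times> cbox x y) (\<lambda>(b, s). (f1 (b + s) - f1 b) * \<eta>2 s)"
      unfolding case_prod_beta
      by (intro continuous_intros continuous_on_compose2[OF c(1)] continuous_on_compose2[OF c(2)]) auto
  qed auto
  show ?thesis
  proof (cases "0 \<le> w")
    case True
    then show ?thesis using *[of 0 w] by (simp add: rel_flux_def primitive_of_def)
  next
    case False
    then show ?thesis using DERIV_minus[OF *[of w 0]] by (simp add: rel_flux_def primitive_of_def)
  qed
qed

lemma rel_flux_bound:
  assumes c: "continuous_on UNIV f" "continuous_on UNIV \<eta>2"
    and le: "\<And>s. \<bar>s\<bar> \<le> \<bar>w\<bar> \<Longrightarrow> \<bar>f (b + s) - f b\<bar> \<le> A * \<bar>s\<bar>" "\<And>s. \<bar>s\<bar> \<le> \<bar>w\<bar> \<Longrightarrow> \<bar>\<eta>2 s\<bar> \<le> K" and "A \<ge> 0"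
  shows "\<bar>rel_flux f \<eta>2 w b\<bar> \<le> A * K * w\<^sup>2"
proof -
  obtain z where z: "z \<in> {min w 0..max w 0}"
    "rel_flux f \<eta>2 w b - rel_flux f \<eta>2 0 b = (f (b + z) - f b) * \<eta>2 z * (w - 0)"
    using mean_value_between[OF rel_flux_deriv_w[OF c]] by metis
  have zw: "\<bar>z\<bar> \<le> \<bar>w\<bar>" using z(1) by (auto simp: min_def max_def split: if_splits)
  have K: "K \<ge> 0" using le(2)[of 0] by simp
  have "\<bar>rel_flux f \<eta>2 w b\<bar> = \<bar>f (b + z) - f b\<bar> * \<bar>\<eta>2 z\<bar> * \<bar>w\<bar>"
    using z(2) by (simp add: rel_flux_def primitive_of_def abs_mult)
  also have "\<dots> \<le> (A * \<bar>w\<bar>) * K * \<bar>w\<bar>"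
    using le[OF zw] zw K \<open>A \<ge> 0\<close> by (intro mult_right_mono mult_mono) (auto intro: order_trans mult_left_mono)
  also have "\<dots> = A * K * w\<^sup>2" by (simp add: power2_eq_square)
  finally show ?thesis .
qed

lemma rel_flux_nonneg:
  assumes c: "continuous_on UNIV f" "continuous_on UNIV \<eta>2"
    and mono: "\<And>x y. x \<le> y \<Longrightarrow> f x \<le> f y" and "\<And>s. 0 \<le> \<eta>2 s"
  shows "0 \<le> rel_flux f \<eta>2 w b"
proof -
  obtain z where z: "z \<in> {min w 0..max w 0}"
    "rel_flux f \<eta>2 w b - rel_flux f \<eta>2 0 b = (f (b + z) - f b) * \<eta>2 z * (w - 0)"
    using mean_value_between[OF rel_flux_deriv_w[OF c]] by metis
  have eq: "rel_flux f \<eta>2 w b = ((f (b + z) - f b) * w) * \<eta>2 z"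
    using z(2) by (simp add: rel_flux_def primitive_of_def mult_ac)
  have "0 \<le> (f (b + z) - f b) * w"
  proof (cases "w \<ge> 0")
    case True
    then show ?thesis using z(1) mono[of b "b + z"] by (intro mult_nonneg_nonneg) auto
  next
    case False
    then show ?thesis using z(1) mono[of "b + z" b] by (intro mult_nonpos_nonpos) auto
  qed
  then show ?thesis using assms(4) by (simp add: eq)
qed

text \<open>The increment in \<open>w\<close> is resolved by the mean value theorem with \<open>b\<close> already at its new value, so that
  continuity and differentiability along a curve \<open>(W, P)\<close> follow from the two partial derivatives.\<close>

lemma rel_flux_difference:
  assumes c: "continuous_on UNIV f" "continuous_on UNIV \<eta>2" and W: "isCont W x" and P: "isCont P x"
  shows "\<exists>q. (q \<longlongrightarrow> (f (P x + W x) - f (P x)) * \<eta>2 (W x)) (at x) \<and>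
     (\<forall>y. rel_flux f \<eta>2 (W y) (P y) - rel_flux f \<eta>2 (W x) (P y) = q y * (W y - W x))"
proof -
  have "\<exists>z. z \<in> {min (W y) (W x)..max (W y) (W x)} \<and>
      rel_flux f \<eta>2 (W y) (P y) - rel_flux f \<eta>2 (W x) (P y) = (f (P y + z) - f (P y)) * \<eta>2 z * (W y - W x)" for y
    by (rule mean_value_between[OF rel_flux_deriv_w[OF c]])
  then obtain z where z: "\<And>y. z y \<in> {min (W y) (W x)..max (W y) (W x)}"
      "\<And>y. rel_flux f \<eta>2 (W y) (P y) - rel_flux f \<eta>2 (W x) (P y) = (f (P y + z y) - f (P y)) * \<eta>2 (z y) * (W y - W x)"
    by metis
  have lW: "(W \<longlongrightarrow> W x) (at x)" and lP: "(P \<longlongrightarrow> P x) (at x)" using W P by (simp_all add: isCont_def)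
  have lz: "(z \<longlongrightarrow> W x) (at x)"
  proof (rule tendsto_sandwich)
    show "\<forall>\<^sub>F y in at x. min (W y) (W x) \<le> z y" "\<forall>\<^sub>F y in at x. z y \<le> max (W y) (W x)"
      using z(1) by (auto intro!: always_eventually)
    show "((\<lambda>y. min (W y) (W x)) \<longlongrightarrow> W x) (at x)" using tendsto_min[OF lW tendsto_const[of "W x"]] by simp
    show "((\<lambda>y. max (W y) (W x)) \<longlongrightarrow> W x) (at x)" using tendsto_max[OF lW tendsto_const[of "W x"]] by simp
  qed
  have cf: "isCont f y" "isCont \<eta>2 y" for y using c by (simp_all add: continuous_on_eq_continuous_at)
  have "((\<lambda>y. (f (P y + z y) - f (P y)) * \<eta>2 (z y)) \<longlongrightarrow> (f (P x + W x) - f (P x)) * \<eta>2 (W x)) (at x)"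
    by (intro tendsto_intros isCont_tendsto_compose[OF cf(1)] isCont_tendsto_compose[OF cf(2)] lz lP)
  with z(2) show ?thesis by (intro exI[of _ "\<lambda>y. (f (P y + z y) - f (P y)) * \<eta>2 (z y)"]) auto
qed

lemma rel_flux_comp_isCont:
  fixes f f1 \<eta>2 W P :: "real \<Rightarrow> real"
  assumes f: "\<And>x. (f has_real_derivative f1 x) (at x)" and c: "continuous_on UNIV f1" "continuous_on UNIV \<eta>2"
    and W: "isCont W x" and P: "isCont P x"
  shows "isCont (\<lambda>x. rel_flux f \<eta>2 (W x) (P x)) x"
proof -
  have cf: "continuous_on UNIV f" using f by (auto intro!: continuous_at_imp_continuous_on intro: DERIV_isCont)
  obtain q where q: "(q \<longlongrightarrow> (f (P x + W x) - f (P x)) * \<eta>2 (W x)) (at x)"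
     "\<And>y. rel_flux f \<eta>2 (W y) (P y) - rel_flux f \<eta>2 (W x) (P y) = q y * (W y - W x)"
    using rel_flux_difference[OF cf c(2) W P] by blast
  have 1: "((\<lambda>y. q y * (W y - W x) + rel_flux f \<eta>2 (W x) (P y)) \<longlongrightarrow>
     (f (P x + W x) - f (P x)) * \<eta>2 (W x) * (W x - W x) + rel_flux f \<eta>2 (W x) (P x)) (at x)"
    using W P by (intro tendsto_intros q(1) isCont_tendsto_compose[OF DERIV_isCont[OF rel_flux_deriv_b[OF f c]]])
      (simp_all add: isCont_def)
  have 2: "rel_flux f \<eta>2 (W y) (P y) = q y * (W y - W x) + rel_flux f \<eta>2 (W x) (P y)" for y
    using q(2)[of y] by linarith
  show ?thesis unfolding isCont_def by (subst 2) (use 1 in simp)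
qed

lemma rel_flux_comp_has_derivative:
  fixes f f1 \<eta>2 W P :: "real \<Rightarrow> real"
  assumes f: "\<And>x. (f has_real_derivative f1 x) (at x)" and c: "continuous_on UNIV f1" "continuous_on UNIV \<eta>2"
    and W: "(W has_real_derivative w') (at x)" and P: "(P has_real_derivative p') (at x)"
  shows "((\<lambda>x. rel_flux f \<eta>2 (W x) (P x)) has_real_derivative
     (f (P x + W x) - f (P x)) * \<eta>2 (W x) * w' + rel_flux f1 \<eta>2 (W x) (P x) * p') (at x)"
proof -
  have cf: "continuous_on UNIV f" using f by (auto intro!: continuous_at_imp_continuous_on intro: DERIV_isCont)
  obtain q where q: "(q \<longlongrightarrow> (f (P x + W x) - f (P x)) * \<eta>2 (W x)) (at x)"
     "\<And>y. rel_flux f \<eta>2 (W y) (P y) - rel_flux f \<eta>2 (W x) (P y) = q y * (W y - W x)"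
    using rel_flux_difference[OF cf c(2) DERIV_isCont[OF W] DERIV_isCont[OF P]] by blast
  have "((\<lambda>y. rel_flux f \<eta>2 (W x) (P y)) has_real_derivative rel_flux f1 \<eta>2 (W x) (P x) * p') (at x)"
    by (rule DERIV_chain2[OF rel_flux_deriv_b[OF f c] P])
  then have 1: "((\<lambda>y. q y * ((W y - W x) / (y - x)) + (rel_flux f \<eta>2 (W x) (P y) - rel_flux f \<eta>2 (W x) (P x)) / (y - x)) \<longlongrightarrow>
      (f (P x + W x) - f (P x)) * \<eta>2 (W x) * w' + rel_flux f1 \<eta>2 (W x) (P x) * p') (at x)"
    using W by (intro tendsto_intros q(1)) (simp_all add: has_field_derivative_iff)
  have 2: "(rel_flux f \<eta>2 (W y) (P y) - rel_flux f \<eta>2 (W x) (P x)) / (y - x) =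
     q y * ((W y - W x) / (y - x)) + (rel_flux f \<eta>2 (W x) (P y) - rel_flux f \<eta>2 (W x) (P x)) / (y - x)" for y
    using q(2)[of y] by (simp add: add_divide_distrib[symmetric])
  show ?thesis unfolding has_field_derivative_iff by (subst 2) (rule 1)
qed

section \<open>Dissipation of convection and stress of the wave\<close>

locale viscous_solution = convex_flux +
  fixes \<sigma> \<sigma>1 :: "real \<Rightarrow> real" and M :: real and u ut U V :: "real \<Rightarrow> real \<Rightarrow> real"
  assumes \<sigma>: "\<And>x. (\<sigma> has_real_derivative \<sigma>1 x) (at x)" and \<sigma>1: "continuous_on UNIV \<sigma>1"
    and \<sigma>1_pos: "\<And>x. \<sigma>1 x > 0" and \<sigma>_0: "\<sigma> 0 = 0"
    and solution: "regular_solution f \<sigma> um up M u ut U V"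
begin

lemma sol:
  assumes "t \<ge> 0"
  shows "AE x in lebesgue. u t x = U t x" "\<And>x. (U t has_real_derivative V t x) (at x)"
    "continuous_on UNIV (V t)" "\<And>x. \<bar>U t x\<bar> \<le> M" "\<And>x. \<bar>V t x\<bar> \<le> M" "V t \<in> Lq 2"
    "(LINT x|lebesgue. (V t x)\<^sup>2) \<le> M" "(\<lambda>x. U t x - riemann_data um up x) \<in> Lq 2"
  using solution assms by (auto simp: regular_solution_def)

lemma flux: "t > 0 \<Longrightarrow> is_primitive (\<lambda>x. f (U t x) - \<sigma> (V t x)) (\<lambda>x. - ut t x)"
  using solution by (simp add: regular_solution_def)

lemma cont_\<sigma>: "continuous_on UNIV \<sigma>"
  using \<sigma> by (auto intro!: continuous_at_imp_continuous_on intro: DERIV_isCont)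

lemma cont_U: "t \<ge> 0 \<Longrightarrow> continuous_on UNIV (U t)"
  using sol(2) by (auto intro!: continuous_at_imp_continuous_on intro: DERIV_isCont)

text \<open>The quantity to be estimated is the difference of the solution and the approximate
  wave.  It is differentiable off the corners of the wave, with derivative \<open>Wx\<close>.\<close>

definition W :: "real \<Rightarrow> real \<Rightarrow> real" where "W t x = U t x - \<phi> t x"
definition Wx :: "real \<Rightarrow> real \<Rightarrow> real" where "Wx t x = V t x - \<phi>x t x"
definition W_max :: real where "W_max = M + \<bar>um\<bar> + \<bar>up\<bar>"

lemma W_bound: "t \<ge> 0 \<Longrightarrow> \<bar>W t x\<bar> \<le> W_max"
  using sol(4)[of t x] \<phi>_range(3)[of t x] by (simp add: W_def W_max_def)

lemma cont_W: "t \<ge> 0 \<Longrightarrow> continuous_on UNIV (W t)"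
  unfolding W_def by (intro continuous_intros cont_U \<phi>_continuous)

lemma W_Lq2: "t \<ge> 0 \<Longrightarrow> W t \<in> Lq 2"
  using Lq2_diff[OF sol(8) \<phi>_riemann] by (simp add: W_def[abs_def])

lemma Wx_Lq2: "t \<ge> 0 \<Longrightarrow> Wx t \<in> Lq 2"
  using Lq2_diff[OF sol(6) \<phi>x_Lq2(1)] by (simp add: Wx_def[abs_def])

lemma W_has_derivative: "t \<ge> 0 \<Longrightarrow> x \<notin> corners t \<Longrightarrow> (W t has_real_derivative Wx t x) (at x)"
  unfolding W_def[abs_def] Wx_def by (intro DERIV_diff sol(2) \<phi>_has_x_derivative)

lemma \<phi>x_abs_le: "t \<ge> 0 \<Longrightarrow> \<bar>\<phi>x t x\<bar> \<le> L"
proof -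
  assume t: "t \<ge> 0"
  then have "L / (1 + t) \<le> L" using L(1) by (simp add: field_simps)
  with \<phi>x_bounds[OF t, of x] show ?thesis by linarith
qed

lemma Wx_bound: "t \<ge> 0 \<Longrightarrow> \<bar>Wx t x\<bar> \<le> M + L"
  using sol(5)[of t x] \<phi>x_abs_le[of t x] by (simp add: Wx_def)

lemma entropy_comp_primitive:
  assumes \<eta>: "entropy \<eta> \<eta>1 \<eta>2" and t: "t \<ge> 0"
  shows "is_primitive (\<lambda>x. \<eta>1 (W t x)) (\<lambda>x. \<eta>2 (W t x) * Wx t x)"
proof (rule is_primitive_deriv[OF corners(2)])
  show "continuous_on UNIV (\<lambda>x. \<eta>1 (W t x))"
    by (rule continuous_on_compose2[OF entropy_continuous(2)[OF \<eta>] cont_W[OF t]]) auto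
  show "((\<lambda>x. \<eta>1 (W t x)) has_real_derivative \<eta>2 (W t x) * Wx t x) (at x)" if "x \<notin> corners t" for x
    using \<eta> by (intro DERIV_chain2[OF _ W_has_derivative[OF t that]]) (simp add: entropy_def)
  obtain K where K: "K > 0" "\<forall>x. \<bar>x\<bar> \<le> W_max \<longrightarrow> \<bar>\<eta>2 x\<bar> \<le> K"
    using entropy_bounds[OF \<eta>, of W_max] by metis
  have "\<bar>\<eta>2 (W t x) * Wx t x\<bar> \<le> K * (M + L)" for x
    unfolding abs_mult using K W_bound[OF t] Wx_bound[OF t] by (intro mult_mono) auto
  then show "\<exists>B. \<forall>x. \<bar>x\<bar> \<le> r \<longrightarrow> \<bar>\<eta>2 (W t x) * Wx t x\<bar> \<le> B" for r by blast
qed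

lemma entropy_comp_Lq2:
  assumes \<eta>: "entropy \<eta> \<eta>1 \<eta>2" and t: "t \<ge> 0"
  shows "(\<lambda>x. \<eta>1 (W t x)) \<in> Lq 2" "(\<lambda>x. \<eta>2 (W t x) * Wx t x) \<in> Lq 2" "integrable lebesgue (\<lambda>x. \<eta> (W t x))"
    "integrable lebesgue (\<lambda>x. \<eta>2 (W t x) * (Wx t x)\<^sup>2)"
proof -
  have b: "AE x in lebesgue. \<bar>W t x\<bar> \<le> W_max" using W_bound[OF t] by (intro always_eventually) simp
  show "(\<lambda>x. \<eta>1 (W t x)) \<in> Lq 2" "integrable lebesgue (\<lambda>x. \<eta> (W t x))"
    using energy_integrable[OF \<eta> W_Lq2[OF t] b] by auto
  obtain K where K: "K > 0" "\<forall>x. \<bar>x\<bar> \<le> W_max \<longrightarrow> \<bar>\<eta>2 x\<bar> \<le> K"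
    using entropy_bounds[OF \<eta>, of W_max] by metis
  have m: "(\<lambda>x. \<eta>2 (W t x)) \<in> borel_measurable lebesgue"
    by (rule continuous_imp_lebesgue[OF continuous_on_compose2[OF entropy_continuous(3)[OF \<eta>] cont_W[OF t]]]) auto
  show 1: "(\<lambda>x. \<eta>2 (W t x) * Wx t x) \<in> Lq 2"
    by (rule Lq2_bounded_mult[OF Wx_Lq2[OF t] m, where K = K]) (use K W_bound[OF t] in auto)
  show "integrable lebesgue (\<lambda>x. \<eta>2 (W t x) * (Wx t x)\<^sup>2)"
    using Lq2_mult_integrable[OF 1 Wx_Lq2[OF t]] by (simp add: power2_eq_square mult.assoc)
qed

lemma f_difference_Lq2:
  assumes t: "t \<ge> 0" shows "(\<lambda>x. f (U t x) - f (\<phi> t x)) \<in> Lq 2"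
proof -
  obtain A where A: "A > 0" "\<And>a b. \<bar>a\<bar> \<le> W_max \<Longrightarrow> \<bar>b\<bar> \<le> W_max \<Longrightarrow> \<bar>f a - f b\<bar> \<le> A * \<bar>a - b\<bar>"
    using lipschitz_on_compact_interval[OF f cont(2)] by metis
  have M: "M \<ge> 0" using sol(4)[OF t, of 0] by linarith
  have bd: "\<bar>U t x\<bar> \<le> W_max" "\<bar>\<phi> t x\<bar> \<le> W_max" for x
    using sol(4)[OF t, of x] \<phi>_range(3)[of t x] M by (auto simp: W_max_def)
  show ?thesis
    by (rule Lq2_lipschitz_comp[of "U t" "\<phi> t" f A, OF _ cont(1) continuous_imp_lebesgue[OF cont_U[OF t]]
          continuous_imp_lebesgue[OF \<phi>_continuous[OF t]] A(2)[OF bd]])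
       (use W_Lq2[OF t] in \<open>simp add: W_def[abs_def]\<close>)
qed

text \<open>The function \<open>rel_flux\<close>, evaluated along \<open>W\<close> and \<open>\<phi>\<close>, is integrable, hence its derivative in \<open>x\<close> has
  integral zero.  That derivative consists of the integrand in question and of the \<open>rel_flux\<close> of \<open>f'\<close>
  multiplied by \<open>\<phi>\<^sub>x\<close>, where both factors are nonnegative.\<close>

lemma convection_dissipative:
  assumes \<eta>: "entropy \<eta> \<eta>1 \<eta>2" and t: "t \<ge> 0"
  shows "(LINT x|lebesgue. (f (U t x) - f (\<phi> t x)) * (\<eta>2 (W t x) * Wx t x)) \<le> 0"
proof -
  note c\<eta> = entropy_continuous[OF \<eta>]
  define S where "S = W_max + \<bar>um\<bar> + \<bar>up\<bar>"
  obtain K where K: "K > 0" "\<forall>x. \<bar>x\<bar> \<le> W_max \<longrightarrow> \<bar>\<eta>2 x\<bar> \<le> K"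
    using entropy_bounds[OF \<eta>, of W_max] by metis
  obtain A where A: "A > 0" "\<And>a b. \<bar>a\<bar> \<le> S \<Longrightarrow> \<bar>b\<bar> \<le> S \<Longrightarrow> \<bar>f a - f b\<bar> \<le> A * \<bar>a - b\<bar>"
    using lipschitz_on_compact_interval[OF f cont(2)] by metis
  obtain A' where A': "A' > 0" "\<And>a b. \<bar>a\<bar> \<le> S \<Longrightarrow> \<bar>b\<bar> \<le> S \<Longrightarrow> \<bar>f1 a - f1 b\<bar> \<le> A' * \<bar>a - b\<bar>"
    using lipschitz_on_compact_interval[OF f1 cont(3)] by metis
  have S: "\<bar>\<phi> t x + s\<bar> \<le> S" "\<bar>\<phi> t x\<bar> \<le> S" if "\<bar>s\<bar> \<le> \<bar>W t x\<bar>" for x s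
    using \<phi>_range(3)[of t x] W_bound[OF t, of x] that by (auto simp: S_def)
  define C where "C x = rel_flux f \<eta>2 (W t x) (\<phi> t x)" for x
  define h where "h x = rel_flux f1 \<eta>2 (W t x) (\<phi> t x)" for x
  define k where "k x = (f (U t x) - f (\<phi> t x)) * (\<eta>2 (W t x) * Wx t x)" for x
  have Cb: "\<bar>C x\<bar> \<le> A * K * (W t x)\<^sup>2" for x
    unfolding C_def using A K W_bound[OF t, of x] S
    by (intro rel_flux_bound cont c\<eta>) (auto intro: order_trans[OF A(2)])
  have hb: "\<bar>h x\<bar> \<le> A' * K * (W t x)\<^sup>2" for x
    unfolding h_def using A' K W_bound[OF t, of x] S
    by (intro rel_flux_bound cont c\<eta>) (auto intro: order_trans[OF A'(2)])
  have h0: "0 \<le> h x" for x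
    unfolding h_def using \<eta> by (intro rel_flux_nonneg cont c\<eta> f1_mono) (auto simp: entropy_def)
  have P: "is_primitive C (\<lambda>x. k x + h x * \<phi>x t x)"
  proof (rule is_primitive_deriv[OF corners(2)])
    show "continuous_on UNIV C"
      unfolding C_def using cont_W[OF t] \<phi>_continuous[OF t]
      by (intro continuous_at_imp_continuous_on ballI rel_flux_comp_isCont[OF f cont(2) c\<eta>(3)])
         (auto simp: continuous_on_eq_continuous_at)
    show "(C has_real_derivative k x + h x * \<phi>x t x) (at x)" if "x \<notin> corners t" for x
      using rel_flux_comp_has_derivative[OF f cont(2) c\<eta>(3) W_has_derivative[OF t that] \<phi>_has_x_derivative[OF t that]]
      by (simp add: C_def[abs_def] k_def h_def W_def mult.assoc)
    have "\<bar>k x + h x * \<phi>x t x\<bar> \<le> (A * W_max) * (K * (M + L)) + A' * K * W_max\<^sup>2 * L" for x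
    proof -
      have R0: "W_max \<ge> 0" using W_bound[OF t, of x] by linarith
      have "\<bar>f (U t x) - f (\<phi> t x)\<bar> \<le> A * \<bar>W t x\<bar>"
        using A(2)[OF S(1)[of "W t x" x] S(2)[of "W t x" x]] by (simp add: W_def)
      also have "\<dots> \<le> A * W_max" using A(1) W_bound[OF t] by (intro mult_left_mono) auto
      finally have "\<bar>k x\<bar> \<le> (A * W_max) * (K * (M + L))"
        unfolding k_def abs_mult using A(1) K R0 W_bound[OF t, of x] Wx_bound[OF t, of x] by (intro mult_mono) auto
      moreover have "\<bar>h x\<bar> \<le> A' * K * W_max\<^sup>2"
      proof (rule order_trans[OF hb])
        have "\<bar>W t x\<bar>\<^sup>2 \<le> W_max\<^sup>2" using W_bound[OF t] by (intro power_mono) auto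
        then show "A' * K * (W t x)\<^sup>2 \<le> A' * K * W_max\<^sup>2" using A'(1) K(1) by (intro mult_left_mono) auto
      qed
      then have "\<bar>h x * \<phi>x t x\<bar> \<le> A' * K * W_max\<^sup>2 * L"
        unfolding abs_mult using \<phi>x_abs_le[OF t, of x] A'(1) K(1) by (intro mult_mono) auto
      ultimately show ?thesis by linarith
    qed
    then show "\<exists>B. \<forall>x. \<bar>x\<bar> \<le> r \<longrightarrow> \<bar>k x + h x * \<phi>x t x\<bar> \<le> B" for r by blast
  qed
  have W2: "integrable lebesgue (\<lambda>x. (W t x)\<^sup>2)" by (rule Lq2_square[OF W_Lq2[OF t]])
  have iC: "integrable lebesgue C"
    by (rule Bochner_Integration.integrable_bound[OF integrable_mult_right[OF W2, of "A * K"]])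
       (use Cb A(1) K(1) continuous_imp_lebesgue[OF is_primitive_continuous[OF P]]
         in \<open>auto intro!: always_eventually simp: abs_mult\<close>)
  have ik: "integrable lebesgue k"
    unfolding k_def by (rule Lq2_mult_integrable[OF f_difference_Lq2[OF t] entropy_comp_Lq2(2)[OF \<eta> t]])
  have "(\<lambda>x. (k x + h x * \<phi>x t x) - k x) \<in> borel_measurable lebesgue"
    by (intro borel_measurable_diff locally_integrable_borel[OF is_primitive_locally_integrable[OF P]]
        borel_measurable_integrable[OF ik])
  then have hm: "(\<lambda>x. h x * \<phi>x t x) \<in> borel_measurable lebesgue" by simp
  have ih: "integrable lebesgue (\<lambda>x. h x * \<phi>x t x)"
  proof (rule Bochner_Integration.integrable_bound[OF integrable_mult_left[OF integrable_mult_right[OF W2, of "A' * K"], of L] hm])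
    have "\<bar>h x * \<phi>x t x\<bar> \<le> A' * K * (W t x)\<^sup>2 * L" for x
      unfolding abs_mult using hb[of x] \<phi>x_abs_le[OF t, of x] A'(1) K(1) by (intro mult_mono) auto
    then show "AE x in lebesgue. norm (h x * \<phi>x t x) \<le> norm (A' * K * (W t x)\<^sup>2 * L)"
      using A'(1) K(1) L(1) by (intro always_eventually) (auto simp: abs_mult)
  qed
  have "(LINT x|lebesgue. k x + h x * \<phi>x t x) = 0"
    using ik ih by (intro is_primitive_integral_zero[OF P iC]) auto
  then have "(LINT x|lebesgue. k x) = - (LINT x|lebesgue. h x * \<phi>x t x)" using ik ih by simp
  moreover have "0 \<le> (LINT x|lebesgue. h x * \<phi>x t x)"
    using h0 \<phi>x_bounds(1)[OF t] by (intro Bochner_Integration.integral_nonneg) auto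
  ultimately show ?thesis unfolding k_def by linarith
qed

text \<open>The stress \<open>\<sigma>(\<phi>\<^sub>x)\<close> lives on the fan, where it is of size \<open>O(1 / (1 + t))\<close> and has a derivative of size
  \<open>O(1 / (1 + t)\<^sup>2)\<close>, while the fan has length \<open>O(1 + t)\<close>.  Integrating by parts over the fan moves the
  derivative from \<open>\<eta>1(W)\<close> to the stress, and all the resulting terms are of order \<open>sup |\<eta>1(W)| / (1 + t)\<close>.\<close>

lemma wave_stress_bound:
  "\<exists>C>0. \<forall>\<eta> \<eta>1 \<eta>2 t m. entropy \<eta> \<eta>1 \<eta>2 \<longrightarrow> t \<ge> 0 \<longrightarrow> (\<forall>x. \<bar>\<eta>1 (W t x)\<bar> \<le> m) \<longrightarrow>
     \<bar>LINT x|lebesgue. \<sigma> (\<phi>x t x) * (\<eta>2 (W t x) * Wx t x)\<bar> \<le> C * m / (1 + t)"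
proof -
  obtain A where A: "A > 0" "\<And>a b. \<bar>a\<bar> \<le> L \<Longrightarrow> \<bar>b\<bar> \<le> L \<Longrightarrow> \<bar>\<sigma> a - \<sigma> b\<bar> \<le> A * \<bar>a - b\<bar>"
    using lipschitz_on_compact_interval[OF \<sigma> \<sigma>1] by metis
  obtain S where S: "S > 0" "\<And>x. \<bar>x\<bar> \<le> L \<Longrightarrow> \<bar>\<sigma>1 x\<bar> \<le> S"
    using bounded_on_compact_interval[OF \<sigma>1] by metis
  obtain F where F: "F > 0" "\<And>x. \<bar>x\<bar> \<le> \<bar>um\<bar> + \<bar>up\<bar> \<Longrightarrow> \<bar>f3 x\<bar> \<le> F"
    using bounded_on_compact_interval[OF f3] by metis
  define C2 where "C2 = S * (F * L * L\<^sup>2)"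
  define C where "C = 2 * (A * L) + C2 * (f1 up - f1 um)"
  have C2: "C2 > 0" using S F L by (simp add: C2_def)
  have dl: "f1 um < f1 up" by (rule f1_strict_mono[OF um_less_up])
  have C: "C > 0" unfolding C_def using A(1) L(1) C2 dl by (intro add_pos_pos mult_pos_pos) auto
  have "\<bar>LINT x|lebesgue. \<sigma> (\<phi>x t x) * (\<eta>2 (W t x) * Wx t x)\<bar> \<le> C * m / (1 + t)"
    if \<eta>: "entropy \<eta> \<eta>1 \<eta>2" and t: "t \<ge> 0" and m: "\<And>x. \<bar>\<eta>1 (W t x)\<bar> \<le> m" for \<eta> \<eta>1 \<eta>2 t m
  proof -
    define \<tau> where "\<tau> = 1 + t"
    have \<tau>: "\<tau> \<ge> 1" "\<tau> > 0" using t by (auto simp: \<tau>_def)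
    have m0: "m \<ge> 0" using m[of 0] by linarith
    define a where "a = f1 um * \<tau>"
    define b where "b = f1 up * \<tau>"
    have ab: "a < b" using dl \<tau> by (simp add: a_def b_def)
    \<comment> \<open>Inside the fan \<open>\<kappa>\<close> is the slope of the wave; unlike the slope it is continuous across the corners.\<close>
    define \<kappa> where "\<kappa> x = inverse (f2 (\<phi> t x)) / \<tau>" for x
    define \<kappa>' where "\<kappa>' x = - (f3 (\<phi> t x) * \<phi>x t x * (inverse (f2 (\<phi> t x)))\<^sup>2) / \<tau>" for x
    have inv0: "0 \<le> inverse (f2 (\<phi> t x))" "inverse (f2 (\<phi> t x)) \<le> L" for x
      using L(2) \<phi>_range convex[of "\<phi> t x"] by (auto simp: less_imp_le)
    have \<kappa>b: "\<bar>\<kappa> x\<bar> \<le> L / \<tau>" "\<bar>\<kappa> x\<bar> \<le> L" for x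
    proof -
      show 1: "\<bar>\<kappa> x\<bar> \<le> L / \<tau>" using inv0[of x] \<tau> by (simp add: \<kappa>_def divide_right_mono)
      have "L / \<tau> \<le> L" using \<tau> L(1) by (simp add: field_simps)
      with 1 show "\<bar>\<kappa> x\<bar> \<le> L" by linarith
    qed
    have \<kappa>'b: "\<bar>\<kappa>' x\<bar> \<le> F * L * L\<^sup>2 / \<tau>\<^sup>2" for x
    proof -
      have "\<bar>f3 (\<phi> t x)\<bar> * \<bar>\<phi>x t x\<bar> * (inverse (f2 (\<phi> t x)))\<^sup>2 \<le> F * (L / \<tau>) * L\<^sup>2"
        using F \<phi>_range(3) \<phi>x_bounds[OF t] inv0 L(1) \<tau>
        by (intro mult_mono power_mono) (auto simp: \<tau>_def)
      then have "\<bar>f3 (\<phi> t x)\<bar> * \<bar>\<phi>x t x\<bar> * (inverse (f2 (\<phi> t x)))\<^sup>2 / \<tau> \<le> F * (L / \<tau>) * L\<^sup>2 / \<tau>"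
        using \<tau> by (intro divide_right_mono) auto
      moreover have "\<bar>\<kappa>' x\<bar> = \<bar>f3 (\<phi> t x)\<bar> * \<bar>\<phi>x t x\<bar> * (inverse (f2 (\<phi> t x)))\<^sup>2 / \<tau>"
        using \<tau> by (simp add: \<kappa>'_def abs_mult)
      ultimately have "\<bar>\<kappa>' x\<bar> \<le> F * (L / \<tau>) * L\<^sup>2 / \<tau>" by simp
      also have "\<dots> = F * L * L\<^sup>2 / \<tau>\<^sup>2" by (simp add: power2_eq_square)
      finally show ?thesis .
    qed
    have d\<kappa>: "(\<kappa> has_real_derivative \<kappa>' x) (at x)" if "x \<notin> corners t" for x
    proof -
      have 1: "((\<lambda>x. f2 (\<phi> t x)) has_real_derivative f3 (\<phi> t x) * \<phi>x t x) (at x)"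
        by (rule DERIV_chain2[OF f2 \<phi>_has_x_derivative[OF t that]])
      show ?thesis
        unfolding \<kappa>_def[abs_def] \<kappa>'_def
        by (rule DERIV_cong[OF DERIV_cdivide[OF DERIV_inverse'[OF 1]]])
           (use convex[of "\<phi> t x"] in \<open>auto simp: power2_eq_square\<close>)
    qed
    have cont_\<kappa>: "continuous_on UNIV \<kappa>"
      unfolding \<kappa>_def using convex \<tau>
      by (intro continuous_intros continuous_on_compose2[OF cont(3) \<phi>_continuous[OF t]]) (auto simp: less_imp_neq[symmetric])
    define P where "P x = \<sigma> (\<kappa> x)" for x
    define P' where "P' x = \<sigma>1 (\<kappa> x) * \<kappa>' x" for x
    have P'b: "\<bar>P' x\<bar> \<le> C2 / \<tau>\<^sup>2" for x
    proof -
      have "\<bar>P' x\<bar> \<le> S * (F * L * L\<^sup>2 / \<tau>\<^sup>2)"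
        unfolding P'_def abs_mult using S \<kappa>b(2)[of x] \<kappa>'b[of x] by (intro mult_mono) auto
      then show ?thesis by (simp add: C2_def)
    qed
    have Pb: "\<bar>P x\<bar> \<le> A * L / \<tau>" for x
    proof -
      have "\<bar>P x\<bar> \<le> A * \<bar>\<kappa> x\<bar>" using A(2)[OF \<kappa>b(2)[of x], of 0] L(1) by (simp add: P_def \<sigma>_0)
      also have "\<dots> \<le> A * (L / \<tau>)" using A(1) \<kappa>b(1) by (intro mult_left_mono) auto
      finally show ?thesis by simp
    qed
    have PP: "is_primitive P P'"
    proof (rule is_primitive_deriv[OF corners(2)])
      show "continuous_on UNIV P"
        unfolding P_def by (rule continuous_on_compose2[OF cont_\<sigma> cont_\<kappa>]) auto
      show "(P has_real_derivative P' x) (at x)" if "x \<notin> corners t" for x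
        unfolding P_def[abs_def] P'_def by (rule DERIV_chain2[OF \<sigma> d\<kappa>[OF that]])
    qed (use P'b in blast)
    let ?g = "\<lambda>x. \<eta>2 (W t x) * Wx t x" and ?e = "\<lambda>x. \<eta>1 (W t x)"
    note EP = entropy_comp_primitive[OF \<eta> t]
    note prod = is_primitive_mult[OF PP EP]
    have i1: "(\<lambda>x. P x * ?g x) integrable_on {a..b}" "(\<lambda>x. ?e x * P' x) integrable_on {a..b}"
      using locally_integrable_mult_continuous[OF is_primitive_continuous[OF PP] is_primitive_locally_integrable[OF EP]]
        locally_integrable_mult_continuous[OF is_primitive_continuous[OF EP] is_primitive_locally_integrable[OF PP]]
      by (auto intro: locally_integrable_integrable_on)
    have "integral {a..b} (\<lambda>x. ?e x * P' x) + integral {a..b} (\<lambda>x. P x * ?g x) = P b * ?e b - P a * ?e a"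
      using is_primitive_integral[OF prod, of a b] ab i1 by (simp add: Henstock_Kurzweil_Integration.integral_add)
    then have "\<bar>integral {a..b} (\<lambda>x. P x * ?g x)\<bar> \<le> \<bar>P b * ?e b\<bar> + \<bar>P a * ?e a\<bar> + \<bar>integral {a..b} (\<lambda>x. ?e x * P' x)\<bar>"
      by linarith
    also have "\<dots> \<le> (A * L / \<tau>) * m + (A * L / \<tau>) * m + m * (C2 / \<tau>\<^sup>2) * (b - a)"
    proof (intro add_mono)
      have "\<bar>P y * ?e y\<bar> \<le> (A * L / \<tau>) * m" for y
        unfolding abs_mult using A(1) L(1) \<tau> by (intro mult_mono Pb m) auto
      then show "\<bar>P b * ?e b\<bar> \<le> (A * L / \<tau>) * m" "\<bar>P a * ?e a\<bar> \<le> (A * L / \<tau>) * m" by auto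
      have "norm (integral {a..b} (\<lambda>x. ?e x * P' x)) \<le> m * (C2 / \<tau>\<^sup>2) * (b - a)"
      proof -
        have "\<bar>?e x * P' x\<bar> \<le> m * (C2 / \<tau>\<^sup>2)" for x
          unfolding abs_mult using m m0 P'b[of x] by (intro mult_mono) auto
        then have "norm (integral {a..b} (\<lambda>x. ?e x * P' x)) \<le> integral {a..b} (\<lambda>_. m * (C2 / \<tau>\<^sup>2))"
          using i1 by (intro integral_norm_bound_integral) auto
        then show ?thesis using ab by (simp add: mult_ac)
      qed
      then show "\<bar>integral {a..b} (\<lambda>x. ?e x * P' x)\<bar> \<le> m * (C2 / \<tau>\<^sup>2) * (b - a)" by simp
    qed
    also have "\<dots> = C * m / \<tau>"
      using \<tau> by (simp add: C_def a_def b_def power2_eq_square field_simps)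
    finally have I: "\<bar>integral {a..b} (\<lambda>x. P x * ?g x)\<bar> \<le> C * m / \<tau>" .
    have eq: "\<sigma> (\<phi>x t x) * ?g x = indicator {a<..<b} x * (P x * ?g x)" for x
    proof (cases "x \<in> {a<..<b}")
      case True
      then have "f1 um < x / \<tau>" "x / \<tau> < f1 up" using \<tau> by (auto simp: a_def b_def field_simps)
      then have "\<phi>x t x = \<kappa> x" by (simp add: \<phi>x_def \<kappa>_def fan'_def \<phi>_def \<tau>_def)
      then show ?thesis using True by (simp add: P_def)
    next
      case False
      then have "\<not> (f1 um < x / \<tau> \<and> x / \<tau> < f1 up)" using \<tau> by (auto simp: a_def b_def field_simps)
      then have "\<phi>x t x = 0" by (auto simp: \<phi>x_def fan'_def \<tau>_def)
      then show ?thesis using False by (simp add: \<sigma>_0)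
    qed
    have "set_integrable lebesgue {a..b} (\<lambda>x. P x * ?g x)"
      using locally_integrable_mult_continuous[OF is_primitive_continuous[OF PP] is_primitive_locally_integrable[OF EP]]
      by (simp add: locally_integrable_def)
    then have "set_integrable lebesgue {a<..<b} (\<lambda>x. P x * ?g x)"
      by (rule set_integrable_subset) auto
    then have "(LINT x:{a<..<b}|lebesgue. P x * ?g x) = integral {a<..<b} (\<lambda>x. P x * ?g x)"
      by (rule set_lebesgue_integral_eq_integral(2))
    then have "(LINT x|lebesgue. \<sigma> (\<phi>x t x) * ?g x) = integral {a..b} (\<lambda>x. P x * ?g x)"
      unfolding eq by (simp add: set_lebesgue_integral_def integral_open_interval_real)
    then show ?thesis using I by (simp add: \<tau>_def)
  qed
  with C show ?thesis by blast
qed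

end

section \<open>Energy dissipation and growth of the mass\<close>

context viscous_solution begin

text \<open>The derivative is computed for \<open>u - \<phi>\<close>, for which the time derivative is known, and carried over to
  its representative.\<close>

lemma energy_derivative:
  assumes \<eta>: "entropy \<eta> \<eta>1 \<eta>2" and t: "t \<ge> 0"
  shows "((\<lambda>s. LINT x|lebesgue. \<eta> (W s x)) has_real_derivative (LINT x|lebesgue. \<eta>1 (W t x) * (ut t x - \<phi>t t x)))
     (at t within {0..})"
proof -
  define w where "w t x = u t x - \<phi> t x" for t x
  define w' where "w' t x = ut t x - \<phi>t t x" for t x
  have td: "has_time_deriv w w'"
    using has_time_deriv_diff[OF _ \<phi>_has_time_deriv, of u ut] solution
    by (simp add: regular_solution_def w_def[abs_def] w'_def[abs_def])
  have wW: "AE x in lebesgue. w s x = W s x" "AE x in lebesgue. W s x = w s x" if "s \<ge> 0" for s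
    using sol(1)[OF that] by (auto elim!: eventually_mono simp: w_def W_def)
  have wm: "w s \<in> borel_measurable lebesgue" if "s \<ge> 0" for s
    by (rule borel_measurable_AE[OF Lq2_borel[OF W_Lq2[OF that]] wW(2)[OF that]])
  have wL: "w s \<in> Lq 2" if "s \<ge> 0" for s
    by (rule Lq2_cong_AE[OF W_Lq2[OF that] wm[OF that] wW(2)[OF that]])
  have wb: "AE x in lebesgue. \<bar>w s x\<bar> \<le> W_max" if "s \<ge> 0" for s
    using wW(1)[OF that] by eventually_elim (use W_bound[OF that] in auto)
  have d: "((\<lambda>s. LINT x|lebesgue. \<eta> (w s x)) has_real_derivative (LINT x|lebesgue. \<eta>1 (w t x) * w' t x)) (at t within {0..})"
    by (rule energy_has_derivative[OF \<eta> td t wL[OF t] wb])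
  have m: "(\<lambda>x. h (w s x)) \<in> borel_measurable lebesgue" "(\<lambda>x. h (W s x)) \<in> borel_measurable lebesgue"
    if "s \<ge> 0" "continuous_on UNIV h" for h :: "real \<Rightarrow> real" and s
    using measurable_compose[OF wm[OF that(1)] borel_measurable_continuous_onI[OF that(2)]]
      measurable_compose[OF Lq2_borel[OF W_Lq2[OF that(1)]] borel_measurable_continuous_onI[OF that(2)]] by auto
  have w'm: "w' t \<in> borel_measurable lebesgue"
    using td t Lq2_borel by (auto simp: has_time_deriv_def)
  have e: "(LINT x|lebesgue. \<eta> (w s x)) = (LINT x|lebesgue. \<eta> (W s x))" if "s \<ge> 0" for s
    using wW(1)[OF that] m[OF that entropy_continuous(1)[OF \<eta>]]
    by (intro integral_cong_AE) (auto elim!: eventually_mono)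
  have "(LINT x|lebesgue. \<eta>1 (w t x) * w' t x) = (LINT x|lebesgue. \<eta>1 (W t x) * w' t x)"
    using wW(1)[OF t] m[OF t entropy_continuous(2)[OF \<eta>]] w'm
    by (intro integral_cong_AE) (auto elim!: eventually_mono intro!: borel_measurable_times)
  with d have "((\<lambda>s. LINT x|lebesgue. \<eta> (w s x)) has_real_derivative (LINT x|lebesgue. \<eta>1 (W t x) * (ut t x - \<phi>t t x))) (at t within {0..})"
    by (simp add: w'_def)
  then show ?thesis
    by (rule has_field_derivative_transform_within[where d = 1]) (use t e in auto)
qed

text \<open>Insert the equation into the time derivative and integrate by parts.  The flux difference splits
  into convection, the monotone difference of the two stresses, and the stress of the wave.\<close>

lemma energy_dissipation:
  "\<exists>c>0. \<exists>C>0. \<forall>\<eta> \<eta>1 \<eta>2 t m. entropy \<eta> \<eta>1 \<eta>2 \<longrightarrow> t > 0 \<longrightarrow> (\<forall>x. \<bar>\<eta>1 (W t x)\<bar> \<le> m) \<longrightarrow>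
     (\<exists>D. ((\<lambda>s. LINT x|lebesgue. \<eta> (W s x)) has_real_derivative D) (at t) \<and>
        D \<le> C * m / (1 + t) - c * (LINT x|lebesgue. \<eta>2 (W t x) * (Wx t x)\<^sup>2))"
proof -
  define B where "B = max M L"
  obtain C where C: "C > 0" and stress: "\<forall>\<eta> \<eta>1 \<eta>2 t m. entropy \<eta> \<eta>1 \<eta>2 \<longrightarrow> t \<ge> 0 \<longrightarrow> (\<forall>x. \<bar>\<eta>1 (W t x)\<bar> \<le> m) \<longrightarrow>
     \<bar>LINT x|lebesgue. \<sigma> (\<phi>x t x) * (\<eta>2 (W t x) * Wx t x)\<bar> \<le> C * m / (1 + t)"
    using wave_stress_bound by (elim exE conjE) (rule that)
  obtain c where c: "c > 0" "\<And>a b. \<bar>a\<bar> \<le> B \<Longrightarrow> \<bar>b\<bar> \<le> B \<Longrightarrow> c * (a - b)\<^sup>2 \<le> (\<sigma> a - \<sigma> b) * (a - b)"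
    using strongly_monotone_on_compact_interval[OF \<sigma> \<sigma>1 \<sigma>1_pos] by metis
  obtain A where A: "A > 0" "\<And>a b. \<bar>a\<bar> \<le> B \<Longrightarrow> \<bar>b\<bar> \<le> B \<Longrightarrow> \<bar>\<sigma> a - \<sigma> b\<bar> \<le> A * \<bar>a - b\<bar>"
    using lipschitz_on_compact_interval[OF \<sigma> \<sigma>1] by metis
  have B0: "B \<ge> 0" using L(1) by (simp add: B_def)
  have main: "(\<exists>D. ((\<lambda>s. LINT x|lebesgue. \<eta> (W s x)) has_real_derivative D) (at t) \<and>
        D \<le> C * m / (1 + t) - c * (LINT x|lebesgue. \<eta>2 (W t x) * (Wx t x)\<^sup>2))"
    if \<eta>: "entropy \<eta> \<eta>1 \<eta>2" and t: "t > 0" and m: "\<forall>x. \<bar>\<eta>1 (W t x)\<bar> \<le> m" for \<eta> \<eta>1 \<eta>2 t m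
  proof -
    note t0 = less_imp_le[OF t]
    let ?g = "\<lambda>x. \<eta>2 (W t x) * Wx t x"
    define w' where "w' x = ut t x - \<phi>t t x" for x
    have w'L: "w' \<in> Lq 2"
      using solution \<phi>_has_time_deriv t unfolding regular_solution_def has_time_deriv_def w'_def[abs_def]
      by (intro Lq2_diff) auto
    have bV: "\<bar>V t x\<bar> \<le> B" "\<bar>\<phi>x t x\<bar> \<le> B" for x
      using sol(5)[OF t0, of x] \<phi>x_abs_le[OF t0, of x] by (auto simp: B_def)
    have mV: "(\<lambda>x. \<sigma> (V t x)) \<in> borel_measurable lebesgue" "(\<lambda>x. \<sigma> (\<phi>x t x)) \<in> borel_measurable lebesgue"
      using measurable_compose[OF Lq2_borel[OF sol(6)[OF t0]] borel_measurable_continuous_onI[OF cont_\<sigma>]]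
        measurable_compose[OF Lq2_borel[OF \<phi>x_Lq2(1)[OF t0]] borel_measurable_continuous_onI[OF cont_\<sigma>]] by auto
    have \<sigma>V: "(\<lambda>x. \<sigma> (V t x)) \<in> Lq 2" "(\<lambda>x. \<sigma> (\<phi>x t x)) \<in> Lq 2"
      using A(2)[OF bV(1), of 0] A(2)[OF bV(2), of 0] B0 \<sigma>_0
      by (auto intro!: Lq2_bound[OF sol(6)[OF t0] mV(1), where K = A] Lq2_bound[OF \<phi>x_Lq2(1)[OF t0] mV(2), where K = A]
          always_eventually)
    define J where "J x = f (U t x) - \<sigma> (V t x) - f (\<phi> t x)" for x
    have JP: "is_primitive J (\<lambda>x. - w' x)"
      using is_primitive_diff[OF flux[OF t] f_\<phi>_primitive[OF t0]] by (simp add: J_def[abs_def] w'_def)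
    have "(\<lambda>x. (f (U t x) - f (\<phi> t x)) - \<sigma> (V t x)) \<in> Lq 2"
      by (rule Lq2_diff[OF f_difference_Lq2[OF t0] \<sigma>V(1)])
    then have JL: "J \<in> Lq 2" by (simp add: J_def[abs_def] algebra_simps)
    note eL = entropy_comp_Lq2[OF \<eta> t0]
    define D where "D = (LINT x|lebesgue. \<eta>1 (W t x) * w' x)"
    have "(LINT x|lebesgue. - w' x * \<eta>1 (W t x)) = - (LINT x|lebesgue. J x * ?g x)"
      by (rule integral_by_parts_line[OF JP entropy_comp_primitive[OF \<eta> t0] JL Lq2_uminus[OF w'L] eL(1,2)])
    then have D: "D = (LINT x|lebesgue. J x * ?g x)" by (simp add: D_def mult.commute)
    define I1 where "I1 = (LINT x|lebesgue. (f (U t x) - f (\<phi> t x)) * ?g x)"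
    define I2 where "I2 = (LINT x|lebesgue. (\<sigma> (V t x) - \<sigma> (\<phi>x t x)) * ?g x)"
    define I3 where "I3 = (LINT x|lebesgue. \<sigma> (\<phi>x t x) * ?g x)"
    note i = Lq2_mult_integrable[OF f_difference_Lq2[OF t0] eL(2)] Lq2_mult_integrable[OF Lq2_diff[OF \<sigma>V] eL(2)]
      Lq2_mult_integrable[OF \<sigma>V(2) eL(2)]
    have "D = (LINT x|lebesgue. (f (U t x) - f (\<phi> t x)) * ?g x - (\<sigma> (V t x) - \<sigma> (\<phi>x t x)) * ?g x - \<sigma> (\<phi>x t x) * ?g x)"
      unfolding D by (intro Bochner_Integration.integral_cong) (auto simp: J_def algebra_simps)
    also have "\<dots> = I1 - I2 - I3"
      unfolding I1_def I2_def I3_def using i by (subst Bochner_Integration.integral_diff, simp, simp, subst Bochner_Integration.integral_diff, simp_all)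
    finally have "D = I1 - I2 - I3" .
    moreover have "I1 \<le> 0" unfolding I1_def by (rule convection_dissipative[OF \<eta> t0])
    moreover have "c * (LINT x|lebesgue. \<eta>2 (W t x) * (Wx t x)\<^sup>2) \<le> I2"
    proof -
      have "(LINT x|lebesgue. c * (\<eta>2 (W t x) * (Wx t x)\<^sup>2)) \<le> I2"
        unfolding I2_def
      proof (rule integral_mono)
        fix x
        have "c * (Wx t x)\<^sup>2 \<le> (\<sigma> (V t x) - \<sigma> (\<phi>x t x)) * Wx t x"
          using c(2)[OF bV, of x x] by (simp add: Wx_def)
        then have "\<eta>2 (W t x) * (c * (Wx t x)\<^sup>2) \<le> \<eta>2 (W t x) * ((\<sigma> (V t x) - \<sigma> (\<phi>x t x)) * Wx t x)"
          using \<eta> by (intro mult_left_mono) (auto simp: entropy_def)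
        then show "c * (\<eta>2 (W t x) * (Wx t x)\<^sup>2) \<le> (\<sigma> (V t x) - \<sigma> (\<phi>x t x)) * ?g x"
          by (simp add: mult_ac)
      qed (use eL(4) i(2) in auto)
      then show ?thesis by simp
    qed
    moreover have "\<bar>I3\<bar> \<le> C * m / (1 + t)" unfolding I3_def by (rule stress[rule_format, OF \<eta> t0]) (use m in blast)
    ultimately have "D \<le> C * m / (1 + t) - c * (LINT x|lebesgue. \<eta>2 (W t x) * (Wx t x)\<^sup>2)" by linarith
    moreover have "((\<lambda>s. LINT x|lebesgue. \<eta> (W s x)) has_real_derivative D) (at t)"
      using energy_derivative[OF \<eta> t0] t by (simp add: at_within_nonneg D_def w'_def)
    ultimately show ?thesis by blast
  qed
  show ?thesis
    by (rule exI[of _ c], intro conjI c(1), rule exI[of _ C], intro conjI C allI impI, rule main) assumption+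
qed

lemma energy_continuous:
  assumes "entropy \<eta> \<eta>1 \<eta>2" shows "continuous_on {0..T} (\<lambda>s. LINT x|lebesgue. \<eta> (W s x))"
proof (rule DERIV_continuous_on)
  fix t :: real assume "t \<in> {0..T}"
  then show "((\<lambda>s. LINT x|lebesgue. \<eta> (W s x)) has_real_derivative (LINT x|lebesgue. \<eta>1 (W t x) * (ut t x - \<phi>t t x)))
     (at t within {0..T})"
    by (intro has_field_derivative_subset[OF energy_derivative[OF assms]]) auto
qed

end

text \<open>A smooth convex approximation of the absolute value, with slope at most one.\<close>

lemma entropy_abs:
  assumes d: "d > 0"
  shows "entropy (\<lambda>x. sqrt (x\<^sup>2 + d\<^sup>2) - d) (\<lambda>x. x / sqrt (x\<^sup>2 + d\<^sup>2)) (\<lambda>x. d\<^sup>2 / (sqrt (x\<^sup>2 + d\<^sup>2)) ^ 3)"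
proof -
  have p: "x\<^sup>2 + d\<^sup>2 > 0" for x using d by (simp add: add_nonneg_pos)
  have r: "((\<lambda>x. sqrt (x\<^sup>2 + d\<^sup>2)) has_real_derivative x / sqrt (x\<^sup>2 + d\<^sup>2)) (at x)" for x
    using p[of x] by (auto intro!: derivative_eq_intros simp: field_simps)
  have 1: "((\<lambda>x. sqrt (x\<^sup>2 + d\<^sup>2) - d) has_real_derivative x / sqrt (x\<^sup>2 + d\<^sup>2)) (at x)" for x
    using DERIV_diff[OF r DERIV_const] by simp
  have 2: "((\<lambda>x. x / sqrt (x\<^sup>2 + d\<^sup>2)) has_real_derivative d\<^sup>2 / (sqrt (x\<^sup>2 + d\<^sup>2)) ^ 3) (at x)" for x
  proof -
    define s where "s = sqrt (x\<^sup>2 + d\<^sup>2)"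
    have s: "s > 0" "s\<^sup>2 = x\<^sup>2 + d\<^sup>2" using p[of x] by (auto simp: s_def)
    have "(1 * s - x * (x / s)) / (s * s) = d\<^sup>2 / s ^ 3"
    proof -
      have "(1 * s - x * (x / s)) / (s * s) = (s\<^sup>2 - x\<^sup>2) / s ^ 3"
        using s(1) by (simp add: field_simps power2_eq_square power3_eq_cube)
      then show ?thesis by (simp add: s(2))
    qed
    then show ?thesis
      by (intro DERIV_cong[OF DERIV_divide[OF DERIV_ident r]]) (use s(1) in \<open>simp_all only: s_def[symmetric] less_imp_neq[symmetric] not_False_eq_True\<close>)
  qed
  have "continuous_on UNIV (\<lambda>x. d\<^sup>2 / (sqrt (x\<^sup>2 + d\<^sup>2)) ^ 3)"
    using p by (intro continuous_intros) (auto simp: less_imp_neq[symmetric])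
  then show ?thesis unfolding entropy_def using 1 2 p d by (auto simp: less_imp_le)
qed

lemma smooth_abs_bounds:
  assumes "d > 0"
  shows "0 \<le> sqrt (x\<^sup>2 + d\<^sup>2) - d" "sqrt (x\<^sup>2 + d\<^sup>2) - d \<le> \<bar>x\<bar>" "\<bar>x\<bar> \<le> sqrt (x\<^sup>2 + d\<^sup>2) - d + d"
    "\<bar>x / sqrt (x\<^sup>2 + d\<^sup>2)\<bar> \<le> 1"
proof -
  show "0 \<le> sqrt (x\<^sup>2 + d\<^sup>2) - d" using assms by (simp add: real_le_rsqrt)
  show "sqrt (x\<^sup>2 + d\<^sup>2) - d \<le> \<bar>x\<bar>" using sqrt_sum_squares_le_sum_abs[of x d] assms by simp
  show 1: "\<bar>x\<bar> \<le> sqrt (x\<^sup>2 + d\<^sup>2) - d + d" by (simp add: real_le_rsqrt)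
  have "sqrt (x\<^sup>2 + d\<^sup>2) > 0" using assms by (simp add: add_nonneg_pos)
  then show "\<bar>x / sqrt (x\<^sup>2 + d\<^sup>2)\<bar> \<le> 1" using 1 by (simp add: abs_divide)
qed

lemma smooth_abs_antimono:
  assumes "0 \<le> e" "e \<le> (d::real)"
  shows "sqrt (x\<^sup>2 + d\<^sup>2) - d \<le> sqrt (x\<^sup>2 + e\<^sup>2) - e"
proof -
  define s where "s = sqrt (x\<^sup>2 + e\<^sup>2)"
  have s: "e \<le> s" "s\<^sup>2 = x\<^sup>2 + e\<^sup>2" using assms by (auto simp: s_def real_le_rsqrt)
  have "x\<^sup>2 + d\<^sup>2 \<le> (s + (d - e))\<^sup>2"
  proof -
    have "e * (d - e) \<le> s * (d - e)" using s(1) assms by (intro mult_right_mono) auto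
    then show ?thesis using s(2) by (simp add: power2_eq_square algebra_simps)
  qed
  then have "sqrt (x\<^sup>2 + d\<^sup>2) \<le> s + (d - e)" using s(1) assms by (intro real_le_lsqrt) auto
  then show ?thesis by (simp add: s_def)
qed

context viscous_solution begin

text \<open>For the approximations of \<open>|w|\<close> the work of the wave is at most \<open>C / (1 + t)\<close>, whose integral is
  \<open>C ln (1 + t)\<close>, independently of the approximation.  They increase to \<open>|w|\<close>.\<close>

lemma L1_growth:
  assumes W0: "integrable lebesgue (W 0)"
  shows "\<exists>A\<ge>1. \<forall>t\<ge>0. integrable lebesgue (W t) \<and> (LINT x|lebesgue. \<bar>W t x\<bar>) \<le> A * (1 + ln (1 + t))"
proof -
  obtain c C where c: "c > 0" "C > 0" and diss: "\<forall>\<eta> \<eta>1 \<eta>2 t m. entropy \<eta> \<eta>1 \<eta>2 \<longrightarrow> t > 0 \<longrightarrow> (\<forall>x. \<bar>\<eta>1 (W t x)\<bar> \<le> m) \<longrightarrow>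
     (\<exists>D. ((\<lambda>s. LINT x|lebesgue. \<eta> (W s x)) has_real_derivative D) (at t) \<and>
        D \<le> C * m / (1 + t) - c * (LINT x|lebesgue. \<eta>2 (W t x) * (Wx t x)\<^sup>2))"
    using energy_dissipation by (elim exE conjE) (rule that)
  define N where "N = (LINT x|lebesgue. \<bar>W 0 x\<bar>)"
  have N0: "N \<ge> 0" by (simp add: N_def)
  define e where "e d x = sqrt (x\<^sup>2 + d\<^sup>2) - d" for d x :: real
  have main: "(LINT x|lebesgue. e d (W T x)) \<le> N + C * ln (1 + T)" if d: "d > 0" and T: "T \<ge> 0" for d T
  proof -
    note \<eta> = entropy_abs[OF d, folded e_def]
    define E where "E t = (LINT x|lebesgue. e d (W t x))" for t
    have "E T - C * ln (1 + T) \<le> E 0 - C * ln (1 + 0)"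
    proof (rule DERIV_nonpos_imp_decreasing_open[OF T])
      fix t assume t: "0 < t" "t < T"
      obtain D where D: "(E has_real_derivative D) (at t)"
        "D \<le> C * 1 / (1 + t) - c * (LINT x|lebesgue. d\<^sup>2 / (sqrt ((W t x)\<^sup>2 + d\<^sup>2)) ^ 3 * (Wx t x)\<^sup>2)"
        using diss[rule_format, OF \<eta> t(1), of 1] smooth_abs_bounds(4)[OF d] unfolding E_def by blast
      have "0 \<le> (LINT x|lebesgue. d\<^sup>2 / (sqrt ((W t x)\<^sup>2 + d\<^sup>2)) ^ 3 * (Wx t x)\<^sup>2)"
        by (intro Bochner_Integration.integral_nonneg) simp
      then have "0 \<le> c * (LINT x|lebesgue. d\<^sup>2 / (sqrt ((W t x)\<^sup>2 + d\<^sup>2)) ^ 3 * (Wx t x)\<^sup>2)"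
        using c(1) by (intro mult_nonneg_nonneg) auto
      then have "D - C / (1 + t) \<le> 0" using D(2) by simp
      moreover have "((\<lambda>t. E t - C * ln (1 + t)) has_real_derivative D - C / (1 + t)) (at t)"
        using t D(1) by (auto intro!: derivative_eq_intros)
      ultimately show "\<exists>y. ((\<lambda>t. E t - C * ln (1 + t)) has_real_derivative y) (at t) \<and> y \<le> 0" by blast
    next
      show "continuous_on {0..T} (\<lambda>t. E t - C * ln (1 + t))"
        unfolding E_def by (intro continuous_intros energy_continuous[OF \<eta>]) auto
    qed
    moreover have "E 0 \<le> N"
      unfolding E_def N_def using W0 entropy_comp_Lq2(3)[OF \<eta>, of 0] smooth_abs_bounds(2)[OF d]
      by (intro integral_mono) (auto simp: e_def)
    ultimately show ?thesis by (simp add: E_def)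
  qed
  define A where "A = max 1 (max N C)"
  have "integrable lebesgue (W t) \<and> (LINT x|lebesgue. \<bar>W t x\<bar>) \<le> A * (1 + ln (1 + t))" if t: "t \<ge> 0" for t
  proof -
    \<comment> \<open>The approximations increase as the parameter \<open>1 / (n + 1)\<close> decreases.\<close>
    define X where "X n x = e (1 / real (Suc n)) (W t x)" for n x
    have pos: "1 / real (Suc n) > 0" for n by simp
    have inc: "X n x \<le> X n' x" if "n \<le> n'" for n n' x
      unfolding X_def e_def using that by (intro smooth_abs_antimono) (auto simp: frac_le)
    have Xi: "integrable lebesgue (X n)" for n
      using entropy_comp_Lq2(3)[OF entropy_abs[OF pos] t] by (simp add: X_def[abs_def] e_def)
    have Xb: "(LINT x|lebesgue. X n x) \<le> N + C * ln (1 + t)" for n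
      unfolding X_def by (rule main[OF pos t])
    have "incseq (\<lambda>n. LINT x|lebesgue. X n x)"
      by (intro monoI integral_mono Xi inc)
    then obtain l where l: "(\<lambda>n. LINT x|lebesgue. X n x) \<longlonglongrightarrow> l"
      using Xb incseq_convergent by metis
    have "has_bochner_integral lebesgue (\<lambda>x. \<bar>W t x\<bar>) l"
    proof (rule has_bochner_integral_monotone_convergence[OF Xi _ _ l])
      show "AE x in lebesgue. mono (\<lambda>n. X n x)" using inc by (intro always_eventually) (auto simp: mono_def)
      show "AE x in lebesgue. (\<lambda>n. X n x) \<longlonglongrightarrow> \<bar>W t x\<bar>"
      proof (intro always_eventually allI)
        fix x
        have "(\<lambda>n. e (1 / real (Suc n)) (W t x)) \<longlonglongrightarrow> e 0 (W t x)"
          unfolding e_def by (intro tendsto_intros LIMSEQ_Suc[OF lim_1_over_n])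
        then show "(\<lambda>n. X n x) \<longlonglongrightarrow> \<bar>W t x\<bar>" by (simp add: X_def e_def)
      qed
      show "(\<lambda>x. \<bar>W t x\<bar>) \<in> borel_measurable lebesgue"
        using Lq2_borel[OF W_Lq2[OF t]] by simp
    qed
    then have 1: "integrable lebesgue (\<lambda>x. \<bar>W t x\<bar>)" "(LINT x|lebesgue. \<bar>W t x\<bar>) = l"
      by (auto simp: has_bochner_integral_iff)
    have "l \<le> N + C * ln (1 + t)" using LIMSEQ_le_const2[OF l] Xb by blast
    also have "\<dots> \<le> A * 1 + A * ln (1 + t)"
      using t by (intro add_mono mult_right_mono) (auto simp: A_def)
    finally have "l \<le> A * (1 + ln (1 + t))" by (simp add: distrib_left)
    moreover have "integrable lebesgue (W t)"
      using 1(1) Lq2_borel[OF W_Lq2[OF t]] by (rule integrable_abs_cancel)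
    ultimately show ?thesis using 1(2) by simp
  qed
  then show ?thesis by (intro exI[of _ A]) (auto simp: A_def)
qed

end

section \<open>Decay of the even moments\<close>

text \<open>After the last time at which \<open>r \<le> B\<close>, the function would have to grow while its derivative is
  nonpositive.\<close>

lemma stays_below_barrier:
  fixes r r' :: "real \<Rightarrow> real"
  assumes "T \<ge> 0" "continuous_on {0..T} r" "r 0 \<le> B"
    and d: "\<And>t. 0 < t \<Longrightarrow> t < T \<Longrightarrow> (r has_real_derivative r' t) (at t)"
    and dec: "\<And>t. 0 < t \<Longrightarrow> t < T \<Longrightarrow> r t > B \<Longrightarrow> r' t \<le> 0"
  shows "r T \<le> B"
proof (rule ccontr)
  assume "\<not> r T \<le> B"
  then have rT: "r T > B" by simp
  define Z where "Z = {t \<in> {0..T}. r t \<le> B}"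
  have "closed Z" unfolding Z_def
    using continuous_closed_preimage[OF assms(2) closed_atLeastAtMost, of "{..B}"]
    by (simp add: vimage_def Int_def)
  moreover have "bounded Z" by (rule bounded_subset[of "{0..T}"]) (auto simp: Z_def)
  ultimately have "compact Z" by (simp add: compact_eq_bounded_closed)
  moreover have "0 \<in> Z" using assms by (simp add: Z_def)
  ultimately obtain t0 where t0: "t0 \<in> Z" "\<And>t. t \<in> Z \<Longrightarrow> t \<le> t0"
    using compact_attains_sup[of Z] by auto
  have "r T \<le> r t0"
  proof (rule DERIV_nonpos_imp_decreasing_open[of t0 T])
    show "t0 \<le> T" using t0(1) by (simp add: Z_def)
    show "continuous_on {t0..T} r" by (rule continuous_on_subset[OF assms(2)]) (use t0(1) in \<open>auto simp: Z_def\<close>)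
    fix t assume t: "t0 < t" "t < T"
    then have "t \<notin> Z" using t0(2)[of t] by auto
    then have "r t > B" using t t0(1) by (auto simp: Z_def)
    then show "\<exists>y. (r has_real_derivative y) (at t) \<and> y \<le> 0"
      using d[of t] dec[of t] t t0(1) by (auto simp: Z_def)
  qed
  then show False using rT t0(1) by (simp add: Z_def)
qed

lemma entropy_even_power:
  assumes "m \<ge> 1"
  shows "entropy (\<lambda>x. x ^ (2 * m)) (\<lambda>x. real (2 * m) * x ^ (2 * m - 1))
     (\<lambda>x. real (2 * m) * (real (2 * m - 1) * x ^ (2 * m - 2)))"
proof -
  have e: "even (2 * m - 2)" by simp
  show ?thesis unfolding entropy_def using assms zero_le_even_power[OF e]
    by (auto intro!: derivative_eq_intros continuous_intros mult_nonneg_nonneg simp: numeral_2_eq_2)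
qed

context viscous_solution begin

definition sup_W :: "real \<Rightarrow> real" where "sup_W t = (SUP x. \<bar>W t x\<bar>)"

lemma sup_W_upper: "t \<ge> 0 \<Longrightarrow> \<bar>W t x\<bar> \<le> sup_W t"
  unfolding sup_W_def by (rule cSUP_upper) (auto intro!: bdd_aboveI[of _ W_max] W_bound)

lemma sup_W_least: "(\<And>x. \<bar>W t x\<bar> \<le> b) \<Longrightarrow> sup_W t \<le> b"
  unfolding sup_W_def by (rule cSUP_least) auto

lemma sup_W_nonneg: "t \<ge> 0 \<Longrightarrow> 0 \<le> sup_W t"
  using sup_W_upper[of t 0] by linarith

lemma sup_W_power_least:
  assumes "t \<ge> 0" "n > 0" "\<And>x. \<bar>W t x\<bar> ^ n \<le> Q" shows "sup_W t ^ n \<le> Q"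
proof -
  have Q: "Q \<ge> 0" using assms(3)[of 0] order_trans zero_le_power[OF abs_ge_zero] by blast
  have "sup_W t \<le> root n Q"
  proof (rule sup_W_least)
    fix x
    have "root n (\<bar>W t x\<bar> ^ n) \<le> root n Q" using assms by (intro real_root_le_mono) auto
    then show "\<bar>W t x\<bar> \<le> root n Q" using assms(2) by (simp add: real_root_power_cancel)
  qed
  then have "sup_W t ^ n \<le> root n Q ^ n" using sup_W_nonneg[OF assms(1)] by (intro power_mono)
  then show ?thesis using assms(2) Q by simp
qed

lemma W_power_Lq2:
  assumes "t \<ge> 0" "m \<ge> 1" shows "(\<lambda>x. W t x ^ m) \<in> Lq 2"
proof (rule Lq2_bound[OF W_Lq2[OF assms(1)], where K = "sup_W t ^ (m - 1)"])
  show "(\<lambda>x. W t x ^ m) \<in> borel_measurable lebesgue" using Lq2_borel[OF W_Lq2[OF assms(1)]] by simp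
  have "\<bar>W t x ^ m\<bar> \<le> sup_W t ^ (m - 1) * \<bar>W t x\<bar>" for x
  proof -
    have "\<bar>W t x ^ m\<bar> = \<bar>W t x\<bar> ^ (m - 1) * \<bar>W t x\<bar>"
      using assms(2) by (cases m) (auto simp: power_abs abs_mult)
    then show ?thesis using sup_W_upper[OF assms(1), of x] by (auto intro!: mult_right_mono power_mono)
  qed
  then show "AE x in lebesgue. \<bar>W t x ^ m\<bar> \<le> sup_W t ^ (m - 1) * \<bar>W t x\<bar>" by simp
qed

lemma W_power_Wx_Lq2:
  assumes "t \<ge> 0" shows "(\<lambda>x. W t x ^ m * Wx t x) \<in> Lq 2"
proof (rule Lq2_bounded_mult[OF Wx_Lq2[OF assms], where K = "sup_W t ^ m"])
  show "(\<lambda>x. W t x ^ m) \<in> borel_measurable lebesgue" using Lq2_borel[OF W_Lq2[OF assms(1)]] by simp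
  show "\<bar>W t x ^ m\<bar> \<le> sup_W t ^ m" for x
    using sup_W_upper[OF assms, of x] by (auto simp: power_abs intro!: power_mono)
qed

text \<open>The function \<open>W^(m+1)\<close> is a primitive of \<open>(m+1) W^m W\<^sub>x\<close>.\<close>

lemma sup_W_power_le_integral:
  assumes t: "t \<ge> 0" and m: "m \<ge> 1"
  shows "sup_W t ^ (m + 1) \<le> real (m + 1) * (LINT x|lebesgue. \<bar>W t x ^ m\<bar> * \<bar>Wx t x\<bar>)"
proof (rule sup_W_power_least[OF t])
  fix x
  have P: "is_primitive (\<lambda>x. W t x ^ (m + 1)) (\<lambda>x. real (m + 1) * (W t x ^ m * Wx t x))"
  proof (rule is_primitive_deriv[OF corners(2)])
    show "continuous_on UNIV (\<lambda>x. W t x ^ (m + 1))" using cont_W[OF t] by (intro continuous_intros)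
    show "((\<lambda>x. W t x ^ (m + 1)) has_real_derivative real (m + 1) * (W t x ^ m * Wx t x)) (at x)"
      if "x \<notin> corners t" for x
      using DERIV_power[OF W_has_derivative[OF t that], of "m + 1"] by (simp add: mult_ac)
    have "\<bar>real (m + 1) * (W t x ^ m * Wx t x)\<bar> \<le> real (m + 1) * (sup_W t ^ m * (M + L))" for x
      unfolding abs_mult using sup_W_upper[OF t, of x] Wx_bound[OF t, of x] sup_W_nonneg[OF t]
      by (intro mult_left_mono mult_mono) (auto simp: power_abs intro!: power_mono)
    then show "\<exists>B. \<forall>x. \<bar>x\<bar> \<le> r \<longrightarrow> \<bar>real (m + 1) * (W t x ^ m * Wx t x)\<bar> \<le> B" for r by blast
  qed
  have "\<bar>W t x ^ (m + 1)\<bar> \<le> (LINT x|lebesgue. \<bar>real (m + 1) * (W t x ^ m * Wx t x)\<bar>)"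
  proof (rule is_primitive_integrable_bound[OF P])
    show "integrable lebesgue (\<lambda>x. W t x ^ (m + 1))"
      using Lq2_mult_integrable[OF W_power_Lq2[OF t m] W_Lq2[OF t]] by (simp add: mult.commute)
    show "integrable lebesgue (\<lambda>x. real (m + 1) * (W t x ^ m * Wx t x))"
      using Lq2_mult_integrable[OF W_power_Lq2[OF t m] Wx_Lq2[OF t]] by simp
  qed
  then show "\<bar>W t x\<bar> ^ (m + 1) \<le> real (m + 1) * (LINT x|lebesgue. \<bar>W t x ^ m\<bar> * \<bar>Wx t x\<bar>)"
    by (simp add: power_abs abs_mult)
qed simp

lemma sup_by_moment_and_gradient:
  assumes t: "t \<ge> 0" and m: "m \<ge> 1"
  shows "sup_W t ^ (2 * m + 2) \<le> (real (m + 1))\<^sup>2 * (LINT x|lebesgue. W t x ^ (2 * m)) * (LINT x|lebesgue. (Wx t x)\<^sup>2)"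
proof -
  have "2 * m + 2 = (m + 1) * 2" by simp
  then have "sup_W t ^ (2 * m + 2) = (sup_W t ^ (m + 1))\<^sup>2" by (simp only: power_mult)
  also have "\<dots> \<le> (real (m + 1) * (LINT x|lebesgue. \<bar>W t x ^ m\<bar> * \<bar>Wx t x\<bar>))\<^sup>2"
    using sup_W_nonneg[OF t] by (intro power_mono sup_W_power_le_integral t m) auto
  also have "\<dots> = (real (m + 1))\<^sup>2 * (LINT x|lebesgue. \<bar>W t x ^ m\<bar> * \<bar>Wx t x\<bar>)\<^sup>2" by (rule power_mult_distrib)
  also have "\<dots> \<le> (real (m + 1))\<^sup>2 * ((LINT x|lebesgue. (W t x ^ m)\<^sup>2) * (LINT x|lebesgue. (Wx t x)\<^sup>2))"
    by (intro mult_left_mono Lq2_Cauchy_Schwarz_abs W_power_Lq2 Wx_Lq2 t m) auto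
  also have "(LINT x|lebesgue. (W t x ^ m)\<^sup>2) = (LINT x|lebesgue. W t x ^ (2 * m))"
    by (simp add: power_mult[symmetric] mult.commute)
  finally show ?thesis by (simp only: mult.assoc)
qed

text \<open>Split \<open>|W^m W\<^sub>x|\<close> as \<open>|W| |W^(m-1) W\<^sub>x|\<close>, apply the Cauchy-Schwarz inequality, and bound \<open>\<integral>W\<^sup>2\<close> by
  \<open>sup |W|\<close> times the mass; one power of the supremum cancels.\<close>

lemma sup_by_mass_and_dissipation:
  assumes t: "t \<ge> 0" and m: "m \<ge> 1" and i: "integrable lebesgue (W t)"
  shows "sup_W t ^ (2 * m + 1) \<le> (real (m + 1))\<^sup>2 * (LINT x|lebesgue. \<bar>W t x\<bar>) * (LINT x|lebesgue. W t x ^ (2 * m - 2) * (Wx t x)\<^sup>2)"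
    (is "_ \<le> ?c * ?I * ?D")
proof -
  have S0: "sup_W t \<ge> 0" by (rule sup_W_nonneg[OF t])
  have D: "?D = (LINT x|lebesgue. (W t x ^ (m - 1) * Wx t x)\<^sup>2)"
  proof -
    have "2 * m - 2 = (m - 1) * 2" by simp
    then show ?thesis by (simp only: power_mult power_mult_distrib)
  qed
  have D0: "?D \<ge> 0" unfolding D by simp
  have I0: "?I \<ge> 0" by simp
  have sq: "(LINT x|lebesgue. (W t x)\<^sup>2) \<le> sup_W t * ?I"
  proof -
    have "(LINT x|lebesgue. (W t x)\<^sup>2) \<le> (LINT x|lebesgue. sup_W t * \<bar>W t x\<bar>)"
    proof (rule integral_mono)
      fix x show "(W t x)\<^sup>2 \<le> sup_W t * \<bar>W t x\<bar>"
        using mult_right_mono[OF sup_W_upper[OF t, of x], of "\<bar>W t x\<bar>"] by (simp add: power2_eq_square)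
    qed (use i Lq2_square[OF W_Lq2[OF t]] in auto)
    then show ?thesis by simp
  qed
  have "Suc (2 * m + 1) = (m + 1) * 2" by simp
  then have "sup_W t * sup_W t ^ (2 * m + 1) = (sup_W t ^ (m + 1))\<^sup>2" by (simp only: power_Suc[symmetric] power_mult)
  also have "\<dots> \<le> (real (m + 1) * (LINT x|lebesgue. \<bar>W t x ^ m\<bar> * \<bar>Wx t x\<bar>))\<^sup>2"
    using S0 by (intro power_mono sup_W_power_le_integral t m) auto
  also have "\<dots> = ?c * (LINT x|lebesgue. \<bar>W t x ^ m\<bar> * \<bar>Wx t x\<bar>)\<^sup>2" by (rule power_mult_distrib)
  also have "(LINT x|lebesgue. \<bar>W t x ^ m\<bar> * \<bar>Wx t x\<bar>) = (LINT x|lebesgue. \<bar>W t x\<bar> * \<bar>W t x ^ (m - 1) * Wx t x\<bar>)"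
    using m by (cases m) (auto simp: abs_mult mult.assoc)
  also have "?c * (LINT x|lebesgue. \<bar>W t x\<bar> * \<bar>W t x ^ (m - 1) * Wx t x\<bar>)\<^sup>2 \<le> ?c * ((LINT x|lebesgue. (W t x)\<^sup>2) * ?D)"
    unfolding D by (intro mult_left_mono Lq2_Cauchy_Schwarz_abs W_Lq2 W_power_Wx_Lq2 t) auto
  also have "\<dots> \<le> ?c * ((sup_W t * ?I) * ?D)"
    by (intro mult_left_mono mult_right_mono sq D0) auto
  finally have le: "sup_W t * sup_W t ^ (2 * m + 1) \<le> sup_W t * (?c * ?I * ?D)" by (simp add: mult_ac)
  show ?thesis
  proof (cases "sup_W t = 0")
    case True
    then show ?thesis using I0 D0 by simp
  next
    case False
    then have "sup_W t > 0" using S0 by simp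
    then show ?thesis using le by (simp only: mult_le_cancel_left_pos)
  qed
qed

text \<open>Let \<open>y\<close> be the moment, \<open>s = sup |W|\<close> and let \<open>a\<close> bound the mass up to the final time \<open>T\<close>.  Then
  \<open>y \<le> a s^(2m-1)\<close>, the dissipation is at least a multiple of \<open>s^(2m+1) / a\<close>, and the work of the wave is at
  most a multiple of \<open>s^(2m-1) / (1 + t)\<close>.  If \<open>(1 + t)^(m-1/2) y\<close> exceeds the barrier \<open>\<kappa>^(2m-1) a^(2m)\<close>, then
  \<open>s\<^sup>2 (1 + t) \<ge> \<kappa>\<^sup>2 a\<^sup>2\<close>, and for large \<open>\<kappa>\<close> the dissipation outweighs both the work and the growth of the
  weight \<open>(1 + t)^(m-1/2)\<close>.  The bound \<open>a\<close> is kept fixed on \<open>[0, T]\<close>, so it need not be differentiated.\<close>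

lemma even_moment_decay:
  assumes m: "m \<ge> 1" and A: "A \<ge> 1"
    and mass: "\<And>t. t \<ge> 0 \<Longrightarrow> integrable lebesgue (W t)"
      "\<And>t. t \<ge> 0 \<Longrightarrow> (LINT x|lebesgue. \<bar>W t x\<bar>) \<le> A * (1 + ln (1 + t))"
  shows "\<exists>K\<ge>0. \<forall>t\<ge>0. (LINT x|lebesgue. W t x ^ (2 * m))
     \<le> K * (A * (1 + ln (1 + t))) ^ (2 * m) * (1 + t) powr (1 / 2 - real m)"
proof -
  note \<eta> = entropy_even_power[OF m]
  obtain c C where c: "c > 0" and C: "C > 0" and diss: "\<forall>\<eta> \<eta>1 \<eta>2 t m. entropy \<eta> \<eta>1 \<eta>2 \<longrightarrow> t > 0 \<longrightarrow> (\<forall>x. \<bar>\<eta>1 (W t x)\<bar> \<le> m) \<longrightarrow>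
     (\<exists>D. ((\<lambda>s. LINT x|lebesgue. \<eta> (W s x)) has_real_derivative D) (at t) \<and>
        D \<le> C * m / (1 + t) - c * (LINT x|lebesgue. \<eta>2 (W t x) * (Wx t x)\<^sup>2))"
    using energy_dissipation by (elim exE conjE) (rule that)
  define y where "y t = (LINT x|lebesgue. W t x ^ (2 * m))" for t
  define D where "D t = (LINT x|lebesgue. W t x ^ (2 * m - 2) * (Wx t x)\<^sup>2)" for t
  define c1 where "c1 = c * (real (2 * m) * real (2 * m - 1)) / (real (m + 1))\<^sup>2"
  have c1: "c1 > 0" using c m by (simp add: c1_def)
  define C1 where "C1 = C * real (2 * m)"
  have C1: "C1 > 0" using C m by (simp add: C1_def)
  \<comment> \<open>The entries of the maximum make the barrier hold at time zero and make the dissipation win above it.\<close>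
  define \<kappa> where "\<kappa> = max 1 (max (y 0) ((C1 + real m) / c1))"
  have \<kappa>: "\<kappa> \<ge> 1" "y 0 \<le> \<kappa>" "(C1 + real m) / c1 \<le> \<kappa>" by (auto simp: \<kappa>_def)
  have \<kappa>sq: "C1 + real m \<le> c1 * \<kappa>\<^sup>2"
  proof -
    have "C1 + real m \<le> c1 * \<kappa>" using \<kappa>(3) c1 by (simp add: field_simps)
    also have "\<dots> \<le> c1 * \<kappa>\<^sup>2" using \<kappa>(1) c1 by (intro mult_left_mono) (auto simp: power2_eq_square)
    finally show ?thesis .
  qed
  define K where "K = \<kappa> ^ (2 * m - 1)"
  have K: "K \<ge> \<kappa>" using \<kappa>(1) m by (simp add: K_def self_le_power)
  have y0: "y t \<ge> 0" for t unfolding y_def by (intro Bochner_Integration.integral_nonneg) (simp add: power_mult)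
  have "\<exists>y'. (y has_real_derivative y') (at t) \<and>
     y' \<le> C1 * sup_W t ^ (2 * m - 1) / (1 + t) - c * (real (2 * m) * real (2 * m - 1)) * D t" if t: "t > 0" for t
  proof -
    have "\<bar>real (2 * m) * W t x ^ (2 * m - 1)\<bar> \<le> real (2 * m) * sup_W t ^ (2 * m - 1)" for x
      using sup_W_upper[of t x] t by (auto simp: abs_mult power_abs intro!: mult_left_mono power_mono)
    then obtain y' where y': "(y has_real_derivative y') (at t)"
      "y' \<le> C * (real (2 * m) * sup_W t ^ (2 * m - 1)) / (1 + t)
         - c * (LINT x|lebesgue. real (2 * m) * (real (2 * m - 1) * W t x ^ (2 * m - 2)) * (Wx t x)\<^sup>2)"
      using diss[rule_format, OF \<eta> t] unfolding y_def by blast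
    have "(LINT x|lebesgue. real (2 * m) * (real (2 * m - 1) * W t x ^ (2 * m - 2)) * (Wx t x)\<^sup>2)
        = real (2 * m) * real (2 * m - 1) * D t"
      unfolding D_def by (simp only: mult.assoc integral_mult_right_zero)
    with y' show ?thesis by (auto simp: C1_def mult.assoc)
  qed
  then obtain y' where y': "\<And>t. t > 0 \<Longrightarrow> (y has_real_derivative y' t) (at t)"
    "\<And>t. t > 0 \<Longrightarrow> y' t \<le> C1 * sup_W t ^ (2 * m - 1) / (1 + t) - c * (real (2 * m) * real (2 * m - 1)) * D t"
    by metis
  have "y T \<le> K * (A * (1 + ln (1 + T))) ^ (2 * m) * (1 + T) powr (1 / 2 - real m)" if T: "T \<ge> 0" for T
  proof -
    \<comment> \<open>The bound of the mass at the final time bounds the mass at all earlier times.\<close>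
    define a where "a = A * (1 + ln (1 + T))"
    have a: "a \<ge> 1"
      using mult_mono[of 1 A 1 "1 + ln (1 + T)"] A T by (simp add: a_def)
    define b where "b = real m - 1 / 2"
    have b: "b > 0" "b \<le> real m" using m by (auto simp: b_def)
    define r where "r t = y t * (1 + t) powr b" for t
    define r' where "r' t = y' t * (1 + t) powr b + y t * (b * (1 + t) powr (b - 1))" for t
    have "r T \<le> K * a ^ (2 * m)"
    proof (rule stays_below_barrier[OF T])
      show "continuous_on {0..T} r"
        unfolding r_def y_def by (intro continuous_intros energy_continuous[OF \<eta>]) auto
      have "r 0 \<le> K * 1" using \<kappa> K by (simp add: r_def)
      also have "\<dots> \<le> K * a ^ (2 * m)"
        using K \<kappa>(1) a by (intro mult_left_mono one_le_power) auto
      finally show "r 0 \<le> K * a ^ (2 * m)" .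
      fix t assume t: "0 < t" "t < T"
      note t0 = less_imp_le[OF t(1)]
      show "(r has_real_derivative r' t) (at t)"
        unfolding r_def[abs_def] r'_def using t y'(1)[OF t(1)]
        by (auto intro!: derivative_eq_intros has_real_derivative_powr[THEN DERIV_chain2] simp: algebra_simps)
      assume big: "K * a ^ (2 * m) < r t"
      define s where "s = sup_W t"
      have s0: "s \<ge> 0" using sup_W_nonneg[OF t0] by (simp add: s_def)
      have mass_t: "(LINT x|lebesgue. \<bar>W t x\<bar>) \<le> a"
      proof -
        have "A * (1 + ln (1 + t)) \<le> a" unfolding a_def using A t by (intro mult_left_mono) auto
        then show ?thesis using mass(2)[OF t0] by linarith
      qed
      have y_le: "y t \<le> s ^ (2 * m - 1) * a"
      proof -
        have "y t \<le> (LINT x|lebesgue. s ^ (2 * m - 1) * \<bar>W t x\<bar>)"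
          unfolding y_def
        proof (rule integral_mono)
          show "integrable lebesgue (\<lambda>x. W t x ^ (2 * m))" using entropy_comp_Lq2(3)[OF \<eta> t0] .
          show "integrable lebesgue (\<lambda>x. s ^ (2 * m - 1) * \<bar>W t x\<bar>)" using mass(1)[OF t0] by simp
          fix x
          have "W t x ^ (2 * m) = \<bar>W t x\<bar> ^ (2 * m)" by (simp add: power_even_abs)
          also have "\<dots> = \<bar>W t x\<bar> ^ (2 * m - 1) * \<bar>W t x\<bar>" using m by (cases m) auto
          also have "\<dots> \<le> s ^ (2 * m - 1) * \<bar>W t x\<bar>"
            unfolding s_def using sup_W_upper[OF t0, of x] by (intro mult_right_mono power_mono) auto
          finally show "W t x ^ (2 * m) \<le> s ^ (2 * m - 1) * \<bar>W t x\<bar>" .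
        qed
        also have "\<dots> \<le> s ^ (2 * m - 1) * a" using mass_t s0 by (simp add: mult_left_mono)
        finally show ?thesis .
      qed
      define \<tau> where "\<tau> = 1 + t"
      have \<tau>: "\<tau> \<ge> 1" using t by (simp add: \<tau>_def)
      have sbig: "\<kappa>\<^sup>2 * a\<^sup>2 \<le> s\<^sup>2 * \<tau>"
      proof -
        have "K * a ^ (2 * m) < s ^ (2 * m - 1) * a * \<tau> powr b"
          using big mult_right_mono[OF y_le, of "\<tau> powr b"] by (simp add: r_def \<tau>_def)
        moreover have "a ^ (2 * m) = a ^ (2 * m - 1) * a" using m by (cases m) auto
        ultimately have "(K * a ^ (2 * m - 1)) * a < (s ^ (2 * m - 1) * \<tau> powr b) * a" by (simp add: mult_ac)
        then have "K * a ^ (2 * m - 1) < s ^ (2 * m - 1) * \<tau> powr b" using a by (simp add: mult_less_cancel_right)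
        also have "\<tau> powr b = sqrt \<tau> ^ (2 * m - 1)"
        proof -
          have "sqrt \<tau> ^ (2 * m - 1) = (\<tau> powr (1 / 2)) powr real (2 * m - 1)"
            using \<tau> by (simp add: powr_half_sqrt powr_realpow)
          also have "\<dots> = \<tau> powr b" using m by (simp add: powr_powr b_def of_nat_diff field_simps)
          finally show ?thesis by simp
        qed
        finally have "(\<kappa> * a) ^ (2 * m - 1) < (s * sqrt \<tau>) ^ (2 * m - 1)"
          by (simp add: K_def power_mult_distrib)
        then have "\<kappa> * a < s * sqrt \<tau>"
          by (rule power_less_imp_less_base) (use s0 \<tau> in auto)
        then have "(\<kappa> * a)\<^sup>2 \<le> (s * sqrt \<tau>)\<^sup>2" using \<kappa>(1) a by (intro power_mono) auto
        then show ?thesis using \<tau> by (simp add: power_mult_distrib)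
      qed
      have D0: "D t \<ge> 0" unfolding D_def by (intro Bochner_Integration.integral_nonneg mult_nonneg_nonneg zero_le_even_power) auto
      have Dlow: "s ^ (2 * m + 1) \<le> (real (m + 1))\<^sup>2 * a * D t"
      proof -
        have "s ^ (2 * m + 1) \<le> (real (m + 1))\<^sup>2 * (LINT x|lebesgue. \<bar>W t x\<bar>) * D t"
          unfolding s_def D_def by (rule sup_by_mass_and_dissipation[OF t0 m mass(1)[OF t0]])
        also have "\<dots> \<le> (real (m + 1))\<^sup>2 * a * D t"
          using mass_t D0 by (intro mult_right_mono mult_left_mono) auto
        finally show ?thesis .
      qed
      have diss_low: "c1 * s ^ (2 * m + 1) / a \<le> c * (real (2 * m) * real (2 * m - 1)) * D t"
      proof -
        have "c1 * s ^ (2 * m + 1) \<le> c1 * ((real (m + 1))\<^sup>2 * a * D t)"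
          using Dlow c1 by (intro mult_left_mono) auto
        also have "\<dots> = c * (real (2 * m) * real (2 * m - 1)) * D t * a"
          by (simp add: c1_def)
        finally show ?thesis using a by (simp add: pos_divide_le_eq)
      qed
      have key: "C1 + b * a - c1 * (s\<^sup>2 * \<tau>) / a \<le> 0"
      proof -
        have "c1 * \<kappa>\<^sup>2 * a = c1 * (\<kappa>\<^sup>2 * a\<^sup>2) / a" using a by (simp add: power2_eq_square)
        also have "\<dots> \<le> c1 * (s\<^sup>2 * \<tau>) / a" using sbig c1 a by (intro divide_right_mono mult_left_mono) auto
        finally have 1: "c1 * \<kappa>\<^sup>2 * a \<le> c1 * (s\<^sup>2 * \<tau>) / a" .
        have "(C1 + real m) * a \<le> c1 * \<kappa>\<^sup>2 * a" using \<kappa>sq a by (intro mult_right_mono) auto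
        moreover have "C1 * 1 \<le> C1 * a" "b * a \<le> real m * a" using a b C1 by (auto intro!: mult_left_mono mult_right_mono)
        ultimately show ?thesis using 1 by (simp add: distrib_right)
      qed
      have "r' t = \<tau> powr (b - 1) * (y' t * \<tau> + b * y t)"
      proof -
        have "\<tau> powr b = \<tau> powr (b - 1) * \<tau>" using \<tau> by (simp add: powr_diff)
        then show ?thesis by (simp add: r'_def \<tau>_def algebra_simps)
      qed
      also have "\<dots> \<le> 0"
      proof (rule mult_nonneg_nonpos)
        have "y' t \<le> C1 * s ^ (2 * m - 1) / \<tau> - c1 * s ^ (2 * m + 1) / a"
          using y'(2)[OF t(1)] diss_low by (simp add: s_def \<tau>_def)
        then have "y' t * \<tau> \<le> (C1 * s ^ (2 * m - 1) / \<tau> - c1 * s ^ (2 * m + 1) / a) * \<tau>"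
          using \<tau> by (intro mult_right_mono) auto
        also have "\<dots> = s ^ (2 * m - 1) * (C1 - c1 * (s\<^sup>2 * \<tau>) / a)"
        proof -
          have "s ^ (2 * m + 1) = s ^ (2 * m - 1) * s\<^sup>2" using m by (simp flip: power_add)
          then show ?thesis using \<tau> by (simp add: algebra_simps)
        qed
        finally have "y' t * \<tau> + b * y t \<le> s ^ (2 * m - 1) * (C1 - c1 * (s\<^sup>2 * \<tau>) / a) + b * (s ^ (2 * m - 1) * a)"
          using y_le b by (intro add_mono mult_left_mono) auto
        also have "\<dots> = s ^ (2 * m - 1) * (C1 + b * a - c1 * (s\<^sup>2 * \<tau>) / a)" by (simp add: algebra_simps)
        also have "\<dots> \<le> 0" using key s0 by (intro mult_nonneg_nonpos) auto
        finally show "y' t * \<tau> + b * y t \<le> 0" .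
      qed simp
      finally show "r' t \<le> 0" .
    qed
    then have "y T * (1 + T) powr b * (1 + T) powr (- b) \<le> K * a ^ (2 * m) * (1 + T) powr (- b)"
      unfolding r_def by (intro mult_right_mono) auto
    moreover have "(1 + T) powr b * (1 + T) powr (- b) = 1" using T by (simp add: powr_minus)
    ultimately show ?thesis by (simp add: a_def b_def mult.assoc)
  qed
  then show ?thesis using K \<kappa>(1) unfolding y_def by (intro exI[of _ K]) auto
qed

end

section \<open>Estimates of the distance to the rarefaction wave\<close>

context convex_flux begin

text \<open>The rarefaction wave itself, expressed by its profile.\<close>

definition \<rho> :: "real \<Rightarrow> real \<Rightarrow> real" where
  "\<rho> t x = (if t = 0 then riemann_data um up x else fan (x / t))"

definition \<delta> :: "real \<Rightarrow> real \<Rightarrow> real" where "\<delta> t x = \<phi> t x - \<rho> t x"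

definition \<delta>_const :: real where "\<delta>_const = 2 * L * \<Lambda> + 4 * (\<bar>um\<bar> + \<bar>up\<bar>)"

lemma \<delta>_const_nonneg: "\<delta>_const \<ge> 0"
  using L(1) \<Lambda>_nonneg by (simp add: \<delta>_const_def)

lemma \<rho>_rarefaction: "deriv f = f1 \<Longrightarrow> t \<ge> 0 \<Longrightarrow> rarefaction f um up t x = \<rho> t x"
  using fan_left[of "x / t"] fan_right[of "x / t"]
  by (cases "t = 0") (auto simp: rarefaction_def \<rho>_def field_simps fan_def clamp_def)

lemma \<rho>_bound: "\<bar>\<rho> t x\<bar> \<le> \<bar>um\<bar> + \<bar>up\<bar>"
  using fan_range[of "x / t"] by (auto simp: \<rho>_def riemann_data_def)

lemma \<delta>_borel: "t \<ge> 0 \<Longrightarrow> \<delta> t \<in> borel_measurable lebesgue"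
proof -
  assume t: "t \<ge> 0"
  have "\<rho> t \<in> borel_measurable lebesgue"
  proof (cases "t = 0")
    case True then show ?thesis using borel_imp_lebesgue[OF riemann_data_borel] by (simp add: \<rho>_def[abs_def])
  next
    case False
    then have "continuous_on UNIV (\<rho> t)"
      unfolding \<rho>_def by (auto intro!: continuous_on_compose2[OF fan_continuous] continuous_intros)
    then show ?thesis by (rule continuous_imp_lebesgue)
  qed
  then show ?thesis unfolding \<delta>_def[abs_def]
    by (intro borel_measurable_diff continuous_imp_lebesgue[OF \<phi>_continuous[OF t]])
qed

lemma \<delta>_outside: "t \<ge> 0 \<Longrightarrow> \<bar>x\<bar> > \<Lambda> * (1 + t) \<Longrightarrow> \<delta> t x = 0"
proof -
  assume t: "t \<ge> 0" and x: "\<bar>x\<bar> > \<Lambda> * (1 + t)"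
  have "\<rho> t x = riemann_data um up x"
  proof (cases "t = 0")
    case False
    have "\<Lambda> * t \<le> \<Lambda> * (1 + t)" using \<Lambda>_nonneg by (intro mult_left_mono) auto
    then have "\<Lambda> < \<bar>x / t\<bar>" using x t False by (simp add: abs_divide field_simps)
    then show ?thesis using fan_outside(1) False t by (auto simp: \<rho>_def riemann_data_def divide_less_0_iff)
  qed (simp add: \<rho>_def)
  then show ?thesis using \<phi>_outside[OF t x] by (simp add: \<delta>_def)
qed

text \<open>For \<open>t \<ge> 1\<close> the arguments \<open>x / (1 + t)\<close> and \<open>x / t\<close> of the profile differ by \<open>x / (t (1 + t))\<close>, and \<open>|x|\<close> is at most
  \<open>\<Lambda> (1 + t)\<close> where the waves differ.  For \<open>t < 1\<close> boundedness suffices.\<close>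

lemma \<delta>_bound:
  assumes t: "t \<ge> 0" shows "\<bar>\<delta> t x\<bar> \<le> \<delta>_const / (1 + t)"
proof (cases "\<bar>x\<bar> > \<Lambda> * (1 + t)")
  case True then show ?thesis using \<delta>_outside[OF t True] \<delta>_const_nonneg t by simp
next
  case False
  show ?thesis
  proof (cases "t < 1")
    case True
    have "\<bar>\<delta> t x\<bar> \<le> 2 * (\<bar>um\<bar> + \<bar>up\<bar>)" using \<rho>_bound[of t x] \<phi>_range(3)[of t x] by (simp add: \<delta>_def)
    then have "\<bar>\<delta> t x\<bar> * (1 + t) \<le> 2 * (\<bar>um\<bar> + \<bar>up\<bar>) * 2" using True t by (intro mult_mono) auto
    also have "\<dots> \<le> \<delta>_const" using L(1) \<Lambda>_nonneg by (simp add: \<delta>_const_def)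
    finally show ?thesis using t by (simp add: field_simps)
  next
    case t1: False
    have "\<bar>\<delta> t x\<bar> \<le> L * \<bar>x / (1 + t) - x / t\<bar>"
      using fan_lipschitz[of "x / (1 + t)" "x / t"] t1 by (simp add: \<delta>_def \<phi>_def \<rho>_def)
    also have "x / (1 + t) - x / t = - (x / (t * (1 + t)))" using t1 by (simp add: field_simps)
    also have "L * \<bar>- (x / (t * (1 + t)))\<bar> = L * \<bar>x\<bar> / t / (1 + t)" using t1 by (simp add: abs_mult abs_divide)
    also have "\<dots> \<le> \<delta>_const / (1 + t)"
    proof (rule divide_right_mono)
      have "L * \<bar>x\<bar> \<le> L * (\<Lambda> * (1 + t))" using False L(1) by (intro mult_left_mono) auto
      also have "\<dots> \<le> L * (\<Lambda> * (2 * t))" using t1 L(1) \<Lambda>_nonneg by (intro mult_left_mono) auto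
      finally have "L * \<bar>x\<bar> / t \<le> 2 * L * \<Lambda>" using t1 by (simp add: field_simps)
      also have "\<dots> \<le> \<delta>_const" by (simp add: \<delta>_const_def)
      finally show "L * \<bar>x\<bar> / t \<le> \<delta>_const" .
    qed (use t in simp)
    finally show ?thesis .
  qed
qed

lemma \<delta>_powr:
  assumes t: "t \<ge> 0" and q: "q \<ge> 1"
  shows "integrable lebesgue (\<lambda>x. \<bar>\<delta> t x\<bar> powr q)"
    "(LINT x|lebesgue. \<bar>\<delta> t x\<bar> powr q) \<le> 2 * \<Lambda> * \<delta>_const powr q * (1 + t) powr (1 - q)"
proof -
  note b = bounded_support_powr[where g = "\<delta> t" and K = "\<delta>_const / (1 + t)" and R = "\<Lambda> * (1 + t)" and q = q,
      OF \<delta>_borel[OF t] \<delta>_bound[OF t] \<delta>_outside[OF t]]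
  show "integrable lebesgue (\<lambda>x. \<bar>\<delta> t x\<bar> powr q)" using b(1) t q \<Lambda>_nonneg by simp
  have "(LINT x|lebesgue. \<bar>\<delta> t x\<bar> powr q) \<le> (\<delta>_const / (1 + t)) powr q * (2 * (\<Lambda> * (1 + t)))"
    using b(2) t q \<Lambda>_nonneg by simp
  also have "\<dots> = 2 * \<Lambda> * \<delta>_const powr q * (1 + t) powr (1 - q)"
    using t \<delta>_const_nonneg by (simp add: powr_divide powr_diff)
  finally show "(LINT x|lebesgue. \<bar>\<delta> t x\<bar> powr q) \<le> 2 * \<Lambda> * \<delta>_const powr q * (1 + t) powr (1 - q)" .
qed

end

lemma one_plus_ln_le_powr:
  fixes t \<epsilon> :: real
  assumes "t \<ge> 0" "\<epsilon> > 0" shows "1 + ln (1 + t) \<le> (1 + 1 / \<epsilon>) * (1 + t) powr \<epsilon>"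
proof -
  have "ln (1 + t) \<le> (1 + t) powr \<epsilon> / \<epsilon>" using assms by (intro ln_powr_bound) auto
  moreover have "1 \<le> (1 + t) powr \<epsilon>" using assms by (intro ge_one_powr_ge_zero) auto
  ultimately show ?thesis using assms by (simp add: distrib_right)
qed

lemma powr_add_le:
  fixes a b q :: real
  assumes "q \<ge> 0" shows "\<bar>a + b\<bar> powr q \<le> 2 powr q * (\<bar>a\<bar> powr q + \<bar>b\<bar> powr q)"
proof -
  have "\<bar>a + b\<bar> powr q \<le> (2 * max \<bar>a\<bar> \<bar>b\<bar>) powr q" using assms by (intro powr_mono2) auto
  also have "\<dots> = 2 powr q * (max \<bar>a\<bar> \<bar>b\<bar>) powr q" by (simp add: powr_mult)
  also have "(max \<bar>a\<bar> \<bar>b\<bar>) powr q \<le> \<bar>a\<bar> powr q + \<bar>b\<bar> powr q" by (simp add: max_def)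
  finally show ?thesis by simp
qed

text \<open>Interpolation between a first and an \<open>n\<close>-th moment with a free height \<open>\<mu>\<close>: the first term alone bounds
  \<open>|x|^q\<close> for \<open>|x| \<le> \<mu>\<close>, and the second one for \<open>|x| \<ge> \<mu>\<close>.\<close>

lemma powr_interpolation:
  fixes x \<mu> q :: real
  assumes "\<mu> > 0" "1 \<le> q" "q \<le> real n" "n > 0"
  shows "\<bar>x\<bar> powr q \<le> \<mu> powr (q - 1) * \<bar>x\<bar> + \<mu> powr (q - real n) * \<bar>x\<bar> ^ n"
proof (cases "x = 0")
  case True then show ?thesis using assms by simp
next
  case False
  then have x: "\<bar>x\<bar> > 0" by simp
  show ?thesis
  proof (cases "\<bar>x\<bar> \<le> \<mu>")
    case True
    have "\<bar>x\<bar> powr q = \<bar>x\<bar> powr (q - 1) * \<bar>x\<bar>" using x by (simp add: powr_diff)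
    also have "\<dots> \<le> \<mu> powr (q - 1) * \<bar>x\<bar>" using True assms by (intro mult_right_mono powr_mono2) auto
    finally show ?thesis using assms by (simp add: add_increasing2)
  next
    case False
    have "\<bar>x\<bar> powr q = \<bar>x\<bar> powr (q - real n) * \<bar>x\<bar> powr real n" using x by (simp add: powr_add[symmetric])
    also have "\<dots> = \<bar>x\<bar> powr (q - real n) * \<bar>x\<bar> ^ n" using x by (simp add: powr_realpow)
    also have "\<dots> \<le> \<mu> powr (q - real n) * \<bar>x\<bar> ^ n"
      using False assms by (intro mult_right_mono powr_mono2') auto
    finally show ?thesis using assms by (simp add: add_increasing)
  qed
qed

context viscous_solution begin

lemma initial_mass:
  assumes "AE x in lebesgue. u 0 x = u0 x" "(\<lambda>x. u0 x - riemann_data um up x) \<in> Lq 1"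
  shows "integrable lebesgue (W 0)"
proof -
  have i0: "integrable lebesgue (\<lambda>x. u0 x - riemann_data um up x)"
    using assms(2) by (auto simp: Lq_def intro: integrable_abs_cancel)
  have i1: "integrable lebesgue (\<delta> 0)"
    using \<delta>_powr(1)[of 0 1] \<delta>_borel[of 0] by (auto intro: integrable_abs_cancel)
  have i: "integrable lebesgue (\<lambda>x. (u0 x - riemann_data um up x) - \<delta> 0 x)"
    using i0 i1 by simp
  show ?thesis
  proof (rule integrable_cong_AE_imp[OF i])
    show "W 0 \<in> borel_measurable lebesgue" by (rule Lq2_borel[OF W_Lq2]) simp
    show "AE x in lebesgue. (u0 x - riemann_data um up x) - \<delta> 0 x = W 0 x"
      using assms(1) sol(1)[of 0, simplified] by eventually_elim (simp add: W_def \<delta>_def \<rho>_def)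
  qed
qed

text \<open>The representative of the difference of the solution and the rarefaction wave.\<close>

definition wave_error :: "real \<Rightarrow> real \<Rightarrow> real" where "wave_error t x = W t x + \<delta> t x"

lemma wave_error_borel: "t \<ge> 0 \<Longrightarrow> wave_error t \<in> borel_measurable lebesgue"
  unfolding wave_error_def[abs_def] by (intro borel_measurable_add \<delta>_borel Lq2_borel[OF W_Lq2])

lemma L1_estimate:
  assumes W0: "integrable lebesgue (W 0)" and \<epsilon>: "\<epsilon> > 0"
  shows "\<exists>C>0. \<forall>t\<ge>0. wave_error t \<in> Lq 1 \<and> Lq_norm 1 (wave_error t) \<le> C * (1 + t) powr \<epsilon>"
proof -
  obtain A where A: "A \<ge> 1" and mass: "\<And>t. t \<ge> 0 \<Longrightarrow> integrable lebesgue (W t)"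
    "\<And>t. t \<ge> 0 \<Longrightarrow> (LINT x|lebesgue. \<bar>W t x\<bar>) \<le> A * (1 + ln (1 + t))"
    using L1_growth[OF W0] by blast
  define B where "B = 2 * \<Lambda> * \<delta>_const"
  have B: "B \<ge> 0" using \<Lambda>_nonneg \<delta>_const_nonneg by (simp add: B_def)
  define C where "C = (A + B) * (1 + 1 / \<epsilon>)"
  have C: "C > 0" using A B \<epsilon> unfolding C_def by (intro mult_pos_pos add_pos_nonneg) auto
  have "wave_error t \<in> Lq 1 \<and> Lq_norm 1 (wave_error t) \<le> C * (1 + t) powr \<epsilon>" if t: "t \<ge> 0" for t
  proof
    have i: "integrable lebesgue (\<lambda>x. \<bar>\<delta> t x\<bar>)" using \<delta>_powr(1)[OF t, of 1] by simp
    then have i\<delta>: "integrable lebesgue (\<delta> t)" using \<delta>_borel[OF t] by (rule integrable_abs_cancel)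
    have iV: "integrable lebesgue (wave_error t)" unfolding wave_error_def[abs_def] using mass(1)[OF t] i\<delta> by simp
    show "wave_error t \<in> Lq 1" using iV wave_error_borel[OF t] by (simp add: Lq_def)
    have "Lq_norm 1 (wave_error t) = (LINT x|lebesgue. \<bar>wave_error t x\<bar>)" by (simp add: Lq_norm_def)
    also have "\<dots> \<le> (LINT x|lebesgue. \<bar>W t x\<bar> + \<bar>\<delta> t x\<bar>)"
    proof (rule integral_mono)
      show "\<bar>wave_error t x\<bar> \<le> \<bar>W t x\<bar> + \<bar>\<delta> t x\<bar>" for x by (simp add: wave_error_def)
    qed (use iV mass(1)[OF t] i in auto)
    also have "\<dots> = (LINT x|lebesgue. \<bar>W t x\<bar>) + (LINT x|lebesgue. \<bar>\<delta> t x\<bar>)"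
      using mass(1)[OF t] i by simp
    also have "\<dots> \<le> A * (1 + ln (1 + t)) + B"
      using mass(2)[OF t] \<delta>_powr(2)[OF t, of 1] \<delta>_const_nonneg t by (intro add_mono) (auto simp: B_def)
    also have "\<dots> \<le> (A + B) * (1 + ln (1 + t))"
      using B t by (simp add: distrib_right distrib_left)
    also have "\<dots> \<le> (A + B) * ((1 + 1 / \<epsilon>) * (1 + t) powr \<epsilon>)"
      using A B one_plus_ln_le_powr[OF t \<epsilon>] by (intro mult_left_mono) auto
    finally show "Lq_norm 1 (wave_error t) \<le> C * (1 + t) powr \<epsilon>" by (simp add: C_def mult.assoc)
  qed
  with C show ?thesis by blast
qed

text \<open>Choose the height \<open>\<mu> = a (1 + t)^(-1/2)\<close> in the interpolation, where \<open>a\<close> is the bound of the mass: this is the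
  typical size of a function of mass \<open>a\<close> that has spread over a distance \<open>(1 + t)^(1/2)\<close>, and it makes
  both terms equal up to constants.\<close>

lemma Lq_estimate:
  assumes W0: "integrable lebesgue (W 0)" and q: "q > 1"
  shows "\<exists>C>0. \<forall>t\<ge>0. wave_error t \<in> Lq q \<and>
     Lq_norm q (wave_error t) \<le> C * (1 + t) powr (- (1 / 2) * (1 - 1 / q)) * max 1 (ln (1 + t))"
proof -
  obtain A where A: "A \<ge> 1" and mass: "\<And>t. t \<ge> 0 \<Longrightarrow> integrable lebesgue (W t)"
    "\<And>t. t \<ge> 0 \<Longrightarrow> (LINT x|lebesgue. \<bar>W t x\<bar>) \<le> A * (1 + ln (1 + t))"
    using L1_growth[OF W0] by blast
  obtain m :: nat where m: "q \<le> real m" using real_arch_simple by blast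
  have m1: "m \<ge> 1" using m q by linarith
  obtain K where K: "K \<ge> 0" and moment: "\<And>t. t \<ge> 0 \<Longrightarrow> (LINT x|lebesgue. W t x ^ (2 * m))
     \<le> K * (A * (1 + ln (1 + t))) ^ (2 * m) * (1 + t) powr (1 / 2 - real m)"
    using even_moment_decay[OF m1 A mass] by blast
  define B where "B = 2 * \<Lambda> * \<delta>_const powr q"
  have B: "B \<ge> 0" using \<Lambda>_nonneg by (simp add: B_def)
  define C0 where "C0 = 2 powr q * (1 + K + B)"
  have C0: "C0 > 0" using K B by (simp add: C0_def add_pos_nonneg)
  define C where "C = C0 powr (1 / q) * (2 * A)"
  have C: "C > 0" using C0 A by (simp add: C_def)
  have "wave_error t \<in> Lq q \<and>
     Lq_norm q (wave_error t) \<le> C * (1 + t) powr (- (1 / 2) * (1 - 1 / q)) * max 1 (ln (1 + t))" if t: "t \<ge> 0" for t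
  proof
    define \<tau> where "\<tau> = 1 + t"
    have \<tau>: "\<tau> \<ge> 1" using t by (simp add: \<tau>_def)
    define a where "a = A * (1 + ln \<tau>)"
    have a: "a \<ge> 1" using mult_mono[of 1 A 1 "1 + ln \<tau>"] A \<tau> by (simp add: a_def)
    define \<mu> where "\<mu> = a * \<tau> powr (- (1 / 2))"
    have \<mu>: "\<mu> > 0" using a \<tau> by (simp add: \<mu>_def)
    have mass_t: "(LINT x|lebesgue. \<bar>W t x\<bar>) \<le> a" using mass(2)[OF t] by (simp add: a_def \<tau>_def)
    have iW2: "integrable lebesgue (\<lambda>x. \<bar>W t x\<bar> ^ (2 * m))"
      using entropy_comp_Lq2(3)[OF entropy_even_power[OF m1] t] by (simp add: power_even_abs)
    have mom_t: "(LINT x|lebesgue. \<bar>W t x\<bar> ^ (2 * m)) \<le> K * a * \<mu> powr (2 * real m - 1)"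
    proof -
      have "\<mu> powr (2 * real m - 1) = a powr (2 * real m - 1) * \<tau> powr (1 / 2 - real m)"
        using a \<tau> by (simp add: \<mu>_def powr_mult powr_powr algebra_simps)
      moreover have "a ^ (2 * m) = a * a powr (2 * real m - 1)"
      proof -
        have "a ^ (2 * m) = a powr (1 + (2 * real m - 1))" using a by (simp add: powr_realpow[symmetric])
        also have "\<dots> = a * a powr (2 * real m - 1)" using a by (simp only: powr_add) simp
        finally show ?thesis .
      qed
      ultimately show ?thesis using moment[OF t] by (simp add: a_def \<tau>_def power_even_abs mult_ac)
    qed
    let ?rhs = "\<lambda>x. \<mu> powr (q - 1) * \<bar>W t x\<bar> + \<mu> powr (q - real (2 * m)) * \<bar>W t x\<bar> ^ (2 * m)"
    have irhs: "integrable lebesgue ?rhs" using mass(1)[OF t] iW2 by simp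
    have le: "\<bar>W t x\<bar> powr q \<le> ?rhs x" for x
      using q m m1 by (intro powr_interpolation \<mu>) auto
    have iWq: "integrable lebesgue (\<lambda>x. \<bar>W t x\<bar> powr q)"
    proof (rule Bochner_Integration.integrable_bound[OF irhs])
      show "(\<lambda>x. \<bar>W t x\<bar> powr q) \<in> borel_measurable lebesgue"
        using Lq2_borel[OF W_Lq2[OF t]] by measurable
      show "AE x in lebesgue. norm (\<bar>W t x\<bar> powr q) \<le> norm (?rhs x)"
        using le by (intro always_eventually allI) (metis abs_ge_self order_trans powr_ge_zero real_norm_def abs_of_nonneg)
    qed
    have Wq: "(LINT x|lebesgue. \<bar>W t x\<bar> powr q) \<le> (1 + K) * (\<mu> powr (q - 1) * a)"
    proof -
      have "(LINT x|lebesgue. \<bar>W t x\<bar> powr q) \<le> (LINT x|lebesgue. ?rhs x)"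
        by (rule integral_mono[OF iWq irhs le])
      also have "\<dots> = \<mu> powr (q - 1) * (LINT x|lebesgue. \<bar>W t x\<bar>)
          + \<mu> powr (q - real (2 * m)) * (LINT x|lebesgue. \<bar>W t x\<bar> ^ (2 * m))"
        using mass(1)[OF t] iW2 by simp
      also have "\<dots> \<le> \<mu> powr (q - 1) * a + \<mu> powr (q - real (2 * m)) * (K * a * \<mu> powr (2 * real m - 1))"
        using mass_t mom_t by (intro add_mono mult_left_mono) auto
      also have "\<mu> powr (q - real (2 * m)) * (K * a * \<mu> powr (2 * real m - 1)) = K * (\<mu> powr (q - 1) * a)"
      proof -
        have "\<mu> powr (q - 1) = \<mu> powr (q - real (2 * m)) * \<mu> powr (2 * real m - 1)"
          using \<mu> by (simp flip: powr_add)
        then show ?thesis by (simp add: mult_ac)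
      qed
      finally show ?thesis by (simp add: distrib_right)
    qed
    have eq\<mu>: "\<mu> powr (q - 1) * a = a powr q * \<tau> powr (- (q - 1) / 2)"
    proof -
      have "a powr q = a powr (q - 1) * a" using a by (simp add: powr_diff)
      moreover have "\<mu> powr (q - 1) = a powr (q - 1) * \<tau> powr (- (q - 1) / 2)"
      proof -
        have "\<mu> powr (q - 1) = a powr (q - 1) * (\<tau> powr (- (1 / 2))) powr (q - 1)"
          using a \<tau> by (simp add: \<mu>_def powr_mult)
        also have "(\<tau> powr (- (1 / 2))) powr (q - 1) = \<tau> powr (- (1 / 2) * (q - 1))" by (rule powr_powr)
        also have "- (1 / 2) * (q - 1) = - (q - 1) / 2" by linarith
        finally show ?thesis .
      qed
      ultimately show ?thesis by simp
    qed
    have \<delta>q: "(LINT x|lebesgue. \<bar>\<delta> t x\<bar> powr q) \<le> B * (a powr q * \<tau> powr (- (q - 1) / 2))"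
    proof -
      have "(LINT x|lebesgue. \<bar>\<delta> t x\<bar> powr q) \<le> B * \<tau> powr (1 - q)"
        using \<delta>_powr(2)[OF t, of q] q by (simp add: B_def \<tau>_def)
      also have "\<dots> \<le> B * (1 * \<tau> powr (- (q - 1) / 2))"
        using B \<tau> q by (intro mult_left_mono) (auto intro!: powr_mono)
      also have "\<dots> \<le> B * (a powr q * \<tau> powr (- (q - 1) / 2))"
        using B a q by (intro mult_left_mono mult_right_mono) (auto intro: ge_one_powr_ge_zero)
      finally show ?thesis .
    qed
    have i\<delta>: "integrable lebesgue (\<lambda>x. \<bar>\<delta> t x\<bar> powr q)" using \<delta>_powr(1)[OF t] q by simp
    let ?sum = "\<lambda>x. 2 powr q * (\<bar>W t x\<bar> powr q + \<bar>\<delta> t x\<bar> powr q)"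
    have isum: "integrable lebesgue ?sum" using iWq i\<delta> by simp
    have lesum: "\<bar>wave_error t x\<bar> powr q \<le> ?sum x" for x
      unfolding wave_error_def using q by (intro powr_add_le) simp
    have iV: "integrable lebesgue (\<lambda>x. \<bar>wave_error t x\<bar> powr q)"
    proof (rule Bochner_Integration.integrable_bound[OF isum])
      show "(\<lambda>x. \<bar>wave_error t x\<bar> powr q) \<in> borel_measurable lebesgue" using wave_error_borel[OF t] by measurable
      show "AE x in lebesgue. norm (\<bar>wave_error t x\<bar> powr q) \<le> norm (?sum x)"
        using lesum by (intro always_eventually allI) (metis abs_ge_self order_trans powr_ge_zero real_norm_def abs_of_nonneg)
    qed
    show "wave_error t \<in> Lq q" using iV wave_error_borel[OF t] by (simp add: Lq_def)
    have "(LINT x|lebesgue. \<bar>wave_error t x\<bar> powr q) \<le> (LINT x|lebesgue. ?sum x)"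
      by (rule integral_mono[OF iV isum lesum])
    also have "\<dots> = 2 powr q * ((LINT x|lebesgue. \<bar>W t x\<bar> powr q) + (LINT x|lebesgue. \<bar>\<delta> t x\<bar> powr q))"
      using iWq i\<delta> by simp
    also have "\<dots> \<le> 2 powr q * ((1 + K) * (a powr q * \<tau> powr (- (q - 1) / 2)) + B * (a powr q * \<tau> powr (- (q - 1) / 2)))"
      using Wq \<delta>q unfolding eq\<mu> by (intro mult_left_mono add_mono) auto
    also have "\<dots> = C0 * (a powr q * \<tau> powr (- (q - 1) / 2))" by (simp add: C0_def algebra_simps)
    finally have "Lq_norm q (wave_error t) \<le> (C0 * (a powr q * \<tau> powr (- (q - 1) / 2))) powr (1 / q)"
      unfolding Lq_norm_def using q by (intro powr_mono2) auto
    also have "\<dots> = C0 powr (1 / q) * (a * \<tau> powr (- (1 / 2) * (1 - 1 / q)))"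
    proof -
      have e: "- (q - 1) / 2 * (1 / q) = - (1 / 2) * (1 - 1 / q)" using q by (simp add: divide_simps)
      have "(C0 * (a powr q * \<tau> powr (- (q - 1) / 2))) powr (1 / q)
         = C0 powr (1 / q) * ((a powr q) powr (1 / q) * (\<tau> powr (- (q - 1) / 2)) powr (1 / q))"
        using C0 by (simp add: powr_mult)
      moreover have "(a powr q) powr (1 / q) = a" using a q by (simp add: powr_powr)
      moreover have "(\<tau> powr (- (q - 1) / 2)) powr (1 / q) = \<tau> powr (- (1 / 2) * (1 - 1 / q))"
        by (simp only: powr_powr e)
      ultimately show ?thesis by simp
    qed
    also have "\<dots> \<le> C0 powr (1 / q) * ((2 * A * max 1 (ln \<tau>)) * \<tau> powr (- (1 / 2) * (1 - 1 / q)))"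
    proof (intro mult_left_mono mult_right_mono)
      have "a \<le> A * (2 * max 1 (ln \<tau>))" unfolding a_def using A by (intro mult_left_mono) auto
      then show "a \<le> 2 * A * max 1 (ln \<tau>)" by (simp add: mult_ac)
    qed auto
    finally show "Lq_norm q (wave_error t) \<le> C * (1 + t) powr (- (1 / 2) * (1 - 1 / q)) * max 1 (ln (1 + t))"
      by (simp add: C_def \<tau>_def mult_ac)
  qed
  with C show ?thesis by blast
qed

lemma Wx_square_bound:
  assumes t: "t \<ge> 0" shows "(LINT x|lebesgue. (Wx t x)\<^sup>2) \<le> 2 * M + 4 * L\<^sup>2 * \<Lambda>"
  using Lq2_square_diff_le[OF sol(6)[OF t] \<phi>x_Lq2(1)[OF t]] sol(7)[OF t] \<phi>x_Lq2(2)[OF t]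
  by (simp add: Wx_def)

text \<open>Combine the decay of the moment of order \<open>2m\<close> with the boundedness of \<open>\<integral>W\<^sub>x\<^sup>2\<close>.  The
  resulting exponent is \<open>-(m - 1/2) / (2m + 2)\<close>, up to logarithms, and approaches \<open>-1/2\<close> as \<open>m\<close> grows.\<close>

lemma Linf_estimate:
  assumes W0: "integrable lebesgue (W 0)" and \<epsilon>: "\<epsilon> > 0"
  shows "\<exists>C>0. \<forall>t\<ge>0. \<forall>x. \<bar>wave_error t x\<bar> \<le> C * (1 + t) powr (- (1 / 2) + \<epsilon>)"
proof -
  obtain A where A: "A \<ge> 1" and mass: "\<And>t. t \<ge> 0 \<Longrightarrow> integrable lebesgue (W t)"
    "\<And>t. t \<ge> 0 \<Longrightarrow> (LINT x|lebesgue. \<bar>W t x\<bar>) \<le> A * (1 + ln (1 + t))"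
    using L1_growth[OF W0] by blast
  \<comment> \<open>The order of the moment is large enough to pay for the loss in the exponent and for the logarithms.\<close>
  obtain m :: nat where m: "max 1 (3 / (2 * \<epsilon>)) \<le> real m" using real_arch_simple by blast
  then have m1: "m \<ge> 1" and m\<epsilon>: "3 / 2 \<le> real m * \<epsilon>" using \<epsilon> by (auto simp: field_simps)
  obtain K where K: "K \<ge> 0" and moment: "\<And>t. t \<ge> 0 \<Longrightarrow> (LINT x|lebesgue. W t x ^ (2 * m))
     \<le> K * (A * (1 + ln (1 + t))) ^ (2 * m) * (1 + t) powr (1 / 2 - real m)"
    using even_moment_decay[OF m1 A mass] by blast
  define N where "N = 2 * M + 4 * L\<^sup>2 * \<Lambda>"
  have "0 \<le> (LINT x|lebesgue. (Wx 0 x)\<^sup>2)" by simp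
  then have N: "N \<ge> 0" using Wx_square_bound[of 0] unfolding N_def by linarith
  define n where "n = 2 * m + 2"
  define B where "B = A * (1 + 1 / (\<epsilon> / 2))"
  have B: "B > 0" using A \<epsilon> unfolding B_def by (intro mult_pos_pos add_pos_pos) auto
  define Q where "Q = (real (m + 1))\<^sup>2 * (K * B ^ (2 * m)) * N"
  have Q: "Q \<ge> 0" using K B N unfolding Q_def by (intro mult_nonneg_nonneg) auto
  define C where "C = root n Q + \<delta>_const + 1"
  have n: "n > 0" by (simp add: n_def)
  have C: "C > 0" using Q \<delta>_const_nonneg n unfolding C_def by (intro add_nonneg_pos add_nonneg_nonneg) auto
  have "\<bar>wave_error t x\<bar> \<le> C * (1 + t) powr (- (1 / 2) + \<epsilon>)" if t: "t \<ge> 0" for t x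
  proof -
    define \<tau> where "\<tau> = 1 + t"
    have \<tau>: "\<tau> \<ge> 1" using t by (simp add: \<tau>_def)
    define s where "s = \<tau> powr (- (1 / 2) + \<epsilon>)"
    have s: "s > 0" using \<tau> by (simp add: s_def)
    have "A * (1 + ln \<tau>) \<le> A * ((1 + 1 / (\<epsilon> / 2)) * \<tau> powr (\<epsilon> / 2))"
      unfolding \<tau>_def using A \<epsilon> by (intro mult_left_mono one_plus_ln_le_powr[OF t]) auto
    then have "(A * (1 + ln \<tau>)) ^ (2 * m) \<le> (B * \<tau> powr (\<epsilon> / 2)) ^ (2 * m)"
      using A \<tau> by (intro power_mono) (auto simp: B_def mult.assoc)
    also have "\<dots> = B ^ (2 * m) * \<tau> powr (real m * \<epsilon>)"
      using \<tau> by (simp add: power_mult_distrib powr_realpow[symmetric] powr_powr mult.commute)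
    finally have logs: "(A * (1 + ln \<tau>)) ^ (2 * m) \<le> B ^ (2 * m) * \<tau> powr (real m * \<epsilon>)" .
    have "(LINT x|lebesgue. W t x ^ (2 * m)) \<le> K * (B ^ (2 * m) * \<tau> powr (real m * \<epsilon>)) * \<tau> powr (1 / 2 - real m)"
      using moment[OF t] mult_right_mono[OF mult_left_mono[OF logs K], of "\<tau> powr (1 / 2 - real m)"]
      by (simp add: \<tau>_def)
    also have "\<dots> = (K * B ^ (2 * m)) * \<tau> powr (real m * \<epsilon> + (1 / 2 - real m))"
      by (simp add: powr_add)
    also have "\<dots> \<le> (K * B ^ (2 * m)) * s ^ n"
    proof (rule mult_left_mono)
      have "s ^ n = \<tau> powr ((- (1 / 2) + \<epsilon>) * real n)"
        using \<tau> by (simp add: s_def powr_powr flip: powr_realpow)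
      moreover have "real m * \<epsilon> + (1 / 2 - real m) \<le> (- (1 / 2) + \<epsilon>) * real n"
        using m\<epsilon> \<epsilon> by (simp add: n_def algebra_simps)
      ultimately show "\<tau> powr (real m * \<epsilon> + (1 / 2 - real m)) \<le> s ^ n"
        using \<tau> by (simp add: powr_mono)
    qed (use K B in auto)
    finally have y: "(LINT x|lebesgue. W t x ^ (2 * m)) \<le> (K * B ^ (2 * m)) * s ^ n" .
    have "sup_W t ^ n \<le> (real (m + 1))\<^sup>2 * (LINT x|lebesgue. W t x ^ (2 * m)) * (LINT x|lebesgue. (Wx t x)\<^sup>2)"
      unfolding n_def by (rule sup_by_moment_and_gradient[OF t m1])
    also have "\<dots> \<le> (real (m + 1))\<^sup>2 * ((K * B ^ (2 * m)) * s ^ n) * N"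
      unfolding N_def using y K B s by (intro mult_mono Wx_square_bound t) auto
    also have "\<dots> = Q * s ^ n" by (simp add: Q_def mult_ac)
    also have "\<dots> = (root n Q * s) ^ n" using n Q by (simp add: power_mult_distrib)
    finally have "sup_W t \<le> root n Q * s"
      using n Q s by (metis mult_nonneg_nonneg less_imp_le power_mono_iff real_root_ge_zero sup_W_nonneg t)
    moreover have "\<bar>\<delta> t x\<bar> \<le> \<delta>_const * s"
    proof -
      have "\<bar>\<delta> t x\<bar> \<le> \<delta>_const * \<tau> powr (- 1)" using \<delta>_bound[OF t, of x] \<tau> by (simp add: \<tau>_def powr_minus divide_inverse)
      also have "\<dots> \<le> \<delta>_const * s" unfolding s_def using \<delta>_const_nonneg \<tau> \<epsilon> by (intro mult_left_mono powr_mono) auto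
      finally show ?thesis .
    qed
    moreover have "\<bar>wave_error t x\<bar> \<le> sup_W t + \<bar>\<delta> t x\<bar>" using sup_W_upper[OF t, of x] by (simp add: wave_error_def)
    ultimately have "\<bar>wave_error t x\<bar> \<le> (root n Q + \<delta>_const + 1) * s" using s by (simp add: distrib_right)
    then show ?thesis by (simp add: C_def s_def \<tau>_def)
  qed
  with C show ?thesis by blast
qed

end

section \<open>The decay theorem\<close>

lemma C_diff_has_derivative:
  assumes "C_diff n g" "j < n"
  shows "((deriv ^^ j) g has_real_derivative (deriv ^^ Suc j) g x) (at x)"
  using assms unfolding C_diff_def differentiable_on_def
  by (auto simp: DERIV_deriv_iff_real_differentiable)

lemma C_diff_continuous:
  assumes "C_diff n g" "j \<le> n" shows "continuous_on UNIV ((deriv ^^ j) g)"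
  using assms unfolding C_diff_def
  by (cases "j = n") (auto intro: differentiable_imp_continuous_on)

lemma Lq_cong_AE:
  assumes "g \<in> Lq q" "AE x in lebesgue. g x = h x"
  shows "h \<in> Lq q" "Lq_norm q h = Lq_norm q g"
proof -
  have g: "g \<in> borel_measurable lebesgue" "integrable lebesgue (\<lambda>x. \<bar>g x\<bar> powr q)"
    using assms(1) by (auto simp: Lq_def)
  have h: "h \<in> borel_measurable lebesgue" by (rule borel_measurable_AE[OF g(1) assms(2)])
  then have hm: "(\<lambda>x. \<bar>h x\<bar> powr q) \<in> borel_measurable lebesgue" by measurable
  have eq: "AE x in lebesgue. \<bar>g x\<bar> powr q = \<bar>h x\<bar> powr q"
    using assms(2) by eventually_elim simp
  show "h \<in> Lq q" using integrable_cong_AE_imp[OF g(2) hm eq] h by (simp add: Lq_def)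
  have "(LINT x|lebesgue. \<bar>g x\<bar> powr q) = (LINT x|lebesgue. \<bar>h x\<bar> powr q)"
    by (rule integral_cong_AE[OF _ hm eq]) (use g in auto)
  then show "Lq_norm q h = Lq_norm q g" by (simp add: Lq_norm_def)
qed

lemma Linf_norm_le:
  assumes "h \<in> borel_measurable lebesgue" "AE x in lebesgue. \<bar>h x\<bar> \<le> c"
  shows "Linf_norm h \<le> ereal c"
  unfolding Linf_norm_def
proof (rule esssup_I)
  show "(\<lambda>x. ereal \<bar>h x\<bar>) \<in> borel_measurable lebesgue" using assms(1) by measurable
  show "AE x in lebesgue. ereal \<bar>h x\<bar> \<le> ereal c" using assms(2) by eventually_elim simp
qed

theorem theorem1p7:
  fixes f \<sigma> u0 :: "real \<Rightarrow> real" and p um up :: real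
  assumes "p > 1 / 3" and "um < up"
    and "C_diff 4 f" and "\<forall>v. (deriv ^^ 2) f v > 0"
    and "C_diff 2 \<sigma>" and "\<sigma> 0 = 0" and "\<forall>v. deriv \<sigma> v > 0"
    and "sim_infinity (\<lambda>v. \<bar>\<sigma> v\<bar>) (\<lambda>v. \<bar>v\<bar> powr p)"
    and "sim_infinity (\<lambda>v. \<bar>deriv \<sigma> v\<bar>) (\<lambda>v. \<bar>v\<bar> powr (p - 1))"
    and "(\<lambda>x. u0 x - riemann_data um up x) \<in> Lq 2"
    and "\<exists>u0'. has_weak_deriv u0 u0' \<and> u0' \<in> Hk 1"
    and "(\<lambda>x. u0 x - riemann_data um up x) \<in> Lq 1"
    and "(u0 \<longlongrightarrow> um) at_bot" and "(u0 \<longlongrightarrow> up) at_top"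
  shows "(\<forall>\<epsilon>>0. \<exists>C>0. \<forall>u. global_solution f \<sigma> um up u0 u \<longrightarrow>
            (\<forall>t\<ge>0. (\<lambda>x. u t x - rarefaction f um up t x) \<in> Lq 1 \<and>
                   Lq_norm 1 (\<lambda>x. u t x - rarefaction f um up t x) \<le> C * (1 + t) powr \<epsilon>))
       \<and> (\<forall>q>1. \<exists>C>0. \<forall>u. global_solution f \<sigma> um up u0 u \<longrightarrow>
            (\<forall>t\<ge>0. (\<lambda>x. u t x - rarefaction f um up t x) \<in> Lq q \<and>
                   Lq_norm q (\<lambda>x. u t x - rarefaction f um up t x)
                     \<le> C * (1 + t) powr (- (1 / 2) * (1 - 1 / q)) * max 1 (ln (1 + t))))
       \<and> (\<forall>\<epsilon>>0. \<exists>C>0. \<forall>u. global_solution f \<sigma> um up u0 u \<longrightarrow>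
            (\<forall>t\<ge>0. Linf_norm (\<lambda>x. u t x - rarefaction f um up t x)
                     \<le> ereal (C * (1 + t) powr (- (1 / 2) + \<epsilon>))))"
proof (cases "\<exists>u. global_solution f \<sigma> um up u0 u")
  case False
  then show ?thesis by (auto intro!: exI[of _ 1])
next
  case True
  then obtain v where v: "global_solution f \<sigma> um up u0 v" by blast
  have f_derivs: "(f has_real_derivative deriv f x) (at x)" "(deriv f has_real_derivative (deriv ^^ 2) f x) (at x)"
    "((deriv ^^ 2) f has_real_derivative (deriv ^^ 3) f x) (at x)" for x
    using C_diff_has_derivative[OF assms(3), of 0 x] C_diff_has_derivative[OF assms(3), of 1 x]
      C_diff_has_derivative[OF assms(3), of 2 x] by (simp_all add: numeral_2_eq_2 numeral_3_eq_3)
  have f3: "continuous_on UNIV ((deriv ^^ 3) f)" using C_diff_continuous[OF assms(3), of 3] by simp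
  have \<sigma>_deriv: "(\<sigma> has_real_derivative deriv \<sigma> x) (at x)" for x
    using C_diff_has_derivative[OF assms(5), of 0 x] by simp
  have \<sigma>_deriv_cont: "continuous_on UNIV (deriv \<sigma>)" using C_diff_continuous[OF assms(5), of 1] by simp
  have conts: "continuous_on UNIV f" "continuous_on UNIV (deriv f)" "continuous_on UNIV \<sigma>"
    using C_diff_continuous[OF assms(3), of 0] C_diff_continuous[OF assms(3), of 1] C_diff_continuous[OF assms(5), of 0] by auto
  obtain M vt V Vx where reg: "regular_solution f \<sigma> um up M v vt V Vx"
    using global_solution_imp_regular[OF v conts(1,3)] by blast
  interpret viscous_solution f "deriv f" "(deriv ^^ 2) f" "(deriv ^^ 3) f" um up \<sigma> "deriv \<sigma>" M v vt V Vx
    by unfold_locales (use f_derivs f3 assms(2,4,6,7) \<sigma>_deriv \<sigma>_deriv_cont reg in auto)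
  have v0: "AE x in lebesgue. v 0 x = u0 x" using v by (auto simp: global_solution_def)
  have W0: "integrable lebesgue (W 0)" by (rule initial_mass[OF v0 assms(12)])
  have same: "AE x in lebesgue. wave_error t x = u t x - rarefaction f um up t x"
    if u: "global_solution f \<sigma> um up u0 u" and t: "t \<ge> 0" for u t
  proof -
    obtain N ut U Ux where "regular_solution f \<sigma> um up N u ut U Ux"
      using global_solution_imp_regular[OF u conts(1,3)] by blast
    moreover have "AE x in lebesgue. u 0 x = u0 x" using u by (auto simp: global_solution_def)
    then have "AE x in lebesgue. u 0 x = v 0 x" using v0 by eventually_elim simp
    ultimately have "AE x in lebesgue. u t x = v t x"
      using regular_solution_unique[OF f_derivs(1) conts(2) \<sigma>_deriv \<sigma>_deriv_cont _ _ reg _ t] assms(7) by blast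
    then show ?thesis
      using sol(1)[OF t] by eventually_elim (simp add: wave_error_def W_def \<delta>_def \<rho>_rarefaction[OF refl t])
  qed
  show ?thesis
  proof (intro conjI allI impI)
    fix \<epsilon> :: real assume "\<epsilon> > 0"
    then obtain C where "C > 0" "\<forall>t\<ge>0. wave_error t \<in> Lq 1 \<and> Lq_norm 1 (wave_error t) \<le> C * (1 + t) powr \<epsilon>"
      using L1_estimate[OF W0] by blast
    then show "\<exists>C>0. \<forall>u. global_solution f \<sigma> um up u0 u \<longrightarrow>
            (\<forall>t\<ge>0. (\<lambda>x. u t x - rarefaction f um up t x) \<in> Lq 1 \<and>
                   Lq_norm 1 (\<lambda>x. u t x - rarefaction f um up t x) \<le> C * (1 + t) powr \<epsilon>)"
      using Lq_cong_AE[OF _ same] by (intro exI[of _ C]) auto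
  next
    fix q :: real assume "q > 1"
    then obtain C where "C > 0" "\<forall>t\<ge>0. wave_error t \<in> Lq q \<and>
        Lq_norm q (wave_error t) \<le> C * (1 + t) powr (- (1 / 2) * (1 - 1 / q)) * max 1 (ln (1 + t))"
      using Lq_estimate[OF W0] by blast
    then show "\<exists>C>0. \<forall>u. global_solution f \<sigma> um up u0 u \<longrightarrow>
            (\<forall>t\<ge>0. (\<lambda>x. u t x - rarefaction f um up t x) \<in> Lq q \<and>
                   Lq_norm q (\<lambda>x. u t x - rarefaction f um up t x)
                     \<le> C * (1 + t) powr (- (1 / 2) * (1 - 1 / q)) * max 1 (ln (1 + t)))"
      using Lq_cong_AE[OF _ same] by (intro exI[of _ C]) auto
  next
    fix \<epsilon> :: real assume "\<epsilon> > 0"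
    then obtain C where C: "C > 0" "\<forall>t\<ge>0. \<forall>x. \<bar>wave_error t x\<bar> \<le> C * (1 + t) powr (- (1 / 2) + \<epsilon>)"
      using Linf_estimate[OF W0] by blast
    have "Linf_norm (\<lambda>x. u t x - rarefaction f um up t x) \<le> ereal (C * (1 + t) powr (- (1 / 2) + \<epsilon>))"
      if u: "global_solution f \<sigma> um up u0 u" and t: "t \<ge> 0" for u t
    proof (rule Linf_norm_le)
      show "(\<lambda>x. u t x - rarefaction f um up t x) \<in> borel_measurable lebesgue"
        by (rule borel_measurable_AE[OF wave_error_borel[OF t] same[OF u t]])
      show "AE x in lebesgue. \<bar>u t x - rarefaction f um up t x\<bar> \<le> C * (1 + t) powr (- (1 / 2) + \<epsilon>)"
        using same[OF u t]
      proof eventually_elim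
        case (elim x)
        have "\<bar>wave_error t x\<bar> \<le> C * (1 + t) powr (- (1 / 2) + \<epsilon>)" using C(2) t by blast
        with elim show ?case by simp
      qed
    qed
    with C(1) show "\<exists>C>0. \<forall>u. global_solution f \<sigma> um up u0 u \<longrightarrow>
            (\<forall>t\<ge>0. Linf_norm (\<lambda>x. u t x - rarefaction f um up t x)
                     \<le> ereal (C * (1 + t) powr (- (1 / 2) + \<epsilon>)))"
      by (intro exI[of _ C]) auto
  qed
qed

end
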